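(* Let $\Omega\subset\mathbb R^d$ be a $C^{1,\operatorname{Dini}}$ domain, $B$ be a ball centered in $\partial\Omega$, and $\Sigma=B\cap\partial\Omega$. Let $u$ be a harmonic function defined in $\Omega$, continuous in $\overline\Omega$, that vanishes in $\Sigma$. Then $\mathcal S_\Sigma(u)$ coincides with $\mathcal S'_\Sigma(u)$, where $$\mathcal S_\Sigma(u)=\{x\in\Sigma\mid |\nabla u(x)|=0\},\qquad \mathcal S'_\Sigma(u)=\{x\in\Sigma\mid u^{-1}(\{0\})\cap B(x,r)\cap\Omega\ne\varnothing\ \text{ for all } r>0\}.$$
   Context: A $C^{1,\operatorname{Dini}}$ domain is a domain whose boundary is locally the graph of a $C^1$ function $\varphi$ whose gradient has a Dini modulus of continuity: $|\nabla\varphi(x)-\nabla\varphi(y)|\le\theta(|x-y|)$ with $\theta$ nondecreasing and $\int_0^1\theta(r)\frac{dr}{r}<\infty$. In this setting $u\in C^1(\Omega\cup\Sigma)$, so $\nabla u(x)$ is well defined for $x\in\Sigma$. *)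

theory Defs
  imports "HOL-Analysis.Analysis"
begin

text \<open>
  The monotonicity and the bounds make \<open>\<theta>\<close> measurable and nonnegative, so that integrability of
  \<open>\<theta>(r) / r\<close> says exactly that the Dini integral is finite; it also forces \<open>\<theta>(r) \<rightarrow> 0\<close> as
  \<open>r \<rightarrow> 0\<close>.
\<close>

definition dini_modulus :: "(real \<Rightarrow> real) \<Rightarrow> bool" where
  "dini_modulus \<theta> \<longleftrightarrow>
     (\<forall>r\<ge>0. 0 \<le> \<theta> r) \<and> mono_on {0..} \<theta> \<and>
     set_integrable lborel {0<..1} (\<lambda>r. \<theta> r / r)"

definition hyperplane_proj :: "'a::euclidean_space \<Rightarrow> 'a \<Rightarrow> 'a" where
  "hyperplane_proj \<nu> y = y - (y \<bullet> \<nu>) *\<^sub>R \<nu>"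

text \<open>
  A boundary chart in the rotated coordinates \<open>y = y' + t \<nu>\<close>, with \<open>\<nu>\<close> a unit vector and \<open>y'\<close> in the
  hyperplane orthogonal to \<open>\<nu>\<close>, which plays the role of the space of dimension one less.  The
  function \<open>\<phi>\<close> and its gradient \<open>g\<close> matter only on the disc \<open>D\<close> of that hyperplane; \<open>D\<close> is the
  projection of the ball around \<open>p\<close>.  Continuity of \<open>g\<close> follows from the Dini modulus.  As usual for
  domains of this kind, \<open>\<Omega>\<close> lies on one side of the graph.
\<close>

definition C1_dini_chart ::
    "'a::euclidean_space set \<Rightarrow> 'a \<Rightarrow> real \<Rightarrow> 'a \<Rightarrow> ('a \<Rightarrow> real) \<Rightarrow> bool" where
  "C1_dini_chart \<Omega> p r \<nu> \<phi> \<longleftrightarrow>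
     0 < r \<and> norm \<nu> = 1 \<and>
     (let H = {y. y \<bullet> \<nu> = 0}; D = H \<inter> ball (hyperplane_proj \<nu> p) r in
       \<exists>g \<theta>. dini_modulus \<theta> \<and>
         (\<forall>y\<in>D. g y \<in> H \<and> (\<phi> has_derivative (\<lambda>h. g y \<bullet> h)) (at y within H)) \<and>
         (\<forall>y\<in>D. \<forall>z\<in>D. norm (g y - g z) \<le> \<theta> (norm (y - z)))) \<and>
     \<Omega> \<inter> ball p r = {y \<in> ball p r. \<phi> (hyperplane_proj \<nu> y) < y \<bullet> \<nu>} \<and>
     frontier \<Omega> \<inter> ball p r = {y \<in> ball p r. y \<bullet> \<nu> = \<phi> (hyperplane_proj \<nu> y)}"

definition C1_dini_domain :: "'a::euclidean_space set \<Rightarrow> bool" where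
  "C1_dini_domain \<Omega> \<longleftrightarrow>
     open \<Omega> \<and> connected \<Omega> \<and> \<Omega> \<noteq> {} \<and>
     (\<forall>p\<in>frontier \<Omega>. \<exists>r \<nu> \<phi>. C1_dini_chart \<Omega> p r \<nu> \<phi>)"

text \<open>
  \<open>u\<close> is twice continuously differentiable on \<open>\<Omega>\<close>, with gradient \<open>G\<close> and Hessian \<open>H\<close>, and the trace
  of the Hessian vanishes.
\<close>

definition harmonic_fun_on :: "'a::euclidean_space set \<Rightarrow> ('a \<Rightarrow> real) \<Rightarrow> bool" where
  "harmonic_fun_on \<Omega> u \<longleftrightarrow>
     (\<exists>(G :: 'a \<Rightarrow> 'a) (H :: 'a \<Rightarrow> 'a \<Rightarrow> 'a).
        (\<forall>x\<in>\<Omega>. GDERIV u x :> G x \<and> (G has_derivative H x) (at x)) \<and>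
        (\<forall>b\<in>Basis. continuous_on \<Omega> (\<lambda>x. H x b)) \<and>
        (\<forall>x\<in>\<Omega>. (\<Sum>b\<in>Basis. H x b \<bullet> b) = 0))"

definition has_gradient_within ::
    "('a::euclidean_space \<Rightarrow> real) \<Rightarrow> 'a \<Rightarrow> 'a \<Rightarrow> 'a set \<Rightarrow> bool" where
  "has_gradient_within u G x S \<longleftrightarrow> (u has_derivative (\<lambda>h. G \<bullet> h)) (at x within S)"

text \<open>
  The gradient at a point of \<open>\<Sigma>\<close> is that of \<open>u\<close> as a function on \<open>\<Omega> \<union> \<Sigma>\<close>, with no reference to the
  values of \<open>u\<close> beyond the boundary.  It is unique because \<open>\<Omega>\<close> contains a truncated open cone with
  vertex at the point.  A relation is used so that no value is assigned where \<open>u\<close> is not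
  differentiable.
\<close>

definition singular_set ::
    "'a::euclidean_space set \<Rightarrow> 'a set \<Rightarrow> ('a \<Rightarrow> real) \<Rightarrow> 'a set" where
  "singular_set \<Omega> \<Sigma> u = {x \<in> \<Sigma>. \<exists>G. has_gradient_within u G x (\<Omega> \<union> \<Sigma>) \<and> norm G = 0}"

definition zero_accumulation_set ::
    "'a::euclidean_space set \<Rightarrow> 'a set \<Rightarrow> ('a \<Rightarrow> real) \<Rightarrow> 'a set" where
  "zero_accumulation_set \<Omega> \<Sigma> u = {x \<in> \<Sigma>. \<forall>r>0. u -` {0} \<inter> ball x r \<inter> \<Omega> \<noteq> {}}"

end

theory Submission
  imports Defs
begin

text \<open>
  At a boundary point \<open>p\<close> with unit normal \<open>n\<close> and at scale \<open>r\<close>, write \<open>X y = (y - p) \<bullet> n\<close> and suppose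
  \<open>A X - E r \<le> u \<le> B X + E r\<close> near \<open>p\<close>.  Going to a smaller scale, explicit harmonic
  polynomials as barriers turn the error \<open>E r\<close> into a change of the slopes \<open>A\<close>, \<open>B\<close>, up to a new error proportional to
  the flatness of the boundary, and the Harnack inequality shrinks \<open>B - A\<close> by a
  fixed factor.  The Dini condition says that the flatness is summable over geometric scales, so the
  slopes converge, uniformly in \<open>p\<close>.

  If zeros in \<open>\<Omega>\<close> accumulate at \<open>x\<close>, then at the boundary point below such a zero the slopes are
  small at the scale of the zero, hence small at all larger scales; letting the zero tend to \<open>x\<close> gives
  \<open>u = o(\<bar>y - x\<bar>)\<close>.  If there are no zeros near \<open>x\<close>, then \<open>u\<close> has a sign there, and
  the one-sided iteration started from a positive slope keeps the slope positive (Hopf's lemma), so the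
  gradient at \<open>x\<close> cannot vanish.
\<close>

subsection \<open>Harmonic functions and the minimum principle\<close>

text \<open>The zeros in \<open>\<Omega>\<close> need not lie on the normal through
  \<open>x\<close>, so each is studied from its own foot point. For this the constants and the
  sequence of flatness bounds must be common to all boundary points near \<open>x\<close>, and rates
  are produced before \<open>\<Omega>\<close>, \<open>u\<close> and \<open>p\<close> are quantified.
  A zero at height comparable to \<open>r\<close> above its foot point gives
  \<open>A X - E r \<le> 0 \<le> B X + E r\<close>, so \<open>A\<close> is not much above 0 and
  \<open>B\<close> not much below it. This is carried back to larger scales: a change of slope is
  paid for by a loss of the width \<open>B - A\<close>, up to a summable error, so the total drift
  is controlled by the width at the larger scale. The additive error lets the iteration start at
  \<open>A = B = 0\<close> from a mere bound on \<open>u\<close>. Differentiability at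
  \<open>x\<close> comes out of the slab estimate itself. The scale ratio \<open>8 * d\<close>, with
  \<open>d\<close> the dimension, comes from the barrier \<open>|q|^2 - d X^2\<close>: the factor
  \<open>d\<close> makes it harmonic, and in a slab of height \<open>r / (8 * d)\<close> its
  negative part stays below its growth towards the sides.\<close>

lemma harmonic_fun_on_subset:
  "harmonic_fun_on S u \<Longrightarrow> T \<subseteq> S \<Longrightarrow> harmonic_fun_on T u"
  unfolding harmonic_fun_on_def subset_iff
  by (elim exE conjE, intro exI conjI ballI) (auto intro: continuous_on_subset)

lemma harmonic_fun_on_imp_continuous_on:
  assumes "harmonic_fun_on S u"
  shows "continuous_on S u"
proof (rule continuous_at_imp_continuous_on, rule ballI)
  fix x assume "x \<in> S"
  then obtain D where "(u has_derivative (\<lambda>h. h \<bullet> D)) (at x)"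
    using assms unfolding harmonic_fun_on_def gderiv_def by blast
  then show "isCont u x" by (rule has_derivative_continuous)
qed

lemma harmonic_fun_on_add:
  assumes "harmonic_fun_on S u" "harmonic_fun_on S v"
  shows "harmonic_fun_on S (\<lambda>x. u x + v x)"
proof -
  obtain G H where 1: "\<forall>x\<in>S. GDERIV u x :> G x \<and> (G has_derivative H x) (at x)"
    "\<forall>b\<in>Basis. continuous_on S (\<lambda>x. H x b)" "\<forall>x\<in>S. (\<Sum>b\<in>Basis. H x b \<bullet> b) = 0"
    using assms(1) unfolding harmonic_fun_on_def by blast
  obtain G' H' where 2: "\<forall>x\<in>S. GDERIV v x :> G' x \<and> (G' has_derivative H' x) (at x)"
    "\<forall>b\<in>Basis. continuous_on S (\<lambda>x. H' x b)" "\<forall>x\<in>S. (\<Sum>b\<in>Basis. H' x b \<bullet> b) = 0"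
    using assms(2) unfolding harmonic_fun_on_def by blast
  show ?thesis unfolding harmonic_fun_on_def
  proof (intro exI[of _ "\<lambda>x. G x + G' x"] exI[of _ "\<lambda>x h. H x h + H' x h"] conjI ballI)
  qed (use 1 2 in \<open>auto intro!: GDERIV_add has_derivative_add continuous_on_add
        simp: inner_add_left sum.distrib\<close>)
qed

lemma harmonic_fun_on_cmult:
  assumes "harmonic_fun_on S u"
  shows "harmonic_fun_on S (\<lambda>x. c * u x)"
proof -
  obtain G H where 1: "\<forall>x\<in>S. GDERIV u x :> G x \<and> (G has_derivative H x) (at x)"
    "\<forall>b\<in>Basis. continuous_on S (\<lambda>x. H x b)" "\<forall>x\<in>S. (\<Sum>b\<in>Basis. H x b \<bullet> b) = 0"
    using assms(1) unfolding harmonic_fun_on_def by blast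
  show ?thesis unfolding harmonic_fun_on_def
  proof (intro exI[of _ "\<lambda>x. c *\<^sub>R G x"] exI[of _ "\<lambda>x h. c *\<^sub>R H x h"] conjI ballI)
    show "GDERIV (\<lambda>x. c * u x) x :> c *\<^sub>R G x" if "x \<in> S" for x
      using 1 that by (auto simp: gderiv_def intro!: has_derivative_mult_right)
  qed (use 1 in \<open>auto intro!: has_derivative_scaleR_right continuous_on_scaleR
        continuous_intros simp flip: sum_distrib_left\<close>)
qed

lemma harmonic_fun_on_uminus:
  "harmonic_fun_on S u \<Longrightarrow> harmonic_fun_on S (\<lambda>x. - u x)"
  using harmonic_fun_on_cmult[of S u "-1"] by simp

lemma harmonic_fun_on_diff:
  "harmonic_fun_on S u \<Longrightarrow> harmonic_fun_on S v \<Longrightarrow> harmonic_fun_on S (\<lambda>x. u x - v x)"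
  using harmonic_fun_on_add[of S u "\<lambda>x. - v x"] harmonic_fun_on_uminus[of S v] by simp

lemma harmonic_fun_on_const: "harmonic_fun_on S (\<lambda>x. c)"
  unfolding harmonic_fun_on_def
  by (intro exI[of _ "\<lambda>x. 0"] exI[of _ "\<lambda>x h. 0"]) (auto simp: GDERIV_const)

lemma harmonic_fun_on_linear: "harmonic_fun_on S (\<lambda>x. (x - p) \<bullet> n)"
  unfolding harmonic_fun_on_def gderiv_def
  by (intro exI[of _ "\<lambda>x. n"] exI[of _ "\<lambda>x h. 0"])
     (auto intro!: derivative_eq_intros)

text \<open>Both terms have Laplacian \<open>2 * DIM('a)\<close>, the second one because
  \<open>n\<close> is a unit vector. The centre \<open>q\<close> is independent of \<open>p\<close>,
  so that the barrier can be centred below the point where it is evaluated.\<close>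

lemma harmonic_fun_on_quadratic:
  fixes n :: "'a::euclidean_space"
  assumes "norm n = 1"
  shows "harmonic_fun_on S (\<lambda>x. (x - q) \<bullet> (x - q) - DIM('a) * ((x - p) \<bullet> n)\<^sup>2)"
  unfolding harmonic_fun_on_def
proof (intro exI[of _ "\<lambda>x. 2 *\<^sub>R (x - q) - (2 * real DIM('a) * ((x - p) \<bullet> n)) *\<^sub>R n"]
    exI[of _ "\<lambda>x h. 2 *\<^sub>R h - (2 * real DIM('a) * (h \<bullet> n)) *\<^sub>R n"] conjI ballI)
  fix x
  show "GDERIV (\<lambda>x. (x - q) \<bullet> (x - q) - real DIM('a) * ((x - p) \<bullet> n)\<^sup>2) x :>
          2 *\<^sub>R (x - q) - (2 * real DIM('a) * ((x - p) \<bullet> n)) *\<^sub>R n"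
    unfolding gderiv_def
    by (auto intro!: derivative_eq_intros ext simp: algebra_simps inner_commute power2_eq_square)
  show "((\<lambda>x. 2 *\<^sub>R (x - q) - (2 * real DIM('a) * ((x - p) \<bullet> n)) *\<^sub>R n) has_derivative
          (\<lambda>h. 2 *\<^sub>R h - (2 * real DIM('a) * (h \<bullet> n)) *\<^sub>R n)) (at x)"
    by (auto intro!: derivative_eq_intros ext simp: algebra_simps)
  have "(\<Sum>b\<in>Basis. (n \<bullet> b) * (n \<bullet> b)) = 1"
    using assms euclidean_inner[of n n] by (simp add: dot_square_norm)
  moreover have "(\<Sum>b\<in>Basis. (2 *\<^sub>R b - (2 * real DIM('a) * (b \<bullet> n)) *\<^sub>R n) \<bullet> b)
      = (\<Sum>b\<in>(Basis::'a set). 2) - 2 * real DIM('a) * (\<Sum>b\<in>Basis. (n \<bullet> b) * (n \<bullet> b))"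
    unfolding sum_distrib_left sum_subtractf[symmetric]
    by (intro sum.cong refl) (simp add: inner_diff_left inner_commute[of _ n])
  ultimately show "(\<Sum>b\<in>Basis. (2 *\<^sub>R b - (2 * real DIM('a) * (b \<bullet> n)) *\<^sub>R n) \<bullet> b) = 0"
    by simp
qed (intro continuous_intros)

text \<open>On the line through \<open>x\<close> in direction \<open>b\<close> the derivative of
  \<open>f\<close> vanishes at \<open>x\<close>. If \<open>H b \<bullet> b\<close> were negative, it
  would be negative just after \<open>x\<close>, and \<open>f\<close> would fall below its
  minimum.\<close>

lemma local_min_second_derivative_nonneg:
  fixes f :: "'a::euclidean_space \<Rightarrow> real"
  assumes "open S" "x \<in> S" and min: "\<And>y. y \<in> S \<Longrightarrow> f x \<le> f y"
    and G: "\<And>y. y \<in> S \<Longrightarrow> GDERIV f y :> G y"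
    and H: "(G has_derivative H) (at x)"
  shows "0 \<le> H b \<bullet> b"
proof (rule ccontr)
  assume neg: "\<not> 0 \<le> H b \<bullet> b"
  let ?l = "\<lambda>t::real. x + t *\<^sub>R b"
  define g where "g = (\<lambda>t. G (?l t) \<bullet> b)"
  have "open (?l -` S)" by (rule open_vimage[OF \<open>open S\<close>]) (intro continuous_intros)
  moreover have "0 \<in> ?l -` S" using \<open>x \<in> S\<close> by simp
  ultimately obtain e where "e > 0" and e': "ball 0 e \<subseteq> ?l -` S"
    by (meson openE)
  have e: "e > 0" "\<And>t. \<bar>t\<bar> < e \<Longrightarrow> ?l t \<in> S"
    using \<open>e > 0\<close> subsetD[OF e'] by auto
  have df: "((\<lambda>t. f (?l t)) has_real_derivative g t) (at t)" if "\<bar>t\<bar> < e" for t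
  proof -
    have "(f has_derivative (\<lambda>h. h \<bullet> G (?l t))) (at (?l t))"
      using G[OF e(2)[OF that]] by (simp add: gderiv_def)
    then have "((\<lambda>t. f (?l t)) has_derivative (\<lambda>s. (s *\<^sub>R b) \<bullet> G (?l t))) (at t)"
      by (rule has_derivative_compose[rotated]) (auto intro!: derivative_eq_intros)
    then show ?thesis
      by (simp add: g_def has_field_derivative_def inner_commute mult.commute[of _ "b \<bullet> _"])
  qed
  have "(G has_derivative H) (at (?l 0))" using H by simp
  then have "((\<lambda>t. G (?l t)) has_derivative (\<lambda>s. H (s *\<^sub>R b))) (at 0)"
    by (rule has_derivative_compose[rotated]) (auto intro!: derivative_eq_intros)
  then have "(g has_derivative (\<lambda>s. H (s *\<^sub>R b) \<bullet> b)) (at 0)"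
    unfolding g_def by (rule has_derivative_inner_left)
  moreover have "H (s *\<^sub>R b) = s *\<^sub>R H b" for s
    using H has_derivative_bounded_linear linear_cmul bounded_linear.linear by blast
  ultimately have dg: "(g has_real_derivative (H b \<bullet> b)) (at 0)"
    by (simp add: has_field_derivative_def mult_commute_abs)
  have g0: "g 0 = 0"
    by (rule DERIV_local_min[OF df[of 0] \<open>e > 0\<close>]) (use e min in auto)
  obtain d where d: "d > 0" "\<And>h. 0 < h \<Longrightarrow> h < d \<Longrightarrow> g h < g 0"
    using has_real_derivative_neg_dec_right[OF dg] neg by auto
  define t where "t = min d e / 2"
  have t: "0 < t" "t < d" "t < e" using d e by (auto simp: t_def)
  have "\<exists>s. 0 < s \<and> s < t \<and> f (?l t) - f (?l 0) = (t - 0) * g s"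
    by (rule MVT2) (use t df in auto)
  then obtain s where s: "0 < s" "s < t" "f (?l t) - f x = t * g s" by auto
  have "g s < 0" using d s t g0 by auto
  then have "f (?l t) < f x" using s t by (smt (verit) mult_pos_neg)
  then show False using min[OF e(2)[of t]] t by auto
qed

text \<open>Subtracting a small multiple of the squared distance to \<open>x\<close> makes the trace
  of the Hessian strictly negative, which is impossible at an interior minimum.\<close>

lemma harmonic_min_principle:
  fixes w :: "'a::euclidean_space \<Rightarrow> real"
  assumes "open Q" "bounded Q" and harm: "harmonic_fun_on Q w"
    and cont: "continuous_on (closure Q) w"
    and front: "\<And>y. y \<in> frontier Q \<Longrightarrow> m \<le> w y"
    and "x \<in> Q"
  shows "m \<le> w x"
proof (rule ccontr)
  assume "\<not> m \<le> w x"
  then have wx: "w x < m" by simp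
  obtain G H where GH: "\<And>y. y \<in> Q \<Longrightarrow> GDERIV w y :> G y"
    "\<And>y. y \<in> Q \<Longrightarrow> (G has_derivative H y) (at y)"
    "\<And>y. y \<in> Q \<Longrightarrow> (\<Sum>b\<in>Basis. H y b \<bullet> b) = 0"
    using harm unfolding harmonic_fun_on_def by blast
  obtain R where R: "R > 0" "\<And>y. y \<in> closure Q \<Longrightarrow> norm (y - x) \<le> R"
  proof -
    have "bounded ((\<lambda>y. y - x) ` closure Q)"
      by (rule bounded_translation_minus[OF bounded_closure[OF \<open>bounded Q\<close>]])
    then show ?thesis using that unfolding bounded_pos by blast
  qed
  \<comment> \<open>The perturbation is then at most half of the gap \<open>m - w x\<close> on
    \<open>closure Q\<close>, so on the frontier \<open>g\<close> still exceeds
    \<open>g x = w x\<close>.\<close>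
  define \<epsilon> where "\<epsilon> = (m - w x) / (2 * R\<^sup>2)"
  have \<epsilon>: "\<epsilon> > 0" using wx R by (auto simp: \<epsilon>_def)
  define g where "g = (\<lambda>y. w y - \<epsilon> * ((y - x) \<bullet> (y - x)))"
  have "continuous_on (closure Q) g" unfolding g_def by (intro continuous_intros cont)
  moreover have "compact (closure Q)" using \<open>bounded Q\<close> by simp
  moreover have "closure Q \<noteq> {}" using \<open>x \<in> Q\<close> closure_subset by blast
  ultimately obtain z where z: "z \<in> closure Q" "\<And>y. y \<in> closure Q \<Longrightarrow> g z \<le> g y"
    using continuous_attains_inf by metis
  have "z \<in> Q"
  proof (rule ccontr)
    assume "z \<notin> Q"
    then have "m \<le> w z" using z front \<open>open Q\<close> by (simp add: frontier_def interior_open)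
    moreover have "\<epsilon> * ((z - x) \<bullet> (z - x)) \<le> \<epsilon> * R\<^sup>2"
      using \<epsilon> R(2)[OF z(1)] by (auto intro!: power_mono simp: dot_square_norm)
    moreover have "\<epsilon> * R\<^sup>2 = (m - w x) / 2" using R by (simp add: \<epsilon>_def)
    moreover have "g z \<le> g x" using z(2) \<open>x \<in> Q\<close> closure_subset by blast
    ultimately show False using wx by (simp add: g_def)
  qed
  have "0 \<le> (H z b - (2 * \<epsilon>) *\<^sub>R b) \<bullet> b" for b
  proof (rule local_min_second_derivative_nonneg[OF \<open>open Q\<close> \<open>z \<in> Q\<close>])
    show "g z \<le> g y" if "y \<in> Q" for y using z(2) that closure_subset by blast
    show "GDERIV g y :> G y - (2 * \<epsilon>) *\<^sub>R (y - x)" if "y \<in> Q" for y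
      using GH(1)[OF that] unfolding g_def gderiv_def
      by (auto intro!: derivative_eq_intros ext simp: algebra_simps inner_commute)
    show "((\<lambda>y. G y - (2 * \<epsilon>) *\<^sub>R (y - x)) has_derivative (\<lambda>h. H z h - (2 * \<epsilon>) *\<^sub>R h)) (at z)"
      using GH(2)[OF \<open>z \<in> Q\<close>] by (auto intro!: derivative_eq_intros)
  qed
  then have "0 \<le> (\<Sum>b\<in>Basis. (H z b - (2 * \<epsilon>) *\<^sub>R b) \<bullet> b)" by (intro sum_nonneg)
  also have "\<dots> = - 2 * \<epsilon> * DIM('a)"
    using GH(3)[OF \<open>z \<in> Q\<close>] by (simp add: inner_diff_left sum_subtractf)
  also have "\<dots> < 0" using \<epsilon> by simp
  finally show False by simp
qed

subsection \<open>Weighted mean values and the Harnack inequality\<close>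

text \<open>Differentiate the translation-invariant integral of \<open>P (z + t b)\<close> at \<open>t = 0\<close>.\<close>

lemma integral_directional_derivative_eq_0:
  fixes P :: "'a::euclidean_space \<Rightarrow> real"
  assumes der: "\<And>z. (P has_derivative D z) (at z)"
    and cont: "continuous_on UNIV (\<lambda>z. D z b)"
    and supp: "\<And>z. \<rho> < norm z \<Longrightarrow> P z = 0"
  shows "integral\<^sup>L lborel (\<lambda>z. D z b) = 0"
proof -
  \<comment> \<open>The increments \<open>t i\<close> are at most 1, so beyond radius
    \<open>R\<close> all difference quotients vanish; inside, the mean value theorem bounds them by
    \<open>M\<close>. This is the dominating function.\<close>
  define R where "R = \<bar>\<rho>\<bar> + norm b"
  have contP: "continuous_on UNIV P"
    using der by (intro continuous_at_imp_continuous_on ballI has_derivative_continuous)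
  have dl: "((\<lambda>t. P (z + t *\<^sub>R b)) has_real_derivative D (z + s *\<^sub>R b) b) (at s)" for z s
  proof -
    have "((\<lambda>t. P (z + t *\<^sub>R b)) has_derivative (\<lambda>t. D (z + s *\<^sub>R b) (t *\<^sub>R b))) (at s)"
      by (rule has_derivative_compose[OF _ der]) (auto intro!: derivative_eq_intros)
    moreover have "D (z + s *\<^sub>R b) (t *\<^sub>R b) = D (z + s *\<^sub>R b) b * t" for t
      using linear_cmul[OF has_derivative_linear[OF der]] by simp
    ultimately show ?thesis by (simp add: has_field_derivative_def)
  qed
  have "compact ((\<lambda>z. D z b) ` cball 0 (R + norm b))"
    by (intro compact_continuous_image continuous_on_subset[OF cont] compact_cball subset_UNIV)
  then have "bounded ((\<lambda>z. D z b) ` cball 0 (R + norm b))"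
    by (rule compact_imp_bounded)
  then obtain M where M: "M > 0" "\<And>z. norm z \<le> R + norm b \<Longrightarrow> \<bar>D z b\<bar> \<le> M"
    unfolding bounded_pos by (auto simp: Ball_def)
  define t where "t = (\<lambda>i::nat. 1 / real (Suc i))"
  have t: "0 < t i" "t i \<le> 1" for i by (auto simp: t_def)
  define q where "q = (\<lambda>i z. (P (z + t i *\<^sub>R b) - P z) / t i)"
  have meas: "P \<in> borel_measurable borel" using contP by (rule borel_measurable_continuous_onI)
  have int: "integrable lborel P"
  proof -
    have "integrable lborel (\<lambda>z. indicator (cball 0 \<rho>) z *\<^sub>R P z)"
      by (rule borel_integrable_compact) (use contP continuous_on_subset in auto)
    moreover have "(\<lambda>z. indicator (cball 0 \<rho>) z *\<^sub>R P z) = P"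
      using supp by (force simp: indicator_def)
    ultimately show ?thesis by simp
  qed
  have shift: "integrable lborel (\<lambda>z. P (c + z))" "integral\<^sup>L lborel (\<lambda>z. P (c + z)) = integral\<^sup>L lborel P" for c
  proof -
    have "integrable (distr lborel borel ((+) c)) P" using int by (simp add: lborel_distr_plus)
    then show "integrable lborel (\<lambda>z. P (c + z))" by (subst (asm) integrable_distr_eq) (use meas in auto)
    have "integral\<^sup>L (distr lborel borel ((+) c)) P = integral\<^sup>L lborel P" by (simp add: lborel_distr_plus)
    then show "integral\<^sup>L lborel (\<lambda>z. P (c + z)) = integral\<^sup>L lborel P"
      by (subst (asm) integral_distr) (use meas in auto)
  qed
  have "(\<lambda>i. integral\<^sup>L lborel (q i)) \<longlonglongrightarrow> integral\<^sup>L lborel (\<lambda>z. D z b)"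
  proof (rule integral_dominated_convergence[where w = "\<lambda>z. M * indicator (cball 0 R) z"])
    show "(\<lambda>z. D z b) \<in> borel_measurable lborel"
      using borel_measurable_continuous_onI[OF cont] by simp
    show "q i \<in> borel_measurable lborel" for i
    proof -
      have "continuous_on UNIV (q i)" unfolding q_def
        using t(1)[of i] by (auto intro!: continuous_intros continuous_on_compose2[OF contP])
      then show ?thesis using borel_measurable_continuous_onI by simp
    qed
    show "integrable lborel (\<lambda>z::'a. M * indicator (cball 0 R) z)"
      by (intro integrable_mult_right integrable_real_indicator) (use emeasure_bounded_finite[OF bounded_cball[of "0::'a" R]] in auto)
    show "AE z in lborel. (\<lambda>i. q i z) \<longlonglongrightarrow> D z b"
    proof (rule AE_I2)
      fix z
      have "((\<lambda>h. (P (z + h *\<^sub>R b) - P z) / h) \<longlongrightarrow> D z b) (at 0)"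
        using dl[of z 0] by (simp add: DERIV_def)
      moreover have "filterlim t (at 0) sequentially"
        unfolding t_def filterlim_at using LIMSEQ_inverse_real_of_nat
        by (auto simp: inverse_eq_divide)
      ultimately show "(\<lambda>i. q i z) \<longlonglongrightarrow> D z b" unfolding q_def by (rule filterlim_compose)
    qed
    show "AE z in lborel. norm (q i z) \<le> M * indicator (cball 0 R) z" for i
    proof (rule AE_I2)
      fix z :: 'a
      show "norm (q i z) \<le> M * indicator (cball 0 R) z"
      proof (cases "norm z \<le> R")
        case True
        have "\<exists>s. 0 < s \<and> s < t i \<and> P (z + t i *\<^sub>R b) - P (z + 0 *\<^sub>R b) = (t i - 0) * D (z + s *\<^sub>R b) b"
          by (rule MVT2) (use t dl in auto)
        then obtain s where s: "0 < s" "s < t i" "P (z + t i *\<^sub>R b) - P z = t i * D (z + s *\<^sub>R b) b"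
          by auto
        have "norm (z + s *\<^sub>R b) \<le> R + 1 * norm b"
          using True s t(2)[of i] mult_right_mono[of s 1 "norm b"] by (intro norm_triangle_le add_mono) auto
        then have "\<bar>D (z + s *\<^sub>R b) b\<bar> \<le> M" using M by simp
        moreover have "q i z = D (z + s *\<^sub>R b) b" using s t(1)[of i] by (simp add: q_def)
        ultimately show ?thesis using True by (simp add: indicator_def)
      next
        case False
        have "norm z - norm (t i *\<^sub>R b) \<le> norm (z + t i *\<^sub>R b)" by (metis norm_diff_ineq)
        moreover have "norm (t i *\<^sub>R b) \<le> 1 * norm b"
          using t[of i] mult_right_mono[of "t i" 1 "norm b"] by auto
        ultimately have "\<rho> < norm (z + t i *\<^sub>R b)" "\<rho> < norm z"
          using False norm_ge_zero[of b] unfolding R_def by linarith+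
        then show ?thesis using supp M(1) by (simp add: q_def)
      qed
    qed
  qed
  moreover have "integral\<^sup>L lborel (q i) = 0" for i
    unfolding q_def using shift[of "t i *\<^sub>R b"] int by (simp add: add.commute)
  ultimately show ?thesis by (simp add: LIMSEQ_const_iff)
qed

section \<open>Radial bump weights and the mean value property\<close>

lemma DERIV_max_0_cube: "((\<lambda>s::real. (max 0 s)^3) has_real_derivative 3 * (max 0 s)\<^sup>2) (at s)"
proof -
  consider "s > 0" | "s < 0" | "s = 0" by linarith
  then show ?thesis
  proof cases
    case 1
    have "((\<lambda>s::real. s^3) has_real_derivative 3 * (max 0 s)\<^sup>2) (at s)"
      using 1 by (auto intro!: derivative_eq_intros)
    then show ?thesis
      by (rule has_field_derivative_transform_within_open[where S = "{0<..}"]) (use 1 in auto)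
  next
    case 2
    have "((\<lambda>s::real. 0) has_real_derivative 3 * (max 0 s)\<^sup>2) (at s)"
      using 2 by (auto intro!: derivative_eq_intros)
    then show ?thesis
      by (rule has_field_derivative_transform_within_open[where S = "{..<0}"]) (use 2 in auto)
  next
    case 3
    have "((\<lambda>h::real. (max 0 h)^3 / h) \<longlongrightarrow> 0) (at 0)"
    proof (rule tendsto_0_le[where K = 1])
      show "((\<lambda>h::real. h\<^sup>2) \<longlongrightarrow> 0) (at 0)" by (auto intro!: tendsto_eq_intros)
      show "\<forall>\<^sub>F h::real in at 0. norm ((max 0 h)^3 / h) \<le> norm (h\<^sup>2) * 1"
        by (intro always_eventually) (auto simp: max_def power2_eq_square power3_eq_cube)
    qed
    then show ?thesis using 3 by (simp add: DERIV_def)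
  qed
qed

text \<open>Takes the place of the surface measure in the mean value property. Being radial and
  supported in a ball, it turns averages into Lebesgue integrals over the whole space.\<close>

definition bump :: "real \<Rightarrow> 'a::real_inner \<Rightarrow> real" where
  "bump \<rho> z = (max 0 (\<rho>\<^sup>2 - z \<bullet> z))\<^sup>2"

lemma bump_nonneg: "0 \<le> bump \<rho> z"
  by (simp add: bump_def)

lemma bump_eq_0: "0 \<le> \<rho> \<Longrightarrow> \<rho> \<le> norm z \<Longrightarrow> bump \<rho> z = 0"
  by (simp add: bump_def dot_square_norm max_def power_mono antisym)

lemma continuous_on_bump: "continuous_on S (bump \<rho>)"
  unfolding bump_def[abs_def] by (intro continuous_intros)

text \<open>Chosen so that its gradient is \<open>bump \<rho> z *\<^sub>R z\<close>.\<close>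

definition bump_potential :: "real \<Rightarrow> 'a::real_inner \<Rightarrow> real" where
  "bump_potential \<rho> z = - ((max 0 (\<rho>\<^sup>2 - z \<bullet> z))^3) / 6"

lemma has_derivative_bump_potential:
  "(bump_potential \<rho> has_derivative (\<lambda>h. bump \<rho> z * (z \<bullet> h))) (at z)"
proof -
  have "((\<lambda>z. (max 0 (\<rho>\<^sup>2 - z \<bullet> z))^3) has_derivative
      (\<lambda>h. (- (2 * (z \<bullet> h))) * (3 * (max 0 (\<rho>\<^sup>2 - z \<bullet> z))\<^sup>2))) (at z)"
  proof (rule has_derivative_compose[where f = "\<lambda>z. \<rho>\<^sup>2 - z \<bullet> z" and g = "\<lambda>s. (max 0 s)^3" and g' = "\<lambda>h. h * (3 * (max 0 (\<rho>\<^sup>2 - z \<bullet> z))\<^sup>2)"])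
    show "((\<lambda>z. \<rho>\<^sup>2 - z \<bullet> z) has_derivative (\<lambda>h. - (2 * (z \<bullet> h)))) (at z)"
      by (auto intro!: derivative_eq_intros simp: inner_commute)
    show "((\<lambda>s. (max 0 s)^3) has_derivative (\<lambda>h. h * (3 * (max 0 (\<rho>\<^sup>2 - z \<bullet> z))\<^sup>2))) (at (\<rho>\<^sup>2 - z \<bullet> z))"
      using DERIV_max_0_cube[of "\<rho>\<^sup>2 - z \<bullet> z"] by (simp add: has_field_derivative_def mult_commute_abs)
  qed
  from has_derivative_mult_right[OF this, of "- 1 / 6"]
  show ?thesis by (simp add: bump_potential_def[abs_def] bump_def algebra_simps)
qed

lemma bump_potential_eq_0: "0 \<le> \<rho> \<Longrightarrow> \<rho> \<le> norm z \<Longrightarrow> bump_potential \<rho> z = 0"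
  by (simp add: bump_potential_def dot_square_norm max_def power_mono antisym)

lemma integrable_bump_mult:
  fixes f :: "'a::euclidean_space \<Rightarrow> real"
  assumes "0 \<le> \<rho>" "continuous_on (cball 0 \<rho>) f"
  shows "integrable lborel (\<lambda>z. bump \<rho> z * f z)"
proof -
  have "integrable lborel (\<lambda>z. indicator (cball 0 \<rho>) z *\<^sub>R (bump \<rho> z * f z))"
    by (rule borel_integrable_compact) (intro compact_cball continuous_intros continuous_on_bump assms)+
  moreover have "(\<lambda>z. indicator (cball 0 \<rho>) z *\<^sub>R (bump \<rho> z * f z)) = (\<lambda>z. bump \<rho> z * f z)"
    using bump_eq_0[OF \<open>0 \<le> \<rho>\<close>] by (force simp: indicator_def)
  ultimately show ?thesis by simp
qed

text \<open>Integration by parts against the potential leaves the trace of \<open>H\<close>.\<close>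

lemma integral_bump_radial_derivative_eq_0:
  fixes x :: "'a::euclidean_space"
  assumes "0 \<le> \<rho>" "open S" and sub: "\<And>z. norm z \<le> \<rho> \<Longrightarrow> x + r *\<^sub>R z \<in> S"
    and G: "\<And>y. y \<in> S \<Longrightarrow> (G has_derivative H y) (at y)"
    and cH: "\<And>b. b \<in> Basis \<Longrightarrow> continuous_on S (\<lambda>y. H y b)"
    and trace: "\<And>y. y \<in> S \<Longrightarrow> (\<Sum>b\<in>Basis. H y b \<bullet> b) = 0"
  shows "integral\<^sup>L lborel (\<lambda>z. bump \<rho> z * (z \<bullet> G (x + r *\<^sub>R z))) = 0"
proof -
  define T where "T = {z. x + r *\<^sub>R z \<in> S}"
  have "T = (\<lambda>z. x + r *\<^sub>R z) -` S" by (auto simp: T_def)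
  then have oT: "open T"
    by simp (rule open_vimage[OF \<open>open S\<close>], intro continuous_intros)
  have sub': "cball 0 \<rho> \<subseteq> T" using sub by (auto simp: T_def)
  have contG: "continuous_on S G"
    using G by (intro continuous_at_imp_continuous_on ballI has_derivative_continuous)
  have contGT: "continuous_on T (\<lambda>z. G (x + r *\<^sub>R z))"
    by (rule continuous_on_compose2[OF contG]) (auto simp: T_def intro!: continuous_intros)
  \<comment> \<open>The partial derivative in direction \<open>b\<close> of \<open>bump_potential
    \<rho> z * (G (x + r *\<^sub>R z) \<bullet> b)\<close>. Summed over the basis, the second term
    becomes the trace of \<open>H\<close>, which vanishes.\<close>
  define K where "K = (\<lambda>b z. bump \<rho> z * (z \<bullet> b) * (G (x + r *\<^sub>R z) \<bullet> b)
      + bump_potential \<rho> z * (r * (H (x + r *\<^sub>R z) b \<bullet> b)))"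
  have Kzero: "K b z = 0" if "\<rho> \<le> norm z" for b z
    using that \<open>0 \<le> \<rho>\<close> by (simp add: K_def bump_eq_0 bump_potential_eq_0)
  have cpot: "continuous_on A (bump_potential \<rho>)" for A
    unfolding bump_potential_def[abs_def] by (intro continuous_intros) auto
  have contK: "continuous_on T (K b)" if "b \<in> Basis" for b
  proof -
    have "continuous_on T (\<lambda>z. H (x + r *\<^sub>R z) b)"
      by (rule continuous_on_compose2[OF cH[OF that]]) (auto simp: T_def intro!: continuous_intros)
    then show ?thesis unfolding K_def
      by (intro continuous_intros continuous_on_bump cpot contGT)
  qed
  have intK: "integral\<^sup>L lborel (K b) = 0" if b: "b \<in> Basis" for b
  proof -
    define P where "P = (\<lambda>z. bump_potential \<rho> z * (G (x + r *\<^sub>R z) \<bullet> b))"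
    \<comment> \<open>Outside the ball \<open>x + r *\<^sub>R z\<close> may leave \<open>S\<close>,
      where nothing is known of \<open>G\<close> and \<open>H\<close>; there the product is locally
      0, and so is its derivative.\<close>
    define D where "D = (\<lambda>z h. if \<rho> < norm z then 0 else
        bump_potential \<rho> z * (H (x + r *\<^sub>R z) (r *\<^sub>R h) \<bullet> b)
        + bump \<rho> z * (z \<bullet> h) * (G (x + r *\<^sub>R z) \<bullet> b))"
    have far: "open {z::'a. \<rho> < norm z}"
      by (intro open_Collect_less continuous_intros)
    have "(P has_derivative D z) (at z)" for z
    proof (cases "\<rho> < norm z")
      case True
      have "((\<lambda>z. 0::real) has_derivative D z) (at z)" using True by (simp add: D_def)
      then show ?thesis
        using has_derivative_transform_within_open[of "\<lambda>z. 0" "D z" z UNIV "{z. \<rho> < norm z}" P]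
          far True \<open>0 \<le> \<rho>\<close> by (auto simp: P_def bump_potential_eq_0)
    next
      case False
      then have z: "x + r *\<^sub>R z \<in> S" using sub by auto
      have "((\<lambda>z. G (x + r *\<^sub>R z)) has_derivative (\<lambda>h. H (x + r *\<^sub>R z) (r *\<^sub>R h))) (at z)"
        by (rule has_derivative_compose[of "\<lambda>z. x + r *\<^sub>R z" "\<lambda>h. r *\<^sub>R h" z UNIV G, OF _ G[OF z]])
           (auto intro!: derivative_eq_intros)
      then have "((\<lambda>z. G (x + r *\<^sub>R z) \<bullet> b) has_derivative (\<lambda>h. H (x + r *\<^sub>R z) (r *\<^sub>R h) \<bullet> b)) (at z)"
        by (rule has_derivative_inner_left)
      from has_derivative_mult[OF has_derivative_bump_potential this]
      show ?thesis using False unfolding P_def D_def by simp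
    qed
    moreover have D_eq: "(\<lambda>z. D z b) = K b"
    proof
      fix z
      show "D z b = K b z"
      proof (cases "\<rho> < norm z")
        case True
        then show ?thesis using Kzero[of z b] by (simp add: D_def)
      next
        case False
        then have "x + r *\<^sub>R z \<in> S" using sub by auto
        then have "H (x + r *\<^sub>R z) (r *\<^sub>R b) = r *\<^sub>R H (x + r *\<^sub>R z) b"
          using linear_cmul[OF has_derivative_linear[OF G]] by blast
        then show ?thesis using False by (simp add: D_def K_def)
      qed
    qed
    moreover have "continuous_on UNIV (\<lambda>z. D z b)"
    proof -
      \<comment> \<open>The open sets \<open>T\<close> and the exterior of the ball cover the space
        and overlap, so continuity can be checked on each of them.\<close>
      have "continuous_on (T \<union> {z. \<rho> < norm z}) (K b)"
      proof (rule continuous_on_open_Un[OF oT far contK[OF b]])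
        show "continuous_on {z. \<rho> < norm z} (K b)"
          using continuous_on_const[of "{z. \<rho> < norm z}" 0]
          by (rule continuous_on_cong[THEN iffD1, rotated -1]) (auto simp: Kzero)
      qed
      moreover have "T \<union> {z. \<rho> < norm z} = UNIV" using sub' by force
      ultimately show ?thesis unfolding D_eq by simp
    qed
    moreover have "P z = 0" if "\<rho> < norm z" for z
      using that \<open>0 \<le> \<rho>\<close> by (simp add: P_def bump_potential_eq_0)
    ultimately show ?thesis using integral_directional_derivative_eq_0[of P D b \<rho>] by simp
  qed
  have "integrable lborel (K b)" if b: "b \<in> Basis" for b
  proof -
    have "integrable lborel (\<lambda>z. indicator (cball 0 \<rho>) z *\<^sub>R K b z)"
      by (rule borel_integrable_compact) (use contK[OF b] sub' continuous_on_subset in auto)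
    moreover have "(\<lambda>z. indicator (cball 0 \<rho>) z *\<^sub>R K b z) = K b"
      using Kzero by (force simp: indicator_def)
    ultimately show ?thesis by simp
  qed
  then have "integral\<^sup>L lborel (\<lambda>z. \<Sum>b\<in>Basis. K b z) = 0"
    by (subst Bochner_Integration.integral_sum) (use intK in auto)
  moreover have "(\<Sum>b\<in>Basis. K b z) = bump \<rho> z * (z \<bullet> G (x + r *\<^sub>R z))" for z
  proof (cases "\<rho> < norm z")
    case True
    then show ?thesis using \<open>0 \<le> \<rho>\<close> by (simp add: K_def bump_eq_0 bump_potential_eq_0)
  next
    case False
    then have "x + r *\<^sub>R z \<in> S" using sub by auto
    then have tr: "(\<Sum>b\<in>Basis. H (x + r *\<^sub>R z) b \<bullet> b) = 0" by (rule trace)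
    have "(\<Sum>b\<in>Basis. K b z) = bump \<rho> z * (\<Sum>b\<in>Basis. (z \<bullet> b) * (G (x + r *\<^sub>R z) \<bullet> b))
        + bump_potential \<rho> z * (r * (\<Sum>b\<in>Basis. H (x + r *\<^sub>R z) b \<bullet> b))"
      by (simp add: K_def sum.distrib sum_distrib_left mult.assoc)
    also have "\<dots> = bump \<rho> z * (z \<bullet> G (x + r *\<^sub>R z))"
      by (simp add: tr euclidean_inner[symmetric])
    finally show ?thesis .
  qed
  ultimately show ?thesis by simp
qed

text \<open>The weighted average over the ball scaled by \<open>s\<close> has derivative in
  \<open>s\<close> equal to the radial integral that was shown to vanish. It is therefore constant
  in \<open>s\<close>, and \<open>s = 0\<close> gives the value at the centre.\<close>

lemma harmonic_bump_mean_value: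
  fixes u :: "'a::euclidean_space \<Rightarrow> real"
  assumes "0 \<le> \<rho>" "0 \<le> R" "open S" and sub: "cball x (\<rho> * R) \<subseteq> S" and harm: "harmonic_fun_on S u"
  shows "integral\<^sup>L lborel (\<lambda>z. bump \<rho> z * u (x + R *\<^sub>R z)) = u x * integral\<^sup>L lborel (bump \<rho> :: 'a \<Rightarrow> real)"
proof -
  obtain G H where GH: "\<And>y. y \<in> S \<Longrightarrow> GDERIV u y :> G y"
    "\<And>y. y \<in> S \<Longrightarrow> (G has_derivative H y) (at y)"
    "\<And>b. b \<in> Basis \<Longrightarrow> continuous_on S (\<lambda>y. H y b)"
    "\<And>y. y \<in> S \<Longrightarrow> (\<Sum>b\<in>Basis. H y b \<bullet> b) = 0"
    using harm unfolding harmonic_fun_on_def by blast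
  have contG: "continuous_on S G"
    using GH(2) by (intro continuous_at_imp_continuous_on ballI has_derivative_continuous)
  have contu: "continuous_on S u" using harm by (rule harmonic_fun_on_imp_continuous_on)
  have inS: "x + s *\<^sub>R z \<in> S" if "norm z \<le> \<rho>" "s \<in> {0..R}" for s z
  proof -
    have "norm (s *\<^sub>R z) \<le> R * \<rho>" using that by (auto intro!: mult_mono)
    then have "x + s *\<^sub>R z \<in> cball x (\<rho> * R)" by (simp add: mult.commute dist_norm)
    then show ?thesis using sub by blast
  qed
  obtain M where M: "M > 0" "\<And>y. y \<in> cball x (\<rho> * R) \<Longrightarrow> norm (G y) \<le> M"
  proof -
    have "bounded (G ` cball x (\<rho> * R))"
      by (intro compact_imp_bounded compact_continuous_image continuous_on_subset[OF contG sub] compact_cball)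
    then show ?thesis using that unfolding bounded_pos by (auto simp: Ball_def)
  qed
  define F where "F = (\<lambda>s. integral\<^sup>L lborel (\<lambda>z. bump \<rho> z * u (x + s *\<^sub>R z)))"
  have int: "integrable lborel (\<lambda>z. bump \<rho> z * u (x + s *\<^sub>R z))" if "s \<in> {0..R}" for s
    using that inS
    by (intro integrable_bump_mult \<open>0 \<le> \<rho>\<close> continuous_on_compose2[OF contu] continuous_intros) auto
  have dl: "((\<lambda>s. u (x + s *\<^sub>R z)) has_real_derivative z \<bullet> G (x + s *\<^sub>R z)) (at s)"
    if "norm z \<le> \<rho>" "s \<in> {0..R}" for s z
  proof -
    have "((\<lambda>s. u (x + s *\<^sub>R z)) has_derivative (\<lambda>h. (h *\<^sub>R z) \<bullet> G (x + s *\<^sub>R z))) (at s)"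
    proof (rule has_derivative_compose[of "\<lambda>s. x + s *\<^sub>R z" "\<lambda>h. h *\<^sub>R z" s UNIV u "\<lambda>h. h \<bullet> G (x + s *\<^sub>R z)"])
      show "((\<lambda>s. x + s *\<^sub>R z) has_derivative (\<lambda>h. h *\<^sub>R z)) (at s)"
        by (auto intro!: derivative_eq_intros)
      show "(u has_derivative (\<lambda>h. h \<bullet> G (x + s *\<^sub>R z))) (at (x + s *\<^sub>R z))"
        using GH(1)[OF inS[OF that]] by (simp add: gderiv_def)
    qed
    then show ?thesis by (simp add: has_field_derivative_def mult_commute_abs)
  qed
  \<comment> \<open>Supplies the dominating function for differentiation under the integral.\<close>
  have lip: "\<bar>u (x + s *\<^sub>R z) - u (x + t *\<^sub>R z)\<bar> \<le> \<rho> * M * \<bar>s - t\<bar>"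
    if z: "norm z \<le> \<rho>" and st: "s \<in> {0..R}" "t \<in> {0..R}" for s t z
  proof -
    have "norm (u (x + s *\<^sub>R z) - u (x + t *\<^sub>R z)) \<le> (\<rho> * M) * norm (s - t)"
    proof (rule field_differentiable_bound[where S = "{0..R}" and f' = "\<lambda>s. z \<bullet> G (x + s *\<^sub>R z)"])
      fix s assume s: "s \<in> {0..R}"
      show "((\<lambda>s. u (x + s *\<^sub>R z)) has_field_derivative z \<bullet> G (x + s *\<^sub>R z)) (at s within {0..R})"
        by (rule has_field_derivative_at_within[OF dl[OF z s]])
      have "norm (s *\<^sub>R z) \<le> R * \<rho>" using s z by (auto intro!: mult_mono)
      then have "norm (G (x + s *\<^sub>R z)) \<le> M" by (intro M) (simp add: mult.commute dist_norm)
      then show "norm (z \<bullet> G (x + s *\<^sub>R z)) \<le> \<rho> * M"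
        using z Cauchy_Schwarz_ineq2[of z "G (x + s *\<^sub>R z)"] \<open>0 \<le> \<rho>\<close>
        by (smt (verit) mult_mono norm_ge_zero real_norm_def)
    qed (use st in auto)
    then show ?thesis by simp
  qed
  have "(F has_real_derivative 0) (at s within {0..R})" if s: "s \<in> {0..R}" for s
    unfolding has_field_derivative_iff tendsto_at_iff_sequentially
  proof (intro allI impI)
    fix X :: "nat \<Rightarrow> real"
    assume X: "\<forall>i. X i \<in> {0..R} - {s}" and lim: "X \<longlonglongrightarrow> s"
    define q where "q = (\<lambda>i z. (bump \<rho> z * u (x + X i *\<^sub>R z) - bump \<rho> z * u (x + s *\<^sub>R z)) / (X i - s))"
    have intq: "integrable lborel (q i)" for i
      unfolding q_def using int[of "X i"] int[OF s] X by auto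
    have "(\<lambda>i. integral\<^sup>L lborel (q i)) \<longlonglongrightarrow> integral\<^sup>L lborel (\<lambda>z. bump \<rho> z * (z \<bullet> G (x + s *\<^sub>R z)))"
    proof (rule integral_dominated_convergence[where w = "\<lambda>z. bump \<rho> z * (\<rho> * M)"])
      show "(\<lambda>z. bump \<rho> z * (z \<bullet> G (x + s *\<^sub>R z))) \<in> borel_measurable lborel"
        using s inS by (intro borel_measurable_integrable integrable_bump_mult \<open>0 \<le> \<rho>\<close> continuous_intros
            continuous_on_compose2[OF contG]) auto
      show "q i \<in> borel_measurable lborel" for i using intq by (rule borel_measurable_integrable)
      show "integrable lborel (\<lambda>z::'a. bump \<rho> z * (\<rho> * M))"
        by (intro integrable_bump_mult \<open>0 \<le> \<rho>\<close> continuous_intros)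
      show "AE z in lborel. (\<lambda>i. q i z) \<longlonglongrightarrow> bump \<rho> z * (z \<bullet> G (x + s *\<^sub>R z))"
      proof (rule AE_I2)
        fix z :: 'a
        show "(\<lambda>i. q i z) \<longlonglongrightarrow> bump \<rho> z * (z \<bullet> G (x + s *\<^sub>R z))"
        proof (cases "norm z \<le> \<rho>")
          case True
          have "((\<lambda>t. (u (x + t *\<^sub>R z) - u (x + s *\<^sub>R z)) / (t - s)) \<longlongrightarrow> z \<bullet> G (x + s *\<^sub>R z)) (at s within {0..R})"
            using has_field_derivative_at_within[OF dl[OF True s], of "{0..R}"]
            by (simp add: has_field_derivative_iff)
          then have "(\<lambda>i. (u (x + X i *\<^sub>R z) - u (x + s *\<^sub>R z)) / (X i - s)) \<longlonglongrightarrow> z \<bullet> G (x + s *\<^sub>R z)"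
            unfolding tendsto_at_iff_sequentially using X lim by (auto simp: o_def)
          then have "(\<lambda>i. bump \<rho> z * ((u (x + X i *\<^sub>R z) - u (x + s *\<^sub>R z)) / (X i - s)))
              \<longlonglongrightarrow> bump \<rho> z * (z \<bullet> G (x + s *\<^sub>R z))"
            by (rule tendsto_mult_left)
          then show ?thesis by (simp add: q_def algebra_simps diff_divide_distrib)
        next
          case False
          then show ?thesis using \<open>0 \<le> \<rho>\<close> by (simp add: q_def bump_eq_0)
        qed
      qed
      show "AE z in lborel. norm (q i z) \<le> bump \<rho> z * (\<rho> * M)" for i
      proof (rule AE_I2)
        fix z :: 'a
        show "norm (q i z) \<le> bump \<rho> z * (\<rho> * M)"
        proof (cases "norm z \<le> \<rho>")
          case True
          have "0 < \<bar>X i - s\<bar>" using X by auto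
          moreover have "\<bar>u (x + X i *\<^sub>R z) - u (x + s *\<^sub>R z)\<bar> \<le> \<rho> * M * \<bar>X i - s\<bar>"
            using lip[OF True _ s] X by blast
          ultimately have "\<bar>u (x + X i *\<^sub>R z) - u (x + s *\<^sub>R z)\<bar> / \<bar>X i - s\<bar> \<le> \<rho> * M"
            by (simp add: divide_le_eq)
          then have "bump \<rho> z * (\<bar>u (x + X i *\<^sub>R z) - u (x + s *\<^sub>R z)\<bar> / \<bar>X i - s\<bar>) \<le> bump \<rho> z * (\<rho> * M)"
            by (rule mult_left_mono[OF _ bump_nonneg])
          then show ?thesis
            by (simp add: q_def abs_mult bump_nonneg flip: right_diff_distrib)
        next
          case False
          then show ?thesis using \<open>0 \<le> \<rho>\<close> by (simp add: q_def bump_eq_0)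
        qed
      qed
    qed
    also have "integral\<^sup>L lborel (\<lambda>z. bump \<rho> z * (z \<bullet> G (x + s *\<^sub>R z))) = 0"
      by (rule integral_bump_radial_derivative_eq_0[OF \<open>0 \<le> \<rho>\<close> \<open>open S\<close> _ GH(2-4)]) (use inS s in auto)
    also have "(\<lambda>i. integral\<^sup>L lborel (q i)) = (\<lambda>i. (F (X i) - F s) / (X i - s))"
      unfolding q_def F_def using int X s by auto
    finally show "((\<lambda>y. (F y - F s) / (y - s)) \<circ> X) \<longlonglongrightarrow> 0" by (simp add: o_def)
  qed
  then have "\<exists>c. \<forall>s\<in>{0..R}. F s = c"
    by (intro has_field_derivative_zero_constant) auto
  then have "F R = F 0" using \<open>0 \<le> R\<close> by fastforce
  then show ?thesis by (simp add: F_def mult.commute)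
qed

lemma integral_bump_pos:
  assumes "0 < \<rho>"
  shows "0 < integral\<^sup>L lborel (bump \<rho> :: 'a::euclidean_space \<Rightarrow> real)"
proof -
  let ?B = "cball (0::'a) (\<rho> / 2)"
  have le: "(3 * \<rho>\<^sup>2 / 4)\<^sup>2 * indicator ?B z \<le> bump \<rho> z" for z :: 'a
  proof (cases "z \<in> ?B")
    case True
    then have "(norm z)\<^sup>2 \<le> (\<rho> / 2)\<^sup>2" by (intro power_mono) auto
    then have "3 * \<rho>\<^sup>2 / 4 \<le> \<rho>\<^sup>2 - z \<bullet> z" by (simp add: dot_square_norm power_divide field_simps)
    then have "(3 * \<rho>\<^sup>2 / 4)\<^sup>2 \<le> (max 0 (\<rho>\<^sup>2 - z \<bullet> z))\<^sup>2"
      by (intro power_mono order.trans[OF _ max.cobounded2]) auto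
    then show ?thesis using True by (simp add: bump_def)
  qed (simp add: bump_nonneg)
  have fin: "emeasure lborel ?B < \<infinity>" using emeasure_bounded_finite[OF bounded_cball] by simp
  have "0 < (3 * \<rho>\<^sup>2 / 4)\<^sup>2 * measure lborel ?B"
    using \<open>0 < \<rho>\<close> content_cball_pos[of "\<rho> / 2" "0::'a"] by simp
  also have "\<dots> = integral\<^sup>L lborel (\<lambda>z::'a. (3 * \<rho>\<^sup>2 / 4)\<^sup>2 * indicator ?B z)"
    using fin by simp
  also have "\<dots> \<le> integral\<^sup>L lborel (bump \<rho> :: 'a \<Rightarrow> real)"
  proof (rule integral_mono)
    show "integrable lborel (\<lambda>z::'a. (3 * \<rho>\<^sup>2 / 4)\<^sup>2 * indicator ?B z)"
      using fin by (intro integrable_mult_right integrable_real_indicator) auto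
    show "integrable lborel (bump \<rho> :: 'a \<Rightarrow> real)"
      using integrable_bump_mult[of \<rho> "\<lambda>_::'a. 1"] \<open>0 < \<rho>\<close> by simp
  qed (rule le)
  finally show ?thesis .
qed

text \<open>Both values are averages of \<open>u\<close>, and the bump of radius \<open>r\<close> around \<open>x\<close> lies below the bump of
  radius \<open>2 r\<close> around \<open>y\<close>.\<close>

lemma harnack_bump:
  fixes u :: "'a::euclidean_space \<Rightarrow> real"
  assumes "open S" "harmonic_fun_on S u" and nonneg: "\<And>z. z \<in> S \<Longrightarrow> 0 \<le> u z"
    and "0 < r" "dist x y \<le> r / 2" and sub: "cball y (2 * r) \<subseteq> S"
  shows "u x * integral\<^sup>L lborel (bump 1 :: 'a \<Rightarrow> real) \<le> u y * integral\<^sup>L lborel (bump 2 :: 'a \<Rightarrow> real)"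
proof -
  \<comment> \<open>The offset of the centres in units of \<open>r\<close>. After a translation by
    \<open>w\<close> both averages are integrals of the values
    \<open>u (y + r *\<^sub>R z)\<close>.\<close>
  define w where "w = (1 / r) *\<^sub>R (x - y)"
  have w: "norm w \<le> 1 / 2"
    using assms(4,5) by (simp add: w_def dist_norm divide_le_eq mult.commute)
  have rw: "y + r *\<^sub>R (w + z) = x + r *\<^sub>R z" for z
    using \<open>0 < r\<close> by (simp add: w_def scaleR_add_right)
  have contu: "continuous_on S u" by (rule harmonic_fun_on_imp_continuous_on) fact
  have insub: "y + r *\<^sub>R z \<in> S" if "norm z \<le> 2" for z
  proof -
    have "norm (r *\<^sub>R z) \<le> r * 2" using that \<open>0 < r\<close> by simp
    then have "y + r *\<^sub>R z \<in> cball y (2 * r)" by (simp add: dist_norm)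
    then show ?thesis using sub by blast
  qed
  have norm2: "norm (w + z) \<le> 3 / 2" if "norm z \<le> 1" for z
    using w that by (intro norm_triangle_le) simp
  have sub1: "cball x (1 * r) \<subseteq> S"
  proof -
    have "cball x r \<subseteq> cball y (2 * r)" using assms(4,5) by (simp add: subset_iff) (smt (verit) dist_triangle dist_commute field_sum_of_halves)
    then show ?thesis using sub by simp
  qed
  define f where "f = (\<lambda>z. bump 2 z * u (y + r *\<^sub>R z))"
  have intf: "integrable lborel f" unfolding f_def
    using insub by (intro integrable_bump_mult continuous_on_compose2[OF contu] continuous_intros) auto
  then have meas: "f \<in> borel_measurable borel" using borel_measurable_integrable by force
  have "integrable (distr lborel borel ((+) w)) f" using intf by (simp add: lborel_distr_plus)
  then have intfw: "integrable lborel (\<lambda>z. f (w + z))" by (subst (asm) integrable_distr_eq) (use meas in auto)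
  have "u x * integral\<^sup>L lborel (bump 1 :: 'a \<Rightarrow> real) = integral\<^sup>L lborel (\<lambda>z. bump 1 z * u (x + r *\<^sub>R z))"
    by (rule harmonic_bump_mean_value[symmetric, OF _ _ \<open>open S\<close> sub1]) (use assms in auto)
  also have "\<dots> \<le> integral\<^sup>L lborel (\<lambda>z. f (w + z))"
  proof (rule integral_mono[OF _ intfw])
    show "integrable lborel (\<lambda>z. bump 1 z * u (x + r *\<^sub>R z))"
    proof (intro integrable_bump_mult continuous_on_compose2[OF contu] continuous_intros)
      show "(\<lambda>z. x + r *\<^sub>R z) ` cball 0 1 \<subseteq> S"
        using sub1 \<open>0 < r\<close> by (auto simp: subset_iff dist_norm)
    qed auto
    fix z :: 'a
    show "bump 1 z * u (x + r *\<^sub>R z) \<le> f (w + z)"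
    proof (cases "norm (w + z) \<le> 2")
      case True
      then have pos: "0 \<le> u (x + r *\<^sub>R z)" using insub[OF True] nonneg unfolding rw by blast
      \<comment> \<open>For \<open>norm z \<le> 1\<close> one has
        \<open>norm (w + z) \<le> 3 / 2\<close>, so the right side is at least
        \<open>(4 - 9 / 4)^2\<close>, while the left side is at most 1.\<close>
      have "bump 1 z \<le> bump 2 (w + z)"
      proof (cases "norm z \<le> 1")
        case True
        have "(norm (w + z))\<^sup>2 \<le> (3 / 2)\<^sup>2" using norm2[OF True] by (intro power_mono) auto
        then have "1\<^sup>2 \<le> (max 0 (2\<^sup>2 - (w + z) \<bullet> (w + z)))\<^sup>2"
          by (intro power_mono) (simp_all add: dot_square_norm power2_eq_square)
        moreover have "(max 0 (1\<^sup>2 - z \<bullet> z))\<^sup>2 \<le> 1\<^sup>2" by (intro power_mono) auto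
        ultimately show ?thesis unfolding bump_def by linarith
      next
        case False
        then show ?thesis by (simp add: bump_eq_0 bump_nonneg)
      qed
      then show ?thesis unfolding f_def rw using pos by (rule mult_right_mono)
    next
      case False
      then have "\<not> norm z \<le> 1" using norm2 by fastforce
      with False show ?thesis by (simp add: f_def bump_eq_0)
    qed
  qed
  also have "\<dots> = integral\<^sup>L (distr lborel borel ((+) w)) f"
    by (subst integral_distr) (use meas in auto)
  also have "\<dots> = integral\<^sup>L lborel f" by (simp add: lborel_distr_plus)
  also have "\<dots> = u y * integral\<^sup>L lborel (bump 2 :: 'a \<Rightarrow> real)" unfolding f_def
    by (rule harmonic_bump_mean_value[OF _ _ \<open>open S\<close> sub]) (use assms in auto)
  finally show ?thesis .
qed

text \<open>The segment is cut into \<open>N\<close> pieces of length at most \<open>r\<close>, each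
  a case of \<open>harnack_bump\<close> with radius \<open>2 * r\<close>; hence the balls of radius
  \<open>4 * r\<close>. The constant depends only on \<open>N\<close> and the dimension, since it is
  fixed before the domain and the function.\<close>

lemma harnack_segment:
  obtains c :: real where "0 < c" "c \<le> 1"
    "\<And>S (u :: 'a::euclidean_space \<Rightarrow> real) r x y. \<lbrakk>open S; harmonic_fun_on S u; \<And>z. z \<in> S \<Longrightarrow> 0 \<le> u z;
       0 < r; dist x y \<le> real N * r; \<And>p. p \<in> closed_segment x y \<Longrightarrow> cball p (4 * r) \<subseteq> S\<rbrakk>
     \<Longrightarrow> c * u x \<le> u y"
proof -
  define I where "I = (\<lambda>\<rho>. integral\<^sup>L lborel (bump \<rho> :: 'a \<Rightarrow> real))"
  define k where "k = min 1 (I 1 / I 2)"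
  have I: "0 < I 1" "0 < I 2" using integral_bump_pos[of 1] integral_bump_pos[of 2] by (auto simp: I_def)
  have k: "0 < k" "k \<le> 1" using I by (auto simp: k_def)
  show thesis
  proof (rule that[of "k ^ N"])
    fix S :: "'a set" and u :: "'a \<Rightarrow> real" and r x y
    assume S: "open S" "harmonic_fun_on S u" "\<And>z. z \<in> S \<Longrightarrow> 0 \<le> u z" and "0 < r"
      and d: "dist x y \<le> real N * r" and seg: "\<And>p. p \<in> closed_segment x y \<Longrightarrow> cball p (4 * r) \<subseteq> S"
    define p where "p = (\<lambda>i::nat. x + (real i / real N) *\<^sub>R (y - x))"
    have pseg: "p i \<in> closed_segment x y" if "i \<le> N" for i
      unfolding closed_segment_def p_def using that
      by (auto intro!: exI[of _ "real i / real N"] simp: algebra_simps divide_le_eq_1)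
    have step: "k * u (p i) \<le> u (p (Suc i))" if "Suc i \<le> N" for i
    proof -
      have "p (Suc i) - p i = (1 / real N) *\<^sub>R (y - x)"
        by (simp add: p_def algebra_simps add_divide_distrib)
      then have "dist (p i) (p (Suc i)) = dist x y / real N"
        by (simp add: dist_norm norm_minus_commute[of x y] norm_minus_commute[of "p i"])
      also have "\<dots> \<le> (2 * r) / 2"
        using d that by (simp add: divide_le_eq mult.commute)
      finally have "u (p i) * I 1 \<le> u (p (Suc i)) * I 2" unfolding I_def
        by (intro harnack_bump[OF S, of "2 * r"]) (use \<open>0 < r\<close> seg[OF pseg[OF that]] in auto)
      then have "u (p i) * (I 1 / I 2) \<le> u (p (Suc i))" using I by (simp add: divide_le_eq)
      moreover have "p i \<in> S" using seg[OF pseg[of i]] that \<open>0 < r\<close> by force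
      then have "k * u (p i) \<le> I 1 / I 2 * u (p i)"
        using S(3) by (intro mult_right_mono) (auto simp: k_def)
      ultimately show ?thesis by (simp add: mult.commute)
    qed
    have "k ^ i * u x \<le> u (p i)" if "i \<le> N" for i
      using that
    proof (induction i)
      case 0
      show ?case by (simp add: p_def)
    next
      case (Suc i)
      then have "k * (k ^ i * u x) \<le> k * u (p i)" using k by (intro mult_left_mono) auto
      then show ?case using step[OF Suc.prems] by (simp add: mult.assoc)
    qed
    from this[of N] have "k ^ N * u x \<le> u (p N)" by simp
    \<comment> \<open>For \<open>N = 0\<close> the quotient in \<open>p\<close> is
      \<open>0 / 0 = 0\<close>, but the distance bound then forces \<open>x = y\<close>.\<close>
    moreover have "p N = y" using d by (cases "N = 0") (auto simp: p_def)
    ultimately show "k ^ N * u x \<le> u y" by simp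
  qed (use k in \<open>auto simp: power_le_one\<close>)
qed

subsection \<open>Improvement of flatness\<close>

text \<open>The number \<open>\<epsilon>\<close> is dimensionless: in the ball,
  \<open>\<Omega>\<close> and a half space agree outside a slab of half-width
  \<open>\<epsilon> * r\<close>, with \<open>n\<close> pointing into \<open>\<Omega>\<close>.
  Stating this for \<open>\<Omega>\<close> instead of its frontier also records which side of the
  slab is inside.\<close>

definition flat_at :: "'a::euclidean_space set \<Rightarrow> 'a \<Rightarrow> 'a \<Rightarrow> real \<Rightarrow> real \<Rightarrow> bool" where
  "flat_at \<Omega> p n r \<epsilon> \<longleftrightarrow> norm n = 1 \<and>
     (\<forall>y\<in>ball p r. (y \<in> \<Omega> \<longrightarrow> - (\<epsilon> * r) \<le> (y - p) \<bullet> n) \<and> (\<epsilon> * r < (y - p) \<bullet> n \<longrightarrow> y \<in> \<Omega>))"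

text \<open>A frontier point is outside the open set \<open>\<Omega>\<close>, which bounds its
  height from above. It is also a limit of points of \<open>\<Omega>\<close>, and violating the
  lower bound strictly is an open condition.\<close>

lemma flat_at_frontier:
  assumes "open \<Omega>" "flat_at \<Omega> p n r \<epsilon>" "y \<in> frontier \<Omega>" "y \<in> ball p r"
  shows "\<bar>(y - p) \<bullet> n\<bar> \<le> \<epsilon> * r"
proof -
  have "y \<notin> \<Omega>" using assms(1,3) by (simp add: frontier_def interior_open)
  then have "(y - p) \<bullet> n \<le> \<epsilon> * r" using assms(2,4) by (force simp: flat_at_def)
  moreover have "- (\<epsilon> * r) \<le> (y - p) \<bullet> n"
  proof (rule ccontr)
    assume neg: "\<not> - (\<epsilon> * r) \<le> (y - p) \<bullet> n"
    let ?T = "ball p r \<inter> {y. (y - p) \<bullet> n < - (\<epsilon> * r)}"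
    have "open ?T" by (intro open_Int open_ball open_Collect_less continuous_intros)
    moreover have "y \<in> ?T" using neg assms(4) by simp
    moreover have "y \<in> closure \<Omega>" using assms(3) by (simp add: frontier_def)
    ultimately have "?T \<inter> \<Omega> \<noteq> {}" by (metis closure_iff_nhds_not_empty Int_commute order_refl)
    then show False using assms(2) by (force simp: flat_at_def)
  qed
  ultimately show ?thesis by linarith
qed

text \<open>
  The quadratic terms are harmonic and bend the plane so that the comparison function stays below
  \<open>u\<close> on the whole boundary of the thin slab, while on the line through \<open>y\<close> in direction \<open>n\<close> they
  have the favourable sign.  The gain at the centre reaches the top of the slab by the Harnack
  inequality.
\<close>

lemma lower_bound_improvement:
  fixes d :: real
  defines "d \<equiv> real DIM('a::euclidean_space)"
  obtains c :: real where "0 < c" "c \<le> 1"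
    "\<And>(\<Omega> :: 'a set) u p n r \<epsilon> A E m y. \<lbrakk>open \<Omega>; harmonic_fun_on \<Omega> u; continuous_on (closure \<Omega>) u;
       flat_at \<Omega> p n r \<epsilon>; 0 \<le> \<epsilon>; \<epsilon> \<le> 1 / (16 * d); 0 < r;
       \<And>y. y \<in> frontier \<Omega> \<inter> ball p r \<Longrightarrow> u y = 0;
       \<And>y. y \<in> \<Omega> \<inter> ball p r \<Longrightarrow> A * ((y - p) \<bullet> n) - E * r \<le> u y;
       0 \<le> E; 0 \<le> m; A * (r / 2) - E * r + m * r \<le> u (p + (r / 2) *\<^sub>R n);
       y \<in> \<Omega> \<inter> ball p (r / (8 * d))\<rbrakk>
     \<Longrightarrow> (A + c * m - 16 * d * E) * ((y - p) \<bullet> n) - \<epsilon> * (2 * c * m + 32 * d * E + \<bar>A\<bar>) * r \<le> u y"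
proof -
  \<comment> \<open>The Harnack radius below is \<open>\<mu> * r / 16\<close>, which is
    \<open>r / (128 * d)\<close>, and the points compared are at distance at most \<open>r\<close>;
    this gives the number of pieces.\<close>
  obtain c :: real where c: "0 < c" "c \<le> 1" and
    harnack: "\<And>S (u :: 'a \<Rightarrow> real) r x y. \<lbrakk>open S; harmonic_fun_on S u; \<And>z. z \<in> S \<Longrightarrow> 0 \<le> u z;
       0 < r; dist x y \<le> real (128 * DIM('a)) * r; \<And>p. p \<in> closed_segment x y \<Longrightarrow> cball p (4 * r) \<subseteq> S\<rbrakk>
     \<Longrightarrow> c * u x \<le> u y"
    using harnack_segment[where 'a = 'a and N = "128 * DIM('a)"] by blast
  show thesis
  proof (rule that[OF c])
    fix \<Omega> :: "'a set" and u p n r \<epsilon> A E m y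
    assume \<Omega>: "open \<Omega>" "harmonic_fun_on \<Omega> u" "continuous_on (closure \<Omega>) u"
      and flat: "flat_at \<Omega> p n r \<epsilon>" and \<epsilon>: "0 \<le> \<epsilon>" "\<epsilon> \<le> 1 / (16 * d)" and r: "0 < r"
      and zero: "\<And>y. y \<in> frontier \<Omega> \<inter> ball p r \<Longrightarrow> u y = 0"
      and lower: "\<And>y. y \<in> \<Omega> \<inter> ball p r \<Longrightarrow> A * ((y - p) \<bullet> n) - E * r \<le> u y"
      and E: "0 \<le> E" and m: "0 \<le> m" and gain: "A * (r / 2) - E * r + m * r \<le> u (p + (r / 2) *\<^sub>R n)"
      and y: "y \<in> \<Omega> \<inter> ball p (r / (8 * d))"
    \<comment> \<open>Relative height of the slab. It equals the scale ratio, so \<open>y\<close>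
      lies below the top, and \<open>d * \<mu>^2 = \<mu> / 8\<close> is at most
      \<open>1 / 64\<close>.\<close>
    define \<mu> where "\<mu> = 1 / (8 * d)"
    define M where "M = c * m"
    define X where "X = (\<lambda>q. (q - p) \<bullet> n)"
    have d: "1 \<le> d" unfolding d_def using DIM_positive[where 'a = 'a] by simp
    have \<mu>: "0 < \<mu>" "\<mu> \<le> 1 / 8" "8 * (d * \<mu>) = 1" "\<epsilon> \<le> \<mu> / 2" using d \<epsilon> by (auto simp: \<mu>_def field_simps)
    have M: "0 \<le> M" using c m by (simp add: M_def)
    have n: "norm n = 1" "n \<bullet> n = 1" using flat by (auto simp: flat_at_def dot_square_norm)
    have "\<mu> * r \<le> 1 / 8 * r" using \<mu> r by (intro mult_right_mono) auto
    then have \<mu>r: "\<mu> * r \<le> r / 8" by simp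
    have X_eq: "n \<bullet> q = n \<bullet> p + X q" for q
      by (simp add: X_def inner_diff_left inner_commute[of n])
    have X_le: "\<bar>X q\<bar> \<le> norm (q - p)" for q
      using Cauchy_Schwarz_ineq2[of "q - p" n] n by (simp add: X_def)
    have flat1: "q \<in> \<Omega> \<Longrightarrow> q \<in> ball p r \<Longrightarrow> - (\<epsilon> * r) \<le> X q" and flat2: "q \<in> ball p r \<Longrightarrow> \<epsilon> * r < X q \<Longrightarrow> q \<in> \<Omega>" for q
      using flat by (auto simp: flat_at_def X_def)
    \<comment> \<open>Harnack for the nonnegative function \<open>?v\<close>, along a segment in the
      convex set \<open>?C\<close> of points of height at least \<open>\<mu> * r\<close>. There the
      required balls have radius \<open>\<mu> * r / 4\<close> and stay above height
      \<open>\<epsilon> * r\<close>, which is at most half of \<open>\<mu> * r\<close>, hence inside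
      \<open>\<Omega>\<close>.\<close>
    have top: "A * X q + (M - E) * r \<le> u q" if q: "norm (q - p) \<le> r / 2" "X q = \<mu> * r" for q
    proof -
      let ?p = "p + (r / 2) *\<^sub>R n" and ?v = "\<lambda>q. u q - A * X q + E * r" and ?C = "cball p (r / 2) \<inter> {q. \<mu> * r + n \<bullet> p \<le> n \<bullet> q}"
      have "c * ?v ?p \<le> ?v q"
      proof (rule harnack[where S = "\<Omega> \<inter> ball p r" and r = "\<mu> * r / 16"])
        show "open (\<Omega> \<inter> ball p r)" using \<Omega> by auto
        show "harmonic_fun_on (\<Omega> \<inter> ball p r) ?v" unfolding X_def
          by (intro harmonic_fun_on_add harmonic_fun_on_diff harmonic_fun_on_cmult harmonic_fun_on_linear harmonic_fun_on_const
              harmonic_fun_on_subset[OF \<Omega>(2)]) auto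
        show "0 \<le> ?v z" if "z \<in> \<Omega> \<inter> ball p r" for z using lower[OF that] by (simp add: X_def)
        show "0 < \<mu> * r / 16" using \<mu> r by simp
        have "dist ?p q \<le> dist ?p p + dist p q" by (rule dist_triangle)
        also have "\<dots> \<le> r / 2 + r / 2" using q n r by (intro add_mono) (auto simp: dist_norm norm_minus_commute)
        also have "\<dots> = real (128 * DIM('a)) * (\<mu> * r / 16)" using \<mu>(3) by (simp add: d_def mult.commute)
        finally show "dist ?p q \<le> real (128 * DIM('a)) * (\<mu> * r / 16)" .
        fix z assume z: "z \<in> closed_segment ?p q"
        have "convex ?C" by (intro convex_Int convex_cball convex_halfspace_ge)
        moreover have "?p \<in> ?C" using n r \<mu> by (auto simp: dist_norm inner_add_right)
        moreover have "q \<in> ?C" using q X_eq[of q] by (simp add: dist_norm norm_minus_commute)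
        ultimately have "z \<in> ?C" using z closed_segment_subset[of ?p ?C q] by blast
        then have z1: "norm (z - p) \<le> r / 2" "\<mu> * r \<le> X z"
          using X_eq[of z] by (simp_all add: dist_norm norm_minus_commute)
        show "cball z (4 * (\<mu> * r / 16)) \<subseteq> \<Omega> \<inter> ball p r"
        proof
          fix t assume "t \<in> cball z (4 * (\<mu> * r / 16))"
          then have t: "norm (t - z) \<le> \<mu> * r / 4" by (simp add: dist_norm norm_minus_commute)
          have "norm (t - p) \<le> norm (t - z) + norm (z - p)" using norm_triangle_ineq[of "t - z" "z - p"] by simp
          then have "norm (t - p) < r" using t z1 r \<mu>r by linarith
          then have tb: "t \<in> ball p r" by (simp add: dist_norm norm_minus_commute)
          have "\<bar>(t - z) \<bullet> n\<bar> \<le> norm (t - z)" using Cauchy_Schwarz_ineq2[of "t - z" n] n by simp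
          moreover have "X t = X z + (t - z) \<bullet> n" by (simp add: X_def inner_diff_left)
          ultimately have "\<mu> * r - \<mu> * r / 4 \<le> X t" using z1 t by linarith
          moreover have "\<epsilon> * r \<le> \<mu> / 2 * r" using \<mu> r by (intro mult_right_mono) auto
          moreover have "0 < \<mu> * r" using \<mu> r by simp
          ultimately have "\<epsilon> * r < X t" by simp
          then show "t \<in> \<Omega> \<inter> ball p r" using flat2 tb by blast
        qed
      qed
      moreover have "m * r \<le> ?v ?p" using gain n by (simp add: X_def)
      then have "c * (m * r) \<le> c * ?v ?p" using c by (intro mult_left_mono) auto
      ultimately show ?thesis by (simp add: M_def algebra_simps)
    qed
    define s where "s = X y"
    define y0 where "y0 = y - s *\<^sub>R n"
    define Pol where "Pol = (\<lambda>q. (q - y0) \<bullet> (q - y0) - DIM('a) * ((q - p) \<bullet> n)\<^sup>2)"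
    define w where "w = (\<lambda>q. u q - ((A + M - 16 * d * E) * X q + (- (M + 8 * E) / r) * Pol q + (- (\<epsilon> * (2 * M + 32 * d * E + \<bar>A\<bar>) * r))))"
    define Q where "Q = \<Omega> \<inter> ball p (r / 2) \<inter> {q. X q < \<mu> * r}"
    have yp: "norm (y - p) < \<mu> * r" using y by (simp add: \<mu>_def dist_norm norm_minus_commute)
    have y0p: "norm (y0 - p) \<le> r / 8"
    proof -
      have "(norm (y0 - p))\<^sup>2 = (norm (y - p))\<^sup>2 - s\<^sup>2"
        unfolding y0_def s_def X_def power2_norm_eq_inner
        using n by (simp add: inner_diff_left inner_diff_right inner_commute algebra_simps power2_eq_square)
      also have "\<dots> \<le> (norm (y - p))\<^sup>2" by simp
      finally have "norm (y0 - p) \<le> norm (y - p)" by (rule power2_le_imp_le) simp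
      then show ?thesis using yp \<mu>r by simp
    qed
    \<comment> \<open>Grouped by \<open>M\<close>, \<open>E\<close> and
      \<open>\<bar>A\<bar>\<close>, in units of \<open>r\<close>. The factor of \<open>M\<close>
      must be at most 0 on the frontier of \<open>\<Omega>\<close> and on the sides and at most 1 on
      the top; the factor subtracted with \<open>E\<close> must be at least 0 on the frontier and at
      least 1 on the sides and the top. These requirements fix the numbers 2, 8, 16 and 32.\<close>
    have w_alt: "w q = u q - r * (A * (X q / r) + M * (X q / r - Pol q / r\<^sup>2 - 2 * \<epsilon>)
        - E * (16 * (d * (X q / r)) + 8 * (Pol q / r\<^sup>2) + 32 * (d * \<epsilon>)) - \<bar>A\<bar> * \<epsilon>)" for q
      using r by (simp add: w_def field_simps power2_eq_square)
    have "0 \<le> w y"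
    proof (rule harmonic_min_principle[of Q])
      show "open Q" unfolding Q_def X_def using \<Omega>
        by (intro open_Int open_ball open_Collect_less continuous_intros)
      show "bounded Q" unfolding Q_def by (meson bounded_ball bounded_subset inf_le1 inf_le2 le_infI1)
      show "harmonic_fun_on Q w" unfolding w_def X_def Pol_def
        by (intro harmonic_fun_on_add harmonic_fun_on_diff harmonic_fun_on_cmult harmonic_fun_on_linear harmonic_fun_on_const
              harmonic_fun_on_quadratic n harmonic_fun_on_subset[OF \<Omega>(2)]) (auto simp: Q_def)
      have clQ: "closure Q \<subseteq> closure \<Omega>" by (intro closure_mono) (auto simp: Q_def)
      show "continuous_on (closure Q) w" unfolding w_def X_def Pol_def
        using r by (intro continuous_intros continuous_on_subset[OF \<Omega>(3) clQ]) auto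
      have "norm (y - p) < r / 2" "X y < \<mu> * r" using yp \<mu>r r X_le[of y] by linarith+
      then show "y \<in> Q" using y by (simp add: Q_def dist_norm norm_minus_commute)
      fix q assume q: "q \<in> frontier Q"
      have "closed (cball p (r / 2) \<inter> {q. X q \<le> \<mu> * r})" unfolding X_def
        by (intro closed_Int closed_cball closed_Collect_le continuous_intros)
      then have "closure Q \<subseteq> cball p (r / 2) \<inter> {q. X q \<le> \<mu> * r}"
        by (intro closure_minimal) (auto simp: Q_def)
      moreover have "q \<in> closure Q" using q by (simp add: frontier_def)
      ultimately have q1: "q \<in> closure \<Omega>" "norm (q - p) \<le> r / 2" "X q \<le> \<mu> * r"
        using clQ by (auto simp: dist_norm norm_minus_commute)
      have "q \<notin> Q" using q \<open>open Q\<close> by (simp add: frontier_def interior_open)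
      have qb: "q \<in> ball p r" using q1 r by (simp add: dist_norm norm_minus_commute)
      define x where "x = X q / r"
      define P where "P = Pol q / r\<^sup>2"
      have xr: "X q = x * r" using r by (simp add: x_def)
      have wq: "w q = u q - r * (A * x + M * (x - P - 2 * \<epsilon>) - E * (16 * (d * x) + 8 * P + 32 * (d * \<epsilon>)) - \<bar>A\<bar> * \<epsilon>)"
        unfolding w_alt x_def P_def ..
      have P_eq: "P = (norm (q - y0) / r)\<^sup>2 - d * x\<^sup>2"
        using r by (simp add: P_def Pol_def x_def X_def d_def dot_square_norm power_divide diff_divide_distrib)
      have x_le: "x \<le> \<mu>" using q1 r by (simp add: x_def divide_le_eq)
      have x2: "d * x\<^sup>2 \<le> \<mu> / 8" if "- \<mu> \<le> x"
      proof -
        have "x\<^sup>2 \<le> \<mu>\<^sup>2" using that x_le by (intro abs_le_square_iff[THEN iffD1]) auto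
        then have "d * x\<^sup>2 \<le> d * \<mu>\<^sup>2" using d by (intro mult_left_mono) auto
        also have "\<dots> = \<mu> / 8" using \<mu>(3) by (simp add: power2_eq_square) 
        finally show ?thesis .
      qed
      have key: "0 \<le> w q" if "r * (A * x + a * M - b * E - e * \<bar>A\<bar>) \<le> u q" "x - P - 2 * \<epsilon> \<le> a"
          "b \<le> 16 * (d * x) + 8 * P + 32 * (d * \<epsilon>)" "e \<le> \<epsilon>" for a b e
      proof -
        have "M * (x - P - 2 * \<epsilon>) \<le> a * M" "b * E \<le> E * (16 * (d * x) + 8 * P + 32 * (d * \<epsilon>))" "e * \<bar>A\<bar> \<le> \<bar>A\<bar> * \<epsilon>"
          using that(2-4) M E by (simp_all add: mult.commute mult_left_mono mult_right_mono)
        then have "r * (A * x + M * (x - P - 2 * \<epsilon>) - E * (16 * (d * x) + 8 * P + 32 * (d * \<epsilon>)) - \<bar>A\<bar> * \<epsilon>)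
            \<le> r * (A * x + a * M - b * E - e * \<bar>A\<bar>)"
          using r by (intro mult_left_mono) auto
        then show ?thesis unfolding wq using that(1) by linarith
      qed
      have d\<epsilon>: "0 \<le> d * \<epsilon>" using d \<epsilon> by simp
      show "0 \<le> w q"
      \<comment> \<open>The frontier of \<open>Q\<close> has three parts: the frontier of
        \<open>\<Omega>\<close>, where \<open>u\<close> vanishes; the top of the slab, where Harnack
        applies; and the lateral sphere, where only the given lower bound is known.\<close>
      proof (cases "q \<in> \<Omega>")
        case False
        then have qf: "q \<in> frontier \<Omega>" using q1 \<Omega> by (simp add: frontier_def interior_open)
        then have "\<bar>X q\<bar> \<le> \<epsilon> * r" using flat_at_frontier[OF \<Omega>(1) flat qf qb] by (simp add: X_def)
        then have x: "\<bar>x\<bar> \<le> \<epsilon>" using r by (simp add: x_def divide_le_eq)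
        have uq: "u q = 0" using zero qf qb by simp
        have "x\<^sup>2 \<le> \<epsilon>\<^sup>2" using x \<epsilon> by (intro abs_le_square_iff[THEN iffD1]) auto
        then have "d * x\<^sup>2 \<le> d * \<epsilon>\<^sup>2" using d by (intro mult_left_mono) auto
        also have "\<dots> = (d * \<epsilon>) * \<epsilon>" by (simp add: power2_eq_square)
        also have "\<dots> \<le> 1 / 16 * \<epsilon>" using \<epsilon> d by (intro mult_right_mono) (auto simp: field_simps)
        finally have P: "- \<epsilon> / 16 \<le> P" using P_eq zero_le_power2[of "norm (q - y0) / r"] by linarith
        have dx: "d * x \<ge> - (d * \<epsilon>)" using x d mult_left_mono[of "- \<epsilon>" x d] by auto
        have "\<epsilon> \<le> d * \<epsilon>" using d \<epsilon> mult_right_mono[of 1 d \<epsilon>] by simp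
        have "A * x \<le> \<bar>A\<bar> * \<bar>x\<bar>" by (simp flip: abs_mult)
        also have "\<dots> \<le> \<bar>A\<bar> * \<epsilon>" using x by (intro mult_left_mono) auto
        finally have "A * x \<le> \<bar>A\<bar> * \<epsilon>" .
        then have "r * (A * x + 0 * M - 0 * E - \<epsilon> * \<bar>A\<bar>) \<le> u q"
          using uq r by (simp add: mult_le_0_iff mult.commute)
        then show ?thesis by (rule key) (use P x dx d\<epsilon> \<epsilon> \<open>\<epsilon> \<le> d * \<epsilon>\<close> in linarith)+
      next
        case True
        then have "- (\<epsilon> * r) \<le> X q" using flat1 qb by blast
        then have x: "- \<epsilon> \<le> x" using r by (simp add: x_def le_divide_eq)
        then have x2': "d * x\<^sup>2 \<le> \<mu> / 8" using x2 \<mu> by linarith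
        have dx: "d * x \<ge> - (d * \<epsilon>)" using x d mult_left_mono[of "- \<epsilon>" x d] by auto
        show ?thesis
        proof (cases "X q = \<mu> * r")
          case top': True
          then have "x = \<mu>" using r by (simp add: x_def)
          then have "d * x = 1 / 8" using \<mu>(3) by simp
          have P: "- \<mu> / 8 \<le> P" using x2' P_eq zero_le_power2[of "norm (q - y0) / r"] by linarith
          have "r * (A * x + 1 * M - 1 * E - 0 * \<bar>A\<bar>) \<le> u q"
            using top[OF q1(2) top'] xr by (simp add: algebra_simps)
          then show ?thesis by (rule key) (use P \<open>x = \<mu>\<close> \<open>d * x = 1 / 8\<close> \<mu> d\<epsilon> \<epsilon> in linarith)+
        next
          \<comment> \<open>On the lateral sphere the distance to \<open>y0\<close> is at least
            \<open>r / 2 - r / 8\<close>. Its relative square \<open>9 / 64\<close> just compensates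
            \<open>x + d * x^2\<close>, which is at most \<open>9 * \<mu> / 8\<close>.\<close>
          case False
          then have "X q < \<mu> * r" using q1 by simp
          then have "\<not> norm (q - p) < r / 2" using \<open>q \<notin> Q\<close> True by (auto simp: Q_def dist_norm norm_minus_commute)
          moreover have "norm (q - p) \<le> norm (q - y0) + norm (y0 - p)"
            using norm_triangle_ineq[of "q - y0" "y0 - p"] by simp
          ultimately have "3 / 8 \<le> norm (q - y0) / r" using y0p r by (simp add: le_divide_eq)
          then have "(3 / 8)\<^sup>2 \<le> (norm (q - y0) / r)\<^sup>2" by (intro power_mono) auto
          moreover have "(3 / 8 :: real)\<^sup>2 = 9 / 64" by (simp add: power2_eq_square)
          ultimately have P: "9 / 64 - \<mu> / 8 \<le> P" using x2' P_eq by linarith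
          have "r * (A * x + 0 * M - 1 * E - 0 * \<bar>A\<bar>) \<le> u q"
            using lower[of q] True qb xr by (simp add: algebra_simps X_def)
          then show ?thesis by (rule key) (use P \<mu> d\<epsilon> \<epsilon> dx x_le in linarith)+
        qed
      qed
    qed
    moreover have "Pol y \<le> 0"
    proof -
      have "Pol y = s\<^sup>2 - d * s\<^sup>2"
        using n by (simp add: Pol_def y0_def s_def X_def d_def power2_eq_square)
      moreover have "1 * s\<^sup>2 \<le> d * s\<^sup>2" using d by (intro mult_right_mono) auto
      ultimately show ?thesis by simp
    qed
    then have "0 \<le> (- (M + 8 * E) / r) * Pol y"
      using M E r by (intro mult_nonpos_nonpos) (auto simp: divide_le_0_iff)
    ultimately show "(A + c * m - 16 * d * E) * ((y - p) \<bullet> n) - \<epsilon> * (2 * c * m + 32 * d * E + \<bar>A\<bar>) * r \<le> u y"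
      by (simp add: w_def M_def X_def mult.assoc)
  qed
qed

text \<open>The value at \<open>p + (r / 2) *\<^sub>R n\<close> exceeds the lower bound, or falls
  short of the upper one, by at least \<open>(B - A) * r / 4\<close>. That side gains and the other
  is kept; the upper side is the lower one for \<open>- u\<close> with slope \<open>- B\<close>. The
  improved slope moves towards the other one and does not pass it except for a multiple of
  \<open>E\<close>, so the bound on \<open>max (abs A') (abs B')\<close> has no term in
  \<open>B - A\<close>. This keeps the slopes bounded under iteration.\<close>

lemma two_sided_improvement:
  fixes d :: real
  defines "d \<equiv> real DIM('a::euclidean_space)"
  obtains c K :: real where "0 < c" "c \<le> 1" "1 \<le> K"
    "\<And>(\<Omega> :: 'a set) u p n r \<epsilon> A B E. \<lbrakk>open \<Omega>; harmonic_fun_on \<Omega> u; continuous_on (closure \<Omega>) u;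
       flat_at \<Omega> p n r \<epsilon>; 0 \<le> \<epsilon>; \<epsilon> \<le> 1 / (16 * d); 0 < r;
       \<And>y. y \<in> frontier \<Omega> \<inter> ball p r \<Longrightarrow> u y = 0;
       \<And>y. y \<in> \<Omega> \<inter> ball p r \<Longrightarrow> A * ((y - p) \<bullet> n) - E * r \<le> u y \<and> u y \<le> B * ((y - p) \<bullet> n) + E * r;
       0 \<le> E; A \<le> B\<rbrakk>
     \<Longrightarrow> \<exists>A' B'. A' \<le> B' \<and> B' - A' \<le> (1 - c) * (B - A) + K * E \<and>
          \<bar>A' - A\<bar> \<le> c * (B - A) + K * E \<and> \<bar>B' - B\<bar> \<le> c * (B - A) + K * E \<and>
          max (abs A') (abs B') \<le> max (abs A) (abs B) + K * E \<and>
          (\<forall>y\<in>\<Omega> \<inter> ball p (r / (8 * d)).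
            A' * ((y - p) \<bullet> n) - K * \<epsilon> * (max (abs A) (abs B) + E) * (r / (8 * d)) \<le> u y \<and>
            u y \<le> B' * ((y - p) \<bullet> n) + K * \<epsilon> * (max (abs A) (abs B) + E) * (r / (8 * d)))"
proof -
  obtain c where c: "0 < c" "c \<le> 1" and
    step: "\<And>(\<Omega> :: 'a set) u p n r \<epsilon> A E m y. \<lbrakk>open \<Omega>; harmonic_fun_on \<Omega> u; continuous_on (closure \<Omega>) u;
       flat_at \<Omega> p n r \<epsilon>; 0 \<le> \<epsilon>; \<epsilon> \<le> 1 / (16 * d); 0 < r;
       \<And>y. y \<in> frontier \<Omega> \<inter> ball p r \<Longrightarrow> u y = 0;
       \<And>y. y \<in> \<Omega> \<inter> ball p r \<Longrightarrow> A * ((y - p) \<bullet> n) - E * r \<le> u y;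
       0 \<le> E; 0 \<le> m; A * (r / 2) - E * r + m * r \<le> u (p + (r / 2) *\<^sub>R n);
       y \<in> \<Omega> \<inter> ball p (r / (8 * d))\<rbrakk>
     \<Longrightarrow> (A + c * m - 16 * d * E) * ((y - p) \<bullet> n) - \<epsilon> * (2 * c * m + 32 * d * E + \<bar>A\<bar>) * r \<le> u y"
    using lower_bound_improvement[where 'a = 'a] unfolding d_def by blast
  have d: "1 \<le> d" unfolding d_def using DIM_positive[where 'a = 'a] by simp
  \<comment> \<open>The error coefficient is at most \<open>32 * d * \<epsilon> * (?M + E)\<close>
    at scale \<open>r\<close>; rewriting \<open>r\<close> as \<open>8 * d\<close> times the new
    scale gives \<open>256 * d^2\<close>.\<close>
  define K where "K = 256 * d\<^sup>2"
  have dd: "d \<le> d\<^sup>2" "1 \<le> d\<^sup>2" using d by (simp_all add: self_le_power)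
  have K: "1 \<le> K" "32 * d \<le> K" using dd unfolding K_def by linarith+
  show thesis
  proof (rule that[of "c / 4" K])
    fix \<Omega> :: "'a set" and u p n r \<epsilon> A B E
    assume \<Omega>: "open \<Omega>" "harmonic_fun_on \<Omega> u" "continuous_on (closure \<Omega>) u"
      and flat: "flat_at \<Omega> p n r \<epsilon>" and \<epsilon>: "0 \<le> \<epsilon>" "\<epsilon> \<le> 1 / (16 * d)" and r: "0 < r"
      and zero: "\<And>y. y \<in> frontier \<Omega> \<inter> ball p r \<Longrightarrow> u y = 0"
      and bd: "\<And>y. y \<in> \<Omega> \<inter> ball p r \<Longrightarrow> A * ((y - p) \<bullet> n) - E * r \<le> u y \<and> u y \<le> B * ((y - p) \<bullet> n) + E * r"
      and E: "0 \<le> E" and AB: "A \<le> B"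
    let ?M = "max (abs A) (abs B)" and ?p = "p + (r / 2) *\<^sub>R n"
    let ?c = "c / 4" and ?D = "B - A"
    have D: "0 \<le> ?D" "?D \<le> 2 * ?M" using AB by auto
    have n: "norm n = 1" using flat by (simp add: flat_at_def)
    have np: "(?p - p) \<bullet> n = r / 2" using n by (simp add: dot_square_norm)
    have "1 / (16 * d) < 1 / 2" using d by (simp add: field_simps)
    then have "\<epsilon> * r < 1 / 2 * r" using \<epsilon> r by (intro mult_strict_right_mono) auto
    then have "?p \<in> \<Omega>" using flat n r np unfolding flat_at_def
      by (elim conjE) (drule bspec[of _ _ ?p], auto simp: dist_norm)
    then have p_in: "?p \<in> \<Omega> \<inter> ball p r" using n r by (simp add: dist_norm)
    have cD: "?c * ?D \<le> ?D" "0 \<le> ?c * ?D" "?c * ?D \<le> ?D / 4"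
      using c D mult_right_mono[of ?c 1 ?D] mult_right_mono[of ?c "1/4" ?D] by auto
    have dE: "16 * d * E \<le> K * E / 2" "32 * d * E \<le> K * E" "0 \<le> 16 * d * E"
      using K E d mult_right_mono[of "32 * d" K E] by auto
    have harm': "harmonic_fun_on \<Omega> (\<lambda>y. - u y)" by (rule harmonic_fun_on_uminus[OF \<Omega>(2)])
    have cont': "continuous_on (closure \<Omega>) (\<lambda>y. - u y)" by (intro continuous_intros \<Omega>)
    have err: "\<epsilon> * (2 * c * m + 32 * d * E + \<bar>a\<bar>) * r \<le> K * \<epsilon> * (?M + E) * (r / (8 * d))"
      if "0 \<le> m" "m \<le> ?D / 4" "\<bar>a\<bar> \<le> ?M" for m a
    proof -
      have "c * m \<le> 1 * (?D / 4)" using c that by (intro mult_mono) auto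
      then have "2 * c * m + 32 * d * E + \<bar>a\<bar> \<le> 2 * ?M + 32 * d * E" using that D by simp
      also have "\<dots> \<le> 32 * d * ?M + 32 * d * E" using d by (intro add_right_mono mult_right_mono) auto
      finally have "\<epsilon> * (2 * c * m + 32 * d * E + \<bar>a\<bar>) * r \<le> \<epsilon> * (32 * d * ?M + 32 * d * E) * r"
        using \<epsilon> r by (intro mult_right_mono mult_left_mono) auto
      also have "\<dots> = K * \<epsilon> * (?M + E) * (r / (8 * d))"
        using d by (simp add: K_def field_simps power2_eq_square)
      finally show ?thesis .
    qed
    have lo: "(A + c * m - 16 * d * E) * ((y - p) \<bullet> n) - K * \<epsilon> * (?M + E) * (r / (8 * d)) \<le> u y"
      if "0 \<le> m" "m \<le> ?D / 4" "A * (r / 2) - E * r + m * r \<le> u ?p" "y \<in> \<Omega> \<inter> ball p (r / (8 * d))" for m y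
      using step[OF \<Omega> flat \<epsilon> r zero _ E that(1,3,4)] bd err[OF that(1,2), of A] by fastforce
    have up: "u y \<le> (B - c * m + 16 * d * E) * ((y - p) \<bullet> n) + K * \<epsilon> * (?M + E) * (r / (8 * d))"
      if "0 \<le> m" "m \<le> ?D / 4" "u ?p \<le> B * (r / 2) + E * r - m * r" "y \<in> \<Omega> \<inter> ball p (r / (8 * d))" for m y
    proof -
      have "(- B + c * m - 16 * d * E) * ((y - p) \<bullet> n) - \<epsilon> * (2 * c * m + 32 * d * E + \<bar>- B\<bar>) * r \<le> - u y"
      proof (rule step[OF \<Omega>(1) harm' cont' flat \<epsilon> r _ _ E that(1) _ that(4)])
        show "- u q = 0" if "q \<in> frontier \<Omega> \<inter> ball p r" for q using zero[OF that] by simp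
        show "- B * ((q - p) \<bullet> n) - E * r \<le> - u q" if "q \<in> \<Omega> \<inter> ball p r" for q
          using bd[OF that] by simp
        show "- B * (r / 2) - E * r + m * r \<le> - u ?p" using that(3) by simp
      qed
      then show ?thesis using err[OF that(1,2), of "- B"] by (simp add: algebra_simps)
    qed
    have lo0: "A * (r / 2) - E * r + 0 * r \<le> u ?p" and up0: "u ?p \<le> B * (r / 2) + E * r - 0 * r"
      using bd[OF p_in] unfolding np by auto
    have "\<exists>A' B'. (A' = A - 16 * d * E \<and> B' = B - ?c * ?D + 16 * d * E \<or> A' = A + ?c * ?D - 16 * d * E \<and> B' = B + 16 * d * E) \<and>
        (\<forall>y\<in>\<Omega> \<inter> ball p (r / (8 * d)).
            A' * ((y - p) \<bullet> n) - K * \<epsilon> * (?M + E) * (r / (8 * d)) \<le> u y \<and>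
            u y \<le> B' * ((y - p) \<bullet> n) + K * \<epsilon> * (?M + E) * (r / (8 * d)))"
    proof (cases "A * (r / 2) - E * r + ?D / 4 * r \<le> u ?p")
      case True
      have "\<forall>y\<in>\<Omega> \<inter> ball p (r / (8 * d)).
            (A + c * (?D / 4) - 16 * d * E) * ((y - p) \<bullet> n) - K * \<epsilon> * (?M + E) * (r / (8 * d)) \<le> u y \<and>
            u y \<le> (B - c * 0 + 16 * d * E) * ((y - p) \<bullet> n) + K * \<epsilon> * (?M + E) * (r / (8 * d))"
        using lo[OF _ _ True] up[OF _ _ up0] D by auto
      then show ?thesis
        by (intro exI[of _ "A + ?c * ?D - 16 * d * E"] exI[of _ "B + 16 * d * E"]) simp
    next
      case False
      \<comment> \<open>The threshold for the upper side lies above the one for the lower side by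
        \<open>2 * E * r\<close>, so failing the first alternative gives the second.\<close>
      have "B * (r / 2) + E * r - ?D / 4 * r - (A * (r / 2) - E * r + ?D / 4 * r) = 2 * (E * r)"
        by (simp add: algebra_simps add_divide_distrib diff_divide_distrib)
      moreover have "0 \<le> E * r" using E r by simp
      ultimately have up1: "u ?p \<le> B * (r / 2) + E * r - ?D / 4 * r" using False by linarith
      have "\<forall>y\<in>\<Omega> \<inter> ball p (r / (8 * d)).
            (A + c * 0 - 16 * d * E) * ((y - p) \<bullet> n) - K * \<epsilon> * (?M + E) * (r / (8 * d)) \<le> u y \<and>
            u y \<le> (B - c * (?D / 4) + 16 * d * E) * ((y - p) \<bullet> n) + K * \<epsilon> * (?M + E) * (r / (8 * d))"
        using lo[OF _ _ lo0] up[OF _ _ up1] D by auto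
      then show ?thesis
        by (intro exI[of _ "A - 16 * d * E"] exI[of _ "B - ?c * ?D + 16 * d * E"]) simp
    qed
    then obtain A' B' where AB': "A' = A - 16 * d * E \<and> B' = B - ?c * ?D + 16 * d * E \<or> A' = A + ?c * ?D - 16 * d * E \<and> B' = B + 16 * d * E"
      and bd': "\<forall>y\<in>\<Omega> \<inter> ball p (r / (8 * d)).
            A' * ((y - p) \<bullet> n) - K * \<epsilon> * (?M + E) * (r / (8 * d)) \<le> u y \<and>
            u y \<le> B' * ((y - p) \<bullet> n) + K * \<epsilon> * (?M + E) * (r / (8 * d))" by blast
    have D'_eq: "(1 - ?c) * ?D = ?D - ?c * ?D" by (simp only: left_diff_distrib mult_1_left)
    show "\<exists>A' B'. A' \<le> B' \<and> B' - A' \<le> (1 - ?c) * ?D + K * E \<and>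
          \<bar>A' - A\<bar> \<le> ?c * ?D + K * E \<and> \<bar>B' - B\<bar> \<le> ?c * ?D + K * E \<and>
          max (abs A') (abs B') \<le> ?M + K * E \<and>
          (\<forall>y\<in>\<Omega> \<inter> ball p (r / (8 * d)).
            A' * ((y - p) \<bullet> n) - K * \<epsilon> * (?M + E) * (r / (8 * d)) \<le> u y \<and>
            u y \<le> B' * ((y - p) \<bullet> n) + K * \<epsilon> * (?M + E) * (r / (8 * d)))"
    proof (rule exI[of _ A'], rule exI[of _ B'], intro conjI bd')
      show "A' \<le> B'" "B' - A' \<le> (1 - ?c) * ?D + K * E" "\<bar>A' - A\<bar> \<le> ?c * ?D + K * E"
        "\<bar>B' - B\<bar> \<le> ?c * ?D + K * E" "max (abs A') (abs B') \<le> ?M + K * E"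
        unfolding D'_eq using AB' cD dE by (elim disjE; linarith)+
    qed
  qed (use c K in auto)
qed

section \<open>Iteration over geometric scales\<close>

text \<open>The recursion reads \<open>c * \<delta> i = \<delta> i - \<delta> (Suc i) + e i\<close>,
  and its sum telescopes.\<close>

lemma affine_recursion_summable:
  fixes \<delta> e :: "nat \<Rightarrow> real"
  assumes "0 < c" "c \<le> 1" "0 \<le> \<delta> 0" "\<And>i. 0 \<le> e i" "summable e"
    and rec: "\<And>i. \<delta> (Suc i) = (1 - c) * \<delta> i + e i"
  shows "summable \<delta>"
proof -
  have nonneg: "0 \<le> \<delta> i" for i
    by (induction i) (use assms in auto)
  have "c * (\<Sum>i<N. \<delta> i) \<le> \<delta> 0 + (\<Sum>i<N. e i) - \<delta> N" for N
  proof (induction N)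
    case (Suc N)
    then show ?case using rec[of N] by (simp add: algebra_simps)
  qed simp
  moreover have "(\<Sum>i<N. e i) \<le> suminf e" for N
    using assms by (intro sum_le_suminf) auto
  ultimately have "c * (\<Sum>i<N. \<delta> i) \<le> \<delta> 0 + suminf e" for N
    using nonneg[of N] by (meson add_left_mono diff_le_eq le_add_same_cancel1 order_trans)
  then have "(\<Sum>i<N. \<delta> i) \<le> (\<delta> 0 + suminf e) / c" for N
    using \<open>0 < c\<close> by (simp add: le_divide_eq mult.commute)
  then show ?thesis using nonneg by (intro summableI_nonneg_bounded[of \<delta>])
qed

text \<open>A discrete Gronwall inequality, from \<open>1 + e i \<le> exp (e i)\<close>.\<close>

lemma le_exp_sum_of_le_mult:
  fixes y e :: "nat \<Rightarrow> real"
  assumes "0 \<le> y 0" "\<And>i. 0 \<le> e i" "summable e" and rec: "\<And>i. y (Suc i) \<le> y i * (1 + e i)"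
  shows "y i \<le> y 0 * exp (suminf e)"
proof -
  have "y i \<le> y 0 * exp (\<Sum>j<i. e j)"
  proof (induction i)
    case (Suc i)
    have "y (Suc i) \<le> y i * (1 + e i)" by (rule rec)
    also have "\<dots> \<le> y 0 * exp (\<Sum>j<i. e j) * (1 + e i)"
      using Suc assms(2)[of i] by (intro mult_right_mono) auto
    also have "\<dots> \<le> y 0 * exp (\<Sum>j<i. e j) * exp (e i)"
      using assms(1) exp_ge_add_one_self[of "e i"] by (intro mult_left_mono) auto
    finally show ?case by (simp add: exp_add)
  qed simp
  also have "\<dots> \<le> y 0 * exp (suminf e)"
    using assms sum_le_suminf[of e "{..<i}"] by (intro mult_left_mono) auto
  finally show ?thesis .
qed

text \<open>
  In a sequence of slab bounds \<open>A i * X - E i * r i \<le> u \<le> B i * X + E i * r i\<close> the error \<open>E\<close> is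
  controlled by the flatness \<open>\<epsilon>\<close>, so the widths \<open>B i - A i\<close> tend to zero and the coefficients at
  scale \<open>j\<close> are close to those at any smaller scale \<open>k\<close>.  All rates depend only on the data.
\<close>

lemma slab_coefficients_rate:
  fixes \<epsilon> :: "nat \<Rightarrow> real"
  assumes c: "0 < c" "c \<le> 1" and K: "1 \<le> K" and \<epsilon>: "\<And>i. 0 \<le> \<epsilon> i" "summable \<epsilon>" and "0 \<le> e0" "0 \<le> \<tau>"
  obtains \<kappa> :: "nat \<Rightarrow> real" where "\<kappa> \<longlonglongrightarrow> 0"
    "\<And>A B E j k. \<lbrakk>A 0 = 0; B 0 = 0; E 0 = e0; \<And>i. A i \<le> B i; \<And>i. 0 \<le> E i;
       \<And>i. B (Suc i) - A (Suc i) \<le> (1 - c) * (B i - A i) + K * E i;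
       \<And>i. abs (A (Suc i) - A i) \<le> c * (B i - A i) + K * E i;
       \<And>i. abs (B (Suc i) - B i) \<le> c * (B i - A i) + K * E i;
       \<And>i. max (abs (A (Suc i))) (abs (B (Suc i))) \<le> max (abs (A i)) (abs (B i)) + K * E i;
       \<And>i. E (Suc i) = K * \<epsilon> i * (max (abs (A i)) (abs (B i)) + E i);
       j \<le> k; A k \<le> \<tau> * E k; - (\<tau> * E k) \<le> B k\<rbrakk>
     \<Longrightarrow> max (abs (A j)) (abs (B j)) + E j \<le> \<kappa> j"
proof -
  \<comment> \<open>Majorants built from the data alone, before any sequence is given:
    \<open>Y\<close> for the slopes, \<open>e\<close> for the errors, \<open>\<delta>\<close> for
    the widths, \<open>T\<close> for the tails of the errors. In \<open>\<kappa>\<close> the summand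
    \<open>2 * K\<close> pays for the drift, \<open>\<tau>\<close> for the condition at scale
    \<open>k\<close>, and 1 for \<open>E j\<close>.\<close>
  define Y where "Y = K * e0 * exp (suminf (\<lambda>i. K\<^sup>2 * \<epsilon> i))"
  define e where "e = (\<lambda>i. case i of 0 \<Rightarrow> e0 | Suc i \<Rightarrow> K * \<epsilon> i * Y)"
  define \<delta> where "\<delta> = rec_nat 0 (\<lambda>i x. (1 - c) * x + K * e i)"
  define T where "T = (\<lambda>j. \<Sum>i. e (i + j))"
  define \<kappa> where "\<kappa> = (\<lambda>j. \<delta> j + (\<tau> + 2 * K + 1) * T j)"
  have Y: "0 \<le> Y" using K \<open>0 \<le> e0\<close> by (simp add: Y_def)
  have e: "0 \<le> e i" for i using \<open>0 \<le> e0\<close> K \<epsilon> Y by (cases i) (auto simp: e_def)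
  have sume: "summable e"
  proof -
    have "summable (\<lambda>i. e (Suc i))" using \<epsilon> by (simp add: e_def summable_mult summable_mult2)
    then show ?thesis by (simp only: summable_Suc_iff)
  qed
  have "summable \<delta>"
    by (rule affine_recursion_summable[OF c, of \<delta> "\<lambda>i. K * e i"])
       (use K e sume in \<open>auto simp: \<delta>_def intro: summable_mult\<close>)
  then have "\<delta> \<longlonglongrightarrow> 0" by (rule summable_LIMSEQ_zero)
  moreover have "T \<longlonglongrightarrow> 0" unfolding T_def using sume by (rule suminf_exist_split2)
  ultimately have "\<kappa> \<longlonglongrightarrow> 0" unfolding \<kappa>_def by (auto intro!: tendsto_eq_intros)
  then show thesis
  proof (rule that)
    fix A B E :: "nat \<Rightarrow> real" and j k
    assume init: "A 0 = 0" "B 0 = 0" "E 0 = e0" and AB: "\<And>i. A i \<le> B i" and E: "\<And>i. 0 \<le> E i"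
      and D: "\<And>i. B (Suc i) - A (Suc i) \<le> (1 - c) * (B i - A i) + K * E i"
      and dA: "\<And>i. abs (A (Suc i) - A i) \<le> c * (B i - A i) + K * E i"
      and dB: "\<And>i. abs (B (Suc i) - B i) \<le> c * (B i - A i) + K * E i"
      and M: "\<And>i. max (abs (A (Suc i))) (abs (B (Suc i))) \<le> max (abs (A i)) (abs (B i)) + K * E i"
      and E_Suc: "\<And>i. E (Suc i) = K * \<epsilon> i * (max (abs (A i)) (abs (B i)) + E i)"
      and "j \<le> k" and k: "A k \<le> \<tau> * E k" "- (\<tau> * E k) \<le> B k"
    define m where "m = (\<lambda>i. max (abs (A i)) (abs (B i)))"
    have m: "0 \<le> m i" for i by (simp add: m_def)
    have M': "m (Suc i) \<le> m i + K * E i" for i using M[of i] unfolding m_def .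
    have EK: "E i \<le> K * E i" for i using K E[of i] by (simp add: mult_le_cancel_right1)
    \<comment> \<open>One step adds \<open>K * E i\<close> to the slopes, and the new error is at
      most \<open>K * \<epsilon> i * (m i + K * E i)\<close>. Hence the combination
      \<open>m i + K * E i\<close> grows at most by the factor
      \<open>1 + K^2 * \<epsilon> i\<close>.\<close>
    have Ybd: "m i + K * E i \<le> Y" for i
    proof -
      have "m i + K * E i \<le> (m 0 + K * E 0) * exp (suminf (\<lambda>i. K\<^sup>2 * \<epsilon> i))"
      proof (rule le_exp_sum_of_le_mult)
        show "0 \<le> m 0 + K * E 0" using m[of 0] E[of 0] K by simp
        show "summable (\<lambda>i. K\<^sup>2 * \<epsilon> i)" using \<epsilon> by (simp add: summable_mult)
        fix i
        show "0 \<le> K\<^sup>2 * \<epsilon> i" using \<epsilon> by simp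
        have "K * E (Suc i) = K\<^sup>2 * \<epsilon> i * (m i + E i)" by (simp add: E_Suc m_def power2_eq_square)
        also have "\<dots> \<le> K\<^sup>2 * \<epsilon> i * (m i + K * E i)" using EK \<epsilon> by (intro mult_left_mono) auto
        finally show "m (Suc i) + K * E (Suc i) \<le> (m i + K * E i) * (1 + K\<^sup>2 * \<epsilon> i)"
          using M'[of i] by (simp add: algebra_simps)
      qed
      then show ?thesis using init by (simp add: m_def Y_def)
    qed
    have Ee: "E i \<le> e i" for i
    proof (cases i)
      case 0
      then show ?thesis using init by (simp add: e_def)
    next
      case (Suc i')
      have "m i' + E i' \<le> Y" using Ybd[of i'] EK[of i'] by linarith
      then have "K * \<epsilon> i' * (m i' + E i') \<le> K * \<epsilon> i' * Y" using K \<epsilon> by (intro mult_left_mono) auto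
      then show ?thesis using Suc by (simp add: e_def E_Suc m_def)
    qed
    have D\<delta>: "B i - A i \<le> \<delta> i" for i
    proof (induction i)
      case (Suc i)
      have "(1 - c) * (B i - A i) \<le> (1 - c) * \<delta> i" "K * E i \<le> K * e i"
        using Suc c K Ee by (auto intro: mult_left_mono)
      then show ?case using D[of i] by (simp add: \<delta>_def)
    qed (use init in \<open>simp add: \<delta>_def\<close>)
    have T_ge: "(\<Sum>i=j..<k. E i) \<le> T j" "E k \<le> T j" "E j \<le> T j"
    proof -
      have "(\<Sum>i=j..<k'. E i) \<le> T j" if "j \<le> k'" for k'
      proof -
        have "(\<Sum>i=j..<k'. E i) \<le> (\<Sum>i=j..<k'. e i)" using Ee by (intro sum_mono)
        also have "\<dots> = (\<Sum>i<k' - j. e (i + j))"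
          using sum.shift_bounds_nat_ivl[of e 0 j "k' - j"] that by (simp add: atLeast0LessThan)
        also have "\<dots> \<le> T j" unfolding T_def
          using e sume by (intro sum_le_suminf) (auto simp: summable_iff_shift)
        finally show ?thesis .
      qed
      note part = this
      have single: "E i \<le> T j" if "i \<in> {j..<Suc k}" for i
      proof -
        have "E i \<le> (\<Sum>i=j..<Suc k. E i)"
          using E that by (intro member_le_sum) auto
        also have "\<dots> \<le> T j" using \<open>j \<le> k\<close> by (intro part) simp
        finally show ?thesis .
      qed
      show "(\<Sum>i=j..<k. E i) \<le> T j" by (rule part) fact
      show "E k \<le> T j" "E j \<le> T j" using \<open>j \<le> k\<close> by (auto intro: single)
    qed
    \<comment> \<open>The term \<open>c * (B i - A i)\<close> is at most the width lost in the step
      plus \<open>K * E i\<close>, so these terms telescope.\<close>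
    have drift: "abs (F k - F j) \<le> (B j - A j) - (B k - A k) + 2 * K * (\<Sum>i=j..<k. E i)"
      if dF: "\<And>i. abs (F (Suc i) - F i) \<le> c * (B i - A i) + K * E i" for F
      using \<open>j \<le> k\<close>
    proof (induction k rule: dec_induct)
      case (step i)
      have "c * (B i - A i) \<le> (B i - A i) - (B (Suc i) - A (Suc i)) + K * E i"
        using D[of i] by (simp add: algebra_simps)
      then show ?case using step.IH dF[of i] \<open>j \<le> i\<close> by (simp add: algebra_simps)
    qed simp
    have KT: "2 * K * (\<Sum>i=j..<k. E i) \<le> 2 * K * T j" using T_ge K by (intro mult_left_mono) auto
    have \<tau>T: "\<tau> * E k \<le> \<tau> * T j" using T_ge \<open>0 \<le> \<tau>\<close> by (intro mult_left_mono) auto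
    \<comment> \<open>For the lower bound on \<open>A j\<close>, write \<open>A k\<close> as
      \<open>B k\<close> minus the width at \<open>k\<close>: this width cancels the one gained in
      \<open>drift\<close>. The upper bound on \<open>B j\<close> is symmetric.\<close>
    have "abs (A j) \<le> \<delta> j + 2 * K * T j + \<tau> * T j" "abs (B j) \<le> \<delta> j + 2 * K * T j + \<tau> * T j"
      using drift[OF dA] drift[OF dB] KT \<tau>T k D\<delta>[of j] AB[of k] by linarith+
    moreover have "\<kappa> j = \<delta> j + 2 * K * T j + \<tau> * T j + T j" by (simp add: \<kappa>_def algebra_simps)
    ultimately show "max (abs (A j)) (abs (B j)) + E j \<le> \<kappa> j" using T_ge by simp
  qed
qed

text \<open>Two-sided improvement is iterated from \<open>A = B = 0\<close>. A zero \<open>z\<close>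
  at height comparable to scale \<open>k\<close> yields the condition on the slopes at
  \<open>k\<close>, which controls every scale \<open>j \<le> k\<close>. Since
  \<open>\<kappa>\<close> precedes \<open>p\<close> and \<open>k\<close>, both may vary with the
  zero.\<close>

lemma uniform_vanishing_rate:
  fixes d :: real and \<epsilon> :: "nat \<Rightarrow> real"
  defines "d \<equiv> real DIM('a::euclidean_space)"
  assumes \<epsilon>: "\<And>i. 0 \<le> \<epsilon> i" "summable \<epsilon>" "\<And>i. \<epsilon> i \<le> 1 / (16 * d)"
    and "0 < r0" "0 \<le> e0" "0 \<le> \<tau>"
  obtains \<kappa> :: "nat \<Rightarrow> real" where "\<kappa> \<longlonglongrightarrow> 0"
    "\<And>(\<Omega> :: 'a set) u p n j k z y. \<lbrakk>open \<Omega>; harmonic_fun_on \<Omega> u; continuous_on (closure \<Omega>) u;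
       \<And>i. flat_at \<Omega> p n (r0 / (8 * d) ^ i) (\<epsilon> i);
       \<And>y. y \<in> frontier \<Omega> \<inter> ball p r0 \<Longrightarrow> u y = 0;
       \<And>y. y \<in> \<Omega> \<inter> ball p r0 \<Longrightarrow> abs (u y) \<le> e0 * r0;
       j \<le> k; z \<in> \<Omega> \<inter> ball p (r0 / (8 * d) ^ k); u z = 0; r0 / (8 * d) ^ k \<le> \<tau> * ((z - p) \<bullet> n);
       y \<in> \<Omega> \<inter> ball p (r0 / (8 * d) ^ j)\<rbrakk>
     \<Longrightarrow> abs (u y) \<le> \<kappa> j * (r0 / (8 * d) ^ j)"
proof -
  obtain c K :: real where c: "0 < c" "c \<le> 1" and K: "1 \<le> K" and
    step: "\<And>(\<Omega> :: 'a set) u p n r \<epsilon> A B E. \<lbrakk>open \<Omega>; harmonic_fun_on \<Omega> u; continuous_on (closure \<Omega>) u;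
       flat_at \<Omega> p n r \<epsilon>; 0 \<le> \<epsilon>; \<epsilon> \<le> 1 / (16 * d); 0 < r;
       \<And>y. y \<in> frontier \<Omega> \<inter> ball p r \<Longrightarrow> u y = 0;
       \<And>y. y \<in> \<Omega> \<inter> ball p r \<Longrightarrow> A * ((y - p) \<bullet> n) - E * r \<le> u y \<and> u y \<le> B * ((y - p) \<bullet> n) + E * r;
       0 \<le> E; A \<le> B\<rbrakk>
     \<Longrightarrow> \<exists>A' B'. A' \<le> B' \<and> B' - A' \<le> (1 - c) * (B - A) + K * E \<and>
          \<bar>A' - A\<bar> \<le> c * (B - A) + K * E \<and> \<bar>B' - B\<bar> \<le> c * (B - A) + K * E \<and>
          max (abs A') (abs B') \<le> max (abs A) (abs B) + K * E \<and>
          (\<forall>y\<in>\<Omega> \<inter> ball p (r / (8 * d)).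
            A' * ((y - p) \<bullet> n) - K * \<epsilon> * (max (abs A) (abs B) + E) * (r / (8 * d)) \<le> u y \<and>
            u y \<le> B' * ((y - p) \<bullet> n) + K * \<epsilon> * (max (abs A) (abs B) + E) * (r / (8 * d)))"
    using two_sided_improvement[where 'a = 'a] unfolding d_def by blast
  obtain \<kappa> :: "nat \<Rightarrow> real" where "\<kappa> \<longlonglongrightarrow> 0" and \<kappa>:
    "\<And>A B E j k. \<lbrakk>A 0 = 0; B 0 = 0; E 0 = e0; \<And>i. A i \<le> B i; \<And>i. 0 \<le> E i;
       \<And>i. B (Suc i) - A (Suc i) \<le> (1 - c) * (B i - A i) + K * E i;
       \<And>i. abs (A (Suc i) - A i) \<le> c * (B i - A i) + K * E i;
       \<And>i. abs (B (Suc i) - B i) \<le> c * (B i - A i) + K * E i;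
       \<And>i. max (abs (A (Suc i))) (abs (B (Suc i))) \<le> max (abs (A i)) (abs (B i)) + K * E i;
       \<And>i. E (Suc i) = K * \<epsilon> i * (max (abs (A i)) (abs (B i)) + E i);
       j \<le> k; A k \<le> \<tau> * E k; - (\<tau> * E k) \<le> B k\<rbrakk>
     \<Longrightarrow> max (abs (A j)) (abs (B j)) + E j \<le> \<kappa> j"
    using slab_coefficients_rate[OF c K \<epsilon>(1,2) \<open>0 \<le> e0\<close> \<open>0 \<le> \<tau>\<close>] by blast
  have d: "1 \<le> d" unfolding d_def using DIM_positive[where 'a = 'a] by simp
  show thesis
  proof (rule that[OF \<open>\<kappa> \<longlonglongrightarrow> 0\<close>])
    fix \<Omega> :: "'a set" and u p n j k z y
    define r where "r = (\<lambda>i. r0 / (8 * d) ^ i)"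
    assume \<Omega>: "open \<Omega>" "harmonic_fun_on \<Omega> u" "continuous_on (closure \<Omega>) u"
      and "\<And>i. flat_at \<Omega> p n (r0 / (8 * d) ^ i) (\<epsilon> i)"
      and zero: "\<And>y. y \<in> frontier \<Omega> \<inter> ball p r0 \<Longrightarrow> u y = 0"
      and bd0: "\<And>y. y \<in> \<Omega> \<inter> ball p r0 \<Longrightarrow> abs (u y) \<le> e0 * r0"
      and "j \<le> k" and "z \<in> \<Omega> \<inter> ball p (r0 / (8 * d) ^ k)" "u z = 0" "r0 / (8 * d) ^ k \<le> \<tau> * ((z - p) \<bullet> n)"
      and "y \<in> \<Omega> \<inter> ball p (r0 / (8 * d) ^ j)"
    then have flat: "\<And>i. flat_at \<Omega> p n (r i) (\<epsilon> i)" and z: "z \<in> \<Omega> \<inter> ball p (r k)" "u z = 0" "r k \<le> \<tau> * ((z - p) \<bullet> n)"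
      and y: "y \<in> \<Omega> \<inter> ball p (r j)" by (auto simp: r_def)
    have r: "0 < r i" for i using d \<open>0 < r0\<close> by (simp add: r_def)
    have r_Suc: "r (Suc i) = r i / (8 * d)" for i by (simp add: r_def)
    have r_le: "r i \<le> r0" for i
      using d \<open>0 < r0\<close> one_le_power[of "8 * d" i] by (simp add: r_def divide_le_eq mult_le_cancel_left1)
    \<comment> \<open>Invariant and step relation for dependent choice. The clause for
      \<open>i = 0\<close> pins the initial values that the rate lemma expects.\<close>
    define bnd where "bnd = (\<lambda>i (A, B, E). A \<le> B \<and> 0 \<le> E \<and>
       (\<forall>y\<in>\<Omega> \<inter> ball p (r i). A * ((y - p) \<bullet> n) - E * r i \<le> u y \<and> u y \<le> B * ((y - p) \<bullet> n) + E * r i) \<and>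
       (i = 0 \<longrightarrow> A = 0 \<and> B = 0 \<and> E = e0))"
    define nxt where "nxt = (\<lambda>i (A, B, E) (A', B', E'). B' - A' \<le> (1 - c) * (B - A) + K * E \<and>
          abs (A' - A) \<le> c * (B - A) + K * E \<and> abs (B' - B) \<le> c * (B - A) + K * E \<and>
          max (abs A') (abs B') \<le> max (abs A) (abs B) + K * E \<and> E' = K * \<epsilon> i * (max (abs A) (abs B) + E))"
    have "\<exists>f. \<forall>i. bnd i (f i) \<and> nxt i (f i) (f (Suc i))"
    proof (rule dependent_nat_choice)
      have "bnd 0 (0, 0, e0)" using \<open>0 \<le> e0\<close> bd0 by (force simp: bnd_def r_def abs_le_iff)
      then show "\<exists>t. bnd 0 t" by blast
      fix t i assume bt: "bnd i t"
      obtain A B E where t: "t = (A, B, E)" by (cases t)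
      have "\<exists>A' B'. A' \<le> B' \<and> B' - A' \<le> (1 - c) * (B - A) + K * E \<and>
          \<bar>A' - A\<bar> \<le> c * (B - A) + K * E \<and> \<bar>B' - B\<bar> \<le> c * (B - A) + K * E \<and>
          max (abs A') (abs B') \<le> max (abs A) (abs B) + K * E \<and>
          (\<forall>y\<in>\<Omega> \<inter> ball p (r i / (8 * d)).
            A' * ((y - p) \<bullet> n) - K * \<epsilon> i * (max (abs A) (abs B) + E) * (r i / (8 * d)) \<le> u y \<and>
            u y \<le> B' * ((y - p) \<bullet> n) + K * \<epsilon> i * (max (abs A) (abs B) + E) * (r i / (8 * d)))"
        by (rule step[OF \<Omega> flat \<epsilon>(1,3) r]) (use zero bt r_le[of i] in \<open>auto simp: bnd_def t\<close>)
      then obtain A' B' where "A' \<le> B'" and st: "B' - A' \<le> (1 - c) * (B - A) + K * E"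
          "\<bar>A' - A\<bar> \<le> c * (B - A) + K * E" "\<bar>B' - B\<bar> \<le> c * (B - A) + K * E"
          "max (abs A') (abs B') \<le> max (abs A) (abs B) + K * E"
          "\<forall>y\<in>\<Omega> \<inter> ball p (r i / (8 * d)).
            A' * ((y - p) \<bullet> n) - K * \<epsilon> i * (max (abs A) (abs B) + E) * (r i / (8 * d)) \<le> u y \<and>
            u y \<le> B' * ((y - p) \<bullet> n) + K * \<epsilon> i * (max (abs A) (abs B) + E) * (r i / (8 * d))"
        by blast
      have "0 \<le> K * \<epsilon> i * (max (abs A) (abs B) + E)"
        using K \<epsilon> bt by (auto simp: bnd_def t)
      then have "bnd (Suc i) (A', B', K * \<epsilon> i * (max (abs A) (abs B) + E))"
        using st \<open>A' \<le> B'\<close> by (simp add: bnd_def r_Suc)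
      moreover have "nxt i t (A', B', K * \<epsilon> i * (max (abs A) (abs B) + E))"
        using st by (simp add: nxt_def t)
      ultimately show "\<exists>t'. bnd (Suc i) t' \<and> nxt i t t'" by blast
    qed
    then obtain f where f: "\<And>i. bnd i (f i)" "\<And>i. nxt i (f i) (f (Suc i))" by blast
    define A B E where "A = (\<lambda>i. fst (f i))" and "B = (\<lambda>i. fst (snd (f i)))" and "E = (\<lambda>i. snd (snd (f i)))"
    have bnd': "bnd i (A i, B i, E i)" for i using f(1)[of i] by (simp add: A_def B_def E_def)
    have nxt': "nxt i (A i, B i, E i) (A (Suc i), B (Suc i), E (Suc i))" for i
      using f(2)[of i] by (simp add: A_def B_def E_def)
    have bd: "A i * ((y - p) \<bullet> n) - E i * r i \<le> u y \<and> u y \<le> B i * ((y - p) \<bullet> n) + E i * r i"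
      if "y \<in> \<Omega> \<inter> ball p (r i)" for i y using bnd'[of i] that by (auto simp: bnd_def)
    have E: "0 \<le> E i" and AB: "A i \<le> B i" for i using bnd'[of i] by (auto simp: bnd_def)
    have Xz: "0 < (z - p) \<bullet> n" using z(3) r[of k] mult_nonneg_nonpos[OF \<open>0 \<le> \<tau>\<close>, of "(z - p) \<bullet> n"] by linarith
    have Er: "E k * r k \<le> (\<tau> * E k) * ((z - p) \<bullet> n)"
      using mult_left_mono[OF z(3) E[of k]] by (simp only: mult_ac)
    \<comment> \<open>The slab bounds at \<open>z\<close> with \<open>u z = 0\<close>, where
      \<open>r k\<close> is replaced by \<open>\<tau>\<close> times the height of \<open>z\<close>;
      the height is positive and can be cancelled.\<close>
    have "A k * ((z - p) \<bullet> n) \<le> (\<tau> * E k) * ((z - p) \<bullet> n)" "(- (\<tau> * E k)) * ((z - p) \<bullet> n) \<le> B k * ((z - p) \<bullet> n)"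
      using bd[OF z(1)] Er unfolding z(2) mult_minus_left by linarith+
    from this[THEN mult_right_le_imp_le] Xz
    have Ak: "A k \<le> \<tau> * E k" and Bk: "- (\<tau> * E k) \<le> B k" by blast+
    have \<kappa>j: "max (abs (A j)) (abs (B j)) + E j \<le> \<kappa> j"
      by (rule \<kappa>[of A B E j k, OF _ _ _ AB E _ _ _ _ _ \<open>j \<le> k\<close> Ak Bk])
         (use bnd'[of 0] nxt' in \<open>simp_all add: bnd_def nxt_def\<close>)
    have n: "norm n = 1" using flat by (simp add: flat_at_def)
    have X: "abs ((y - p) \<bullet> n) \<le> r j"
      using Cauchy_Schwarz_ineq2[of "y - p" n] n y by (simp add: dist_norm norm_minus_commute)
    have "abs (F * ((y - p) \<bullet> n)) \<le> max (abs (A j)) (abs (B j)) * r j" if "abs F \<le> max (abs (A j)) (abs (B j))" for F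
      unfolding abs_mult using that X by (intro mult_mono) auto
    from this[of "A j", OF max.cobounded1] this[of "B j", OF max.cobounded2]
    have "abs (u y) \<le> (max (abs (A j)) (abs (B j)) + E j) * r j"
      using bd[OF y] unfolding distrib_right by linarith
    also have "\<dots> \<le> \<kappa> j * r j" using \<kappa>j r[of j] by (intro mult_right_mono) auto
    finally show "abs (u y) \<le> \<kappa> j * (r0 / (8 * d) ^ j)" by (simp add: r_def)
  qed
qed

text \<open>Positivity is used once: at scale \<open>k\<close> the lower bound 0 holds with no
  error, and one step turns it into the slope \<open>a = c * m\<close>. Afterwards each step costs
  \<open>16 * d * E\<close>, and these losses sum to less than \<open>a / 2\<close> when
  \<open>k\<close> is large. Only the lower bound is iterated.\<close>

lemma positive_linear_growth:
  fixes d r0 :: real and \<epsilon> :: "nat \<Rightarrow> real" and \<Omega> :: "'a::euclidean_space set"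
  defines "d \<equiv> real DIM('a)"
  defines "r \<equiv> (\<lambda>i. r0 / (8 * d) ^ i)"
  assumes \<epsilon>: "\<And>i. 0 \<le> \<epsilon> i" "summable \<epsilon>" "\<And>i. \<epsilon> i \<le> 1 / (16 * d)" and "0 < r0"
    and \<Omega>: "open \<Omega>" "harmonic_fun_on \<Omega> u" "continuous_on (closure \<Omega>) u"
    and flat: "\<And>i. flat_at \<Omega> p n (r i) (\<epsilon> i)"
    and zero: "\<And>y. y \<in> frontier \<Omega> \<inter> ball p r0 \<Longrightarrow> u y = 0"
    and pos: "\<And>y. y \<in> \<Omega> \<inter> ball p r0 \<Longrightarrow> 0 < u y"
  obtains a N where "0 < a" "\<And>i. N \<le> i \<Longrightarrow> p + (r i / 2) *\<^sub>R n \<in> \<Omega> \<and> a * r i \<le> u (p + (r i / 2) *\<^sub>R n)"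
proof -
  obtain c where c: "0 < c" "c \<le> 1" and
    step: "\<And>(\<Omega> :: 'a set) u p n r \<epsilon> A E m y. \<lbrakk>open \<Omega>; harmonic_fun_on \<Omega> u; continuous_on (closure \<Omega>) u;
       flat_at \<Omega> p n r \<epsilon>; 0 \<le> \<epsilon>; \<epsilon> \<le> 1 / (16 * d); 0 < r;
       \<And>y. y \<in> frontier \<Omega> \<inter> ball p r \<Longrightarrow> u y = 0;
       \<And>y. y \<in> \<Omega> \<inter> ball p r \<Longrightarrow> A * ((y - p) \<bullet> n) - E * r \<le> u y;
       0 \<le> E; 0 \<le> m; A * (r / 2) - E * r + m * r \<le> u (p + (r / 2) *\<^sub>R n);
       y \<in> \<Omega> \<inter> ball p (r / (8 * d))\<rbrakk>
     \<Longrightarrow> (A + c * m - 16 * d * E) * ((y - p) \<bullet> n) - \<epsilon> * (2 * c * m + 32 * d * E + \<bar>A\<bar>) * r \<le> u y"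
    using lower_bound_improvement[where 'a = 'a] unfolding d_def by blast
  have d: "1 \<le> d" unfolding d_def using DIM_positive[where 'a = 'a] by simp
  have r: "0 < r i" for i using d \<open>0 < r0\<close> by (simp add: r_def)
  have r_Suc: "r i / (8 * d) = r (Suc i)" "r i = 8 * d * r (Suc i)" for i using d by (simp_all add: r_def)
  have r_le: "r i \<le> r0" for i
    using d \<open>0 < r0\<close> one_le_power[of "8 * d" i] by (simp add: r_def divide_le_eq mult_le_cancel_left1)
  have sub: "ball p (r i) \<subseteq> ball p r0" for i using r_le by (rule subset_ball)
  have zero': "u y = 0" if "y \<in> frontier \<Omega> \<inter> ball p (r i)" for y i using zero sub that by blast
  have n: "norm n = 1" "n \<bullet> n = 1" using flat[of 0] by (auto simp: flat_at_def dot_square_norm)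
  have centre: "p + (r i / 2) *\<^sub>R n \<in> \<Omega> \<inter> ball p (r i)" for i
  proof -
    have "1 / (16 * d) < 1 / 2" using d by (simp add: field_simps)
    then have "\<epsilon> i * r i < 1 / 2 * r i" using \<epsilon>(3)[of i] r[of i] by (intro mult_strict_right_mono) linarith+
    moreover have in_ball: "p + (r i / 2) *\<^sub>R n \<in> ball p (r i)" using n r[of i] by (simp add: dist_norm)
    moreover have "(p + (r i / 2) *\<^sub>R n - p) \<bullet> n = r i / 2" using n by simp
    ultimately have "p + (r i / 2) *\<^sub>R n \<in> \<Omega>"
      using flat[of i] unfolding flat_at_def by auto
    then show ?thesis using in_ball by blast
  qed
  \<comment> \<open>With the tail of \<open>\<epsilon>\<close> below \<open>1 / K\<close>, the total
    loss \<open>320 * d^2 * a * (\<Sum>i<q. \<epsilon> (i + k))\<close> is at most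
    \<open>320 * a / 3000\<close>.\<close>
  define K where "K = 1 + 3000 * d\<^sup>2"
  have K: "1 \<le> K" by (simp add: K_def)
  obtain k where k: "\<And>j. k \<le> j \<Longrightarrow> norm (\<Sum>i. \<epsilon> (i + j)) < 1 / K"
    using suminf_exist_split[OF _ \<epsilon>(2), of "1 / K"] K by auto
  have tail: "(\<Sum>i<q. \<epsilon> (i + k)) \<le> 1 / K" for q
  proof -
    have "(\<Sum>i<q. \<epsilon> (i + k)) \<le> (\<Sum>i. \<epsilon> (i + k))"
      using \<epsilon> by (intro sum_le_suminf) (auto simp: summable_iff_shift)
    also have "\<dots> \<le> 1 / K" using k[of k] by simp
    finally show ?thesis .
  qed
  have small: "\<epsilon> (q + k) \<le> 1 / K" for q
  proof -
    have "\<epsilon> (q + k) \<le> (\<Sum>i<Suc q. \<epsilon> (i + k))" using \<epsilon> by (intro member_le_sum) auto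
    then show ?thesis using tail[of "Suc q"] by linarith
  qed
  define m where "m = u (p + (r k / 2) *\<^sub>R n) / r k"
  define a where "a = c * m"
  have m: "0 < m" unfolding m_def using pos[of "p + (r k / 2) *\<^sub>R n"] centre[of k] sub[of k] r[of k] by auto
  have a: "0 < a" using c m by (simp add: a_def)
  have dK: "d * (1 / K) \<le> 1 / 3000" "d\<^sup>2 * (1 / K) \<le> 1 / 3000"
  proof -
    have "d \<le> d\<^sup>2" using d by (simp add: self_le_power)
    then show "d * (1 / K) \<le> 1 / 3000" "d\<^sup>2 * (1 / K) \<le> 1 / 3000"
      using d K by (simp_all add: divide_le_eq K_def)
  qed
  \<comment> \<open>The error left by a step is at most \<open>2 * a * \<epsilon>\<close> at the old
    scale, that is \<open>16 * d * a * \<epsilon>\<close> at the new one; 20 leaves room. The next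
    step then costs the slope \<open>16 * d * 20 * d * a * \<epsilon>\<close>, whence 320. The
    flatness has index \<open>q + k\<close> but the bound lives at the next scale.\<close>
  have inv: "\<exists>A. a - 320 * d\<^sup>2 * a * (\<Sum>i<q. \<epsilon> (i + k)) \<le> A \<and> A \<le> a \<and>
      (\<forall>y\<in>\<Omega> \<inter> ball p (r (Suc (q + k))). A * ((y - p) \<bullet> n) - (20 * d * a * \<epsilon> (q + k)) * r (Suc (q + k)) \<le> u y)" for q
  proof (induction q)
    case 0
    have "a * ((y - p) \<bullet> n) - (20 * d * a * \<epsilon> k) * r (Suc k) \<le> u y" if y: "y \<in> \<Omega> \<inter> ball p (r (Suc k))" for y
    proof -
      have "(0 + c * m - 16 * d * 0) * ((y - p) \<bullet> n) - \<epsilon> k * (2 * c * m + 32 * d * 0 + \<bar>0\<bar>) * r k \<le> u y"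
      proof (rule step[OF \<Omega> flat \<epsilon>(1,3) r zero'])
        show "0 * ((y - p) \<bullet> n) - 0 * r k \<le> u y" if "y \<in> \<Omega> \<inter> ball p (r k)" for y
          using pos[of y] sub[of k] that by auto
        show "0 * (r k / 2) - 0 * r k + m * r k \<le> u (p + (r k / 2) *\<^sub>R n)" using r[of k] by (simp add: m_def)
        show "y \<in> \<Omega> \<inter> ball p (r k / (8 * d))" using y by (simp add: r_Suc(1))
      qed (use m in auto)
      moreover have "\<epsilon> k * (2 * c * m + 32 * d * 0 + \<bar>0\<bar>) * r k = 16 * (d * a * \<epsilon> k * r (Suc k))"
        by (simp add: r_Suc(2)[of k] a_def)
      moreover have "0 \<le> d * a * \<epsilon> k * r (Suc k)" using d a \<epsilon> r[of "Suc k"] by simp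
      moreover have "(20 * d * a * \<epsilon> k) * r (Suc k) = 20 * (d * a * \<epsilon> k * r (Suc k))" by simp
      moreover have "(0 + c * m - 16 * d * 0) * ((y - p) \<bullet> n) = a * ((y - p) \<bullet> n)" by (simp add: a_def)
      ultimately show ?thesis by linarith
    qed
    then show ?case by (intro exI[of _ a]) auto
  next
    case (Suc q)
    define E where "E = 20 * d * a * \<epsilon> (q + k)"
    let ?i = "Suc (q + k)"
    obtain A where A: "a - 320 * d\<^sup>2 * a * (\<Sum>i<q. \<epsilon> (i + k)) \<le> A" "A \<le> a"
      and bd: "\<And>y. y \<in> \<Omega> \<inter> ball p (r ?i) \<Longrightarrow> A * ((y - p) \<bullet> n) - E * r ?i \<le> u y"
      using Suc unfolding E_def by blast
    have E: "0 \<le> E" using d a \<epsilon> by (simp add: E_def)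
    have "\<bar>A\<bar> \<le> a"
    proof -
      have "(d\<^sup>2 * a) * (\<Sum>i<q. \<epsilon> (i + k)) \<le> (d\<^sup>2 * a) * (1 / K)" using tail a by (intro mult_left_mono) auto
      also have "\<dots> = a * (d\<^sup>2 * (1 / K))" by simp
      also have "\<dots> \<le> a * (1 / 3000)" using dK a by (intro mult_left_mono) auto
      finally have "320 * d\<^sup>2 * a * (\<Sum>i<q. \<epsilon> (i + k)) \<le> 320 * (a * (1 / 3000))" by linarith
      then show ?thesis using A a by linarith
    qed
    have dE: "32 * d * E \<le> a"
    proof -
      have "d * E = 20 * a * (d\<^sup>2 * \<epsilon> (q + k))" by (simp add: E_def power2_eq_square)
      also have "\<dots> \<le> 20 * a * (d\<^sup>2 * (1 / K))" using a small by (intro mult_left_mono) auto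
      also have "\<dots> \<le> 20 * a * (1 / 3000)" using a dK by (intro mult_left_mono) auto
      finally show ?thesis using a by simp
    qed
    have "(A - 16 * d * E) * ((y - p) \<bullet> n) - (20 * d * a * \<epsilon> ?i) * r (Suc ?i) \<le> u y"
      if y: "y \<in> \<Omega> \<inter> ball p (r (Suc ?i))" for y
    proof -
      have "(A + c * 0 - 16 * d * E) * ((y - p) \<bullet> n) - \<epsilon> ?i * (2 * c * 0 + 32 * d * E + \<bar>A\<bar>) * r ?i \<le> u y"
      proof (rule step[OF \<Omega> flat \<epsilon>(1,3) r zero' bd E])
        show "A * (r ?i / 2) - E * r ?i + 0 * r ?i \<le> u (p + (r ?i / 2) *\<^sub>R n)"
          using bd[OF centre] n by simp
        show "y \<in> \<Omega> \<inter> ball p (r ?i / (8 * d))" using y by (simp add: r_Suc(1))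
      qed auto
      moreover have "\<epsilon> ?i * (2 * c * 0 + 32 * d * E + \<bar>A\<bar>) * r ?i \<le> \<epsilon> ?i * (2 * a) * r ?i"
        using dE \<open>\<bar>A\<bar> \<le> a\<close> \<epsilon> r[of ?i] by (intro mult_right_mono mult_left_mono) auto
      moreover have "\<epsilon> ?i * (2 * a) * r ?i = 16 * (d * a * \<epsilon> ?i * r (Suc ?i))"
        by (simp add: r_Suc(2)[of ?i])
      moreover have "0 \<le> d * a * \<epsilon> ?i * r (Suc ?i)" using d a \<epsilon> r[of "Suc ?i"] by simp
      moreover have "(20 * d * a * \<epsilon> ?i) * r (Suc ?i) = 20 * (d * a * \<epsilon> ?i * r (Suc ?i))" by simp
      moreover have "(A + c * 0 - 16 * d * E) * ((y - p) \<bullet> n) = (A - 16 * d * E) * ((y - p) \<bullet> n)" by simp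
      ultimately show ?thesis by linarith
    qed
    moreover have "a - 320 * d\<^sup>2 * a * (\<Sum>i<Suc q. \<epsilon> (i + k)) \<le> A - 16 * d * E"
      using A by (simp add: E_def algebra_simps power2_eq_square)
    moreover have "A - 16 * d * E \<le> a" using A d E by (smt (verit) mult_nonneg_nonneg)
    ultimately show ?case by (intro exI[of _ "A - 16 * d * E"]) simp
  qed
  show thesis
  \<comment> \<open>At height \<open>r i / 2\<close> a slope of at least \<open>a / 2\<close> gives
    \<open>a / 4 * r i\<close>, and the error takes away at most \<open>a / 8 * r i\<close>.\<close>
  proof (rule that[of "a / 8" "Suc k"])
    fix i assume "Suc k \<le> i"
    then obtain q where i: "i = Suc (q + k)" by (metis Suc_le_D Suc_le_mono add.commute le_Suc_ex)
    obtain A where A: "a - 320 * d\<^sup>2 * a * (\<Sum>i<q. \<epsilon> (i + k)) \<le> A"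
      and bd: "\<And>y. y \<in> \<Omega> \<inter> ball p (r i) \<Longrightarrow> A * ((y - p) \<bullet> n) - (20 * d * a * \<epsilon> (q + k)) * r i \<le> u y"
      using inv[of q] unfolding i by blast
    have "(d\<^sup>2 * a) * (\<Sum>i<q. \<epsilon> (i + k)) \<le> (d\<^sup>2 * a) * (1 / K)" using tail a by (intro mult_left_mono) auto
    also have "\<dots> = a * (d\<^sup>2 * (1 / K))" by simp
    also have "\<dots> \<le> a * (1 / 3000)" using dK a by (intro mult_left_mono) auto
    finally have "320 * d\<^sup>2 * a * (\<Sum>i<q. \<epsilon> (i + k)) \<le> 320 * (a * (1 / 3000))" by linarith
    then have A2: "a / 2 \<le> A" using A a by linarith
    have "d * a * \<epsilon> (q + k) \<le> d * a * (1 / K)" using d a small by (intro mult_left_mono) auto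
    also have "\<dots> = a * (d * (1 / K))" by simp
    also have "\<dots> \<le> a * (1 / 3000)" using dK a by (intro mult_left_mono) auto
    finally have E2: "20 * d * a * \<epsilon> (q + k) \<le> a / 8" using a by simp
    have "a / 8 * r i = (a / 2) * (r i / 2) - a / 8 * r i" by simp
    also have "\<dots> \<le> A * (r i / 2) - (20 * d * a * \<epsilon> (q + k)) * r i"
      using A2 E2 r[of i] by (intro diff_mono mult_right_mono) auto
    also have "\<dots> \<le> u (p + (r i / 2) *\<^sub>R n)" using bd[OF centre] n by simp
    finally show "p + (r i / 2) *\<^sub>R n \<in> \<Omega> \<and> a / 8 * r i \<le> u (p + (r i / 2) *\<^sub>R n)" using centre by blast
  qed (use a in simp)
qed

section \<open>The Dini condition on geometric scales\<close>

text \<open>By monotonicity, the integral of \<open>\<theta> r / r\<close> over each interval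
  between consecutive powers of \<open>l\<close> is at least \<open>1 - l\<close> times the value of
  \<open>\<theta>\<close> at the smaller endpoint.\<close>

lemma dini_modulus_summable_geometric:
  assumes "dini_modulus \<theta>" "0 < l" "l < 1"
  shows "summable (\<lambda>i. \<theta> (l ^ i))"
proof -
  let ?f = "\<lambda>r. \<theta> r / r"
  have nonneg: "0 \<le> \<theta> r" if "0 \<le> r" for r using assms that by (simp add: dini_modulus_def)
  have mono: "\<theta> r \<le> \<theta> s" if "0 \<le> r" "r \<le> s" for r s
    using assms that by (auto simp: dini_modulus_def mono_on_def)
  have int: "set_integrable lborel {0<..1} ?f" using assms by (simp add: dini_modulus_def)
  have int': "set_integrable lborel A ?f" if "A \<subseteq> {0<..1}" "A \<in> sets borel" for A
    using set_integrable_subset[OF int] that by simp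
  have l: "0 < l ^ i" "l ^ i \<le> 1" for i using assms by (auto simp: power_le_one)
  have bound: "(1 - l) * (\<Sum>i<N. \<theta> (l ^ Suc i)) \<le> (LINT r:{l ^ N<..1}|lborel. ?f r)" for N
  proof (induction N)
    case 0
    show ?case by (simp add: set_lebesgue_integral_def)
  next
    case (Suc N)
    let ?I = "{l ^ Suc N<..l ^ N}" and ?c = "\<theta> (l ^ Suc N) / l ^ N"
    have le: "l ^ Suc N \<le> l ^ N" using l assms by (simp add: mult_le_cancel_right1)
    have "(1 - l) * \<theta> (l ^ Suc N) = ((1 - l) * l ^ N) * ?c" using l(1)[of N] assms by (simp del: power_Suc)
    also have "(1 - l) * l ^ N = l ^ N - l ^ Suc N" by (simp add: algebra_simps)
    also have "(l ^ N - l ^ Suc N) * ?c = (LINT r:?I|lborel. ?c)"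
      using le by (simp add: set_integral_const del: power_Suc)
    also have "\<dots> \<le> (LINT r:?I|lborel. ?f r)"
    proof (rule set_integral_mono)
      show "set_integrable lborel ?I (\<lambda>r. ?c)" using le by (simp add: set_integrable_def)
      show "set_integrable lborel ?I ?f"
        using l(1)[of "Suc N"] l(2)[of N] by (intro int') (auto simp del: power_Suc)
      show "?c \<le> ?f r" if "r \<in> ?I" for r
        using that l(1)[of "Suc N"] nonneg mono by (intro frac_le) (auto simp del: power_Suc)
    qed
    finally have "(1 - l) * (\<Sum>i<Suc N. \<theta> (l ^ Suc i))
        \<le> (LINT r:?I|lborel. ?f r) + (LINT r:{l ^ N<..1}|lborel. ?f r)"
      using Suc by (simp add: distrib_left)
    also have "\<dots> = (LINT r:?I \<union> {l ^ N<..1}|lborel. ?f r)"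
    proof (rule set_integral_Un[symmetric])
      show "set_integrable lborel ?I ?f" "set_integrable lborel {l ^ N<..1} ?f"
        using l(1)[of "Suc N"] l(1)[of N] l(2)[of N] by (intro int'; auto simp del: power_Suc)+
    qed auto
    also have "?I \<union> {l ^ N<..1} = {l ^ Suc N<..1}" using le l(2)[of N] by (auto simp del: power_Suc)
    finally show ?case .
  qed
  have "(\<Sum>i<N. \<theta> (l ^ Suc i)) \<le> (LINT r:{0<..1}|lborel. ?f r) / (1 - l)" for N
  proof -
    have "(LINT r:{l ^ N<..1}|lborel. ?f r) \<le> (LINT r:{0<..1}|lborel. ?f r)"
      unfolding set_lebesgue_integral_def
    proof (rule integral_mono)
      show "integrable lborel (\<lambda>r. indicator {l ^ N<..1} r *\<^sub>R ?f r)"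
      proof -
        have "{l ^ N<..1} \<subseteq> {0<..1}" using less_trans[OF l(1)[of N]] by auto
        then show ?thesis using int' by (simp add: set_integrable_def)
      qed
      show "integrable lborel (\<lambda>r. indicator {0<..1} r *\<^sub>R ?f r)"
        using int by (simp add: set_integrable_def)
      show "indicator {l ^ N<..1} r *\<^sub>R ?f r \<le> indicator {0<..1} r *\<^sub>R ?f r" for r
        using l(1)[of N] nonneg by (auto simp: indicator_def)
    qed
    then have "(1 - l) * (\<Sum>i<N. \<theta> (l ^ Suc i)) \<le> (LINT r:{0<..1}|lborel. ?f r)"
      using bound[of N] by linarith
    then show ?thesis using assms by (simp add: le_divide_eq mult.commute)
  qed
  then have "summable (\<lambda>i. \<theta> (l ^ Suc i))"
    using nonneg l less_imp_le by (intro summableI_nonneg_bounded) blast+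
  then show ?thesis by (simp only: summable_Suc_iff[of "\<lambda>i. \<theta> (l ^ i)"])
qed

subsection \<open>Boundary charts\<close>

lemma hyperplane_proj_facts:
  assumes "norm \<nu> = 1"
  shows hyperplane_proj_orthogonal: "hyperplane_proj \<nu> y \<bullet> \<nu> = 0"
    and hyperplane_proj_diff: "hyperplane_proj \<nu> y - hyperplane_proj \<nu> x = hyperplane_proj \<nu> (y - x)"
    and norm_hyperplane_proj_le: "norm (hyperplane_proj \<nu> y) \<le> norm y"
    and inner_hyperplane_proj: "h \<bullet> \<nu> = 0 \<Longrightarrow> h \<bullet> hyperplane_proj \<nu> y = h \<bullet> y"
    and hyperplane_proj_add_scaleR: "hyperplane_proj \<nu> (y + t *\<^sub>R \<nu>) = hyperplane_proj \<nu> y"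
    and hyperplane_proj_ident: "h \<bullet> \<nu> = 0 \<Longrightarrow> hyperplane_proj \<nu> h = h"
proof -
  have \<nu>: "\<nu> \<bullet> \<nu> = 1" using assms by (simp add: dot_square_norm)
  show "hyperplane_proj \<nu> y \<bullet> \<nu> = 0" by (simp add: hyperplane_proj_def inner_diff_left \<nu>)
  show "hyperplane_proj \<nu> y - hyperplane_proj \<nu> x = hyperplane_proj \<nu> (y - x)"
    by (simp add: hyperplane_proj_def algebra_simps inner_diff_left)
  have "(norm (hyperplane_proj \<nu> y))\<^sup>2 = (norm y)\<^sup>2 - (y \<bullet> \<nu>)\<^sup>2"
    unfolding power2_norm_eq_inner hyperplane_proj_def
    by (simp add: inner_diff_left inner_diff_right \<nu> inner_commute[of \<nu> y] power2_eq_square)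
  then have "(norm (hyperplane_proj \<nu> y))\<^sup>2 \<le> (norm y)\<^sup>2" by simp
  then show "norm (hyperplane_proj \<nu> y) \<le> norm y" by (rule power2_le_imp_le) simp
  show "h \<bullet> hyperplane_proj \<nu> y = h \<bullet> y" if "h \<bullet> \<nu> = 0"
    using that by (simp add: hyperplane_proj_def inner_diff_right)
  show "hyperplane_proj \<nu> (y + t *\<^sub>R \<nu>) = hyperplane_proj \<nu> y"
    by (simp add: hyperplane_proj_def inner_add_left \<nu> algebra_simps)
  show "hyperplane_proj \<nu> h = h" if "h \<bullet> \<nu> = 0"
    using that by (simp add: hyperplane_proj_def)
qed

context
  fixes \<Omega> :: "'a::euclidean_space set" and p :: 'a and r :: real and \<nu> :: 'a and \<phi> :: "'a \<Rightarrow> real"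
  assumes chart: "C1_dini_chart \<Omega> p r \<nu> \<phi>"
begin

lemma chart_unit: "norm \<nu> = 1" and chart_radius: "0 < r"
  using chart by (auto simp: C1_dini_chart_def)

lemma chart_interior_iff: "y \<in> ball p r \<Longrightarrow> y \<in> \<Omega> \<longleftrightarrow> \<phi> (hyperplane_proj \<nu> y) < y \<bullet> \<nu>"
  and chart_frontier_iff: "y \<in> ball p r \<Longrightarrow> y \<in> frontier \<Omega> \<longleftrightarrow> y \<bullet> \<nu> = \<phi> (hyperplane_proj \<nu> y)"
  using chart unfolding C1_dini_chart_def Let_def by blast+

lemma chart_proj_in_disc:
  assumes "y \<in> ball p r"
  shows "hyperplane_proj \<nu> y \<in> {y. y \<bullet> \<nu> = 0} \<inter> ball (hyperplane_proj \<nu> p) r"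
proof -
  have "norm (hyperplane_proj \<nu> p - hyperplane_proj \<nu> y) \<le> norm (p - y)"
    by (simp add: hyperplane_proj_diff[OF chart_unit] norm_hyperplane_proj_le[OF chart_unit])
  then show ?thesis using assms by (simp add: dist_norm hyperplane_proj_orthogonal[OF chart_unit])
qed

lemma chart_gradient:
  obtains g \<theta> where "dini_modulus \<theta>"
    "\<forall>y\<in>{y. y \<bullet> \<nu> = 0} \<inter> ball (hyperplane_proj \<nu> p) r.
       g y \<bullet> \<nu> = 0 \<and> (\<phi> has_derivative (\<lambda>h. g y \<bullet> h)) (at y within {y. y \<bullet> \<nu> = 0})"
    "\<forall>y\<in>{y. y \<bullet> \<nu> = 0} \<inter> ball (hyperplane_proj \<nu> p) r. \<forall>z\<in>{y. y \<bullet> \<nu> = 0} \<inter> ball (hyperplane_proj \<nu> p) r.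
       norm (g y - g z) \<le> \<theta> (norm (y - z))"
  using chart unfolding C1_dini_chart_def Let_def mem_Collect_eq by blast

text \<open>The normal at \<open>x\<close> is \<open>\<nu> - g\<close> normalised, with
  \<open>g\<close> the gradient of \<open>\<phi>\<close> below \<open>x\<close>, and the first-order
  Taylor error at distance \<open>s\<close> is at most \<open>\<theta> s * s\<close>. The modulus is
  common to all points \<open>x\<close>. The constant \<open>L\<close> makes \<open>\<nu>\<close>
  uniformly transversal to the boundary, so that heights along \<open>\<nu>\<close> and along
  \<open>n\<close> are comparable.\<close>

lemma chart_flat_at:
  obtains \<theta> L where "dini_modulus \<theta>" "0 < L"
    "\<And>x. x \<in> frontier \<Omega> \<inter> ball p r \<Longrightarrow>
       \<exists>n. norm n = 1 \<and> 1 \<le> L * (\<nu> \<bullet> n) \<and> (\<forall>s>0. ball x s \<subseteq> ball p r \<longrightarrow> flat_at \<Omega> x n s (\<theta> s))"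
proof -
  let ?H = "{y. y \<bullet> \<nu> = 0}" and ?P = "hyperplane_proj \<nu>"
  define D where "D = ?H \<inter> ball (?P p) r"
  obtain g \<theta> where \<theta>: "dini_modulus \<theta>"
    and g: "\<And>y. y \<in> D \<Longrightarrow> g y \<bullet> \<nu> = 0" "\<And>y. y \<in> D \<Longrightarrow> (\<phi> has_derivative (\<lambda>h. g y \<bullet> h)) (at y within ?H)"
    and g_mod: "\<And>y z. y \<in> D \<Longrightarrow> z \<in> D \<Longrightarrow> norm (g y - g z) \<le> \<theta> (norm (y - z))"
    using chart_gradient unfolding D_def[symmetric] by metis
  have \<theta>_nonneg: "0 \<le> \<theta> s" if "0 \<le> s" for s using \<theta> that by (simp add: dini_modulus_def)
  have \<theta>_mono: "\<theta> s \<le> \<theta> t" if "0 \<le> s" "s \<le> t" for s t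
    using \<theta> that by (auto simp: dini_modulus_def mono_on_def)
  have inD: "?P y \<in> D" if "y \<in> ball p r" for y using chart_proj_in_disc[OF that] by (simp add: D_def)
  have convD: "convex D"
  proof -
    have "?H = {y. \<nu> \<bullet> y = 0}" by (simp add: inner_commute)
    then show ?thesis unfolding D_def by (simp add: convex_Int convex_hyperplane)
  qed
  \<comment> \<open>Mean value inequality for \<open>\<phi>\<close> minus its linear part at
    \<open>q0\<close>, on a convex set of points no farther from \<open>q0\<close> than
    \<open>q\<close> is.\<close>
  have taylor: "\<bar>\<phi> q - \<phi> q0 - g q0 \<bullet> (q - q0)\<bar> \<le> \<theta> (norm (q - q0)) * norm (q - q0)"
    if q: "q \<in> D" "q0 \<in> D" for q q0
  proof -
    let ?S = "D \<inter> cball q0 (norm (q - q0))" and ?f = "\<lambda>y. \<phi> y - g q0 \<bullet> y"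
    have "norm (?f q - ?f q0) \<le> \<theta> (norm (q - q0)) * norm (q - q0)"
    proof (rule differentiable_bound)
      show "convex ?S" using convD by (intro convex_Int convex_cball)
      fix y assume y: "y \<in> ?S"
      show "(?f has_derivative (\<lambda>h. (g y - g q0) \<bullet> h)) (at y within ?S)"
      proof -
        have "(\<phi> has_derivative (\<lambda>h. g y \<bullet> h)) (at y within ?S)"
          by (rule has_derivative_subset[OF g(2)]) (use y in \<open>auto simp: D_def\<close>)
        then show ?thesis by (auto intro!: derivative_eq_intros simp: inner_diff_left)
      qed
      show "onorm (\<lambda>h. (g y - g q0) \<bullet> h) \<le> \<theta> (norm (q - q0))"
      proof (rule onorm_bound)
        fix h
        have "norm ((g y - g q0) \<bullet> h) \<le> norm (g y - g q0) * norm h" using Cauchy_Schwarz_ineq2 by simp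
        also have "norm (g y - g q0) \<le> \<theta> (norm (y - q0))" using g_mod y q by blast
        also have "\<theta> (norm (y - q0)) \<le> \<theta> (norm (q - q0))"
          using y by (intro \<theta>_mono) (auto simp: dist_norm norm_minus_commute)
        finally show "norm ((g y - g q0) \<bullet> h) \<le> \<theta> (norm (q - q0)) * norm h" by (simp add: mult_right_mono)
      qed (simp add: \<theta>_nonneg)
    qed (use q in \<open>auto simp: dist_norm norm_minus_commute\<close>)
    then show ?thesis by (simp add: inner_diff_right algebra_simps)
  qed
  \<comment> \<open>Bounds the length of the unnormalised normal \<open>N\<close> at every boundary
    point of the chart; the product of \<open>\<nu>\<close> with the unit normal is
    \<open>1 / norm N\<close>.\<close>
  define L where "L = 1 + norm (g (?P p)) + \<theta> r"
  have pD: "?P p \<in> D" using inD chart_radius by simp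
  show thesis
  proof (rule that[OF \<theta>, of L])
    show "0 < L" using \<theta>_nonneg[of r] chart_radius unfolding L_def
      by (intro add_pos_nonneg) auto
    fix x assume x: "x \<in> frontier \<Omega> \<inter> ball p r"
    define G where "G = g (?P x)"
    define N where "N = \<nu> - G"
    define n where "n = (1 / norm N) *\<^sub>R N"
    have xD: "?P x \<in> D" using inD x by simp
    have G: "G \<bullet> \<nu> = 0" using g(1)[OF xD] by (simp add: G_def)
    have \<nu>N: "\<nu> \<bullet> N = 1" using G chart_unit by (simp add: N_def inner_diff_right inner_commute dot_square_norm)
    have N1: "1 \<le> norm N" using Cauchy_Schwarz_ineq2[of \<nu> N] \<nu>N chart_unit by simp
    have "norm G \<le> norm (g (?P p)) + norm (g (?P x) - g (?P p))"
      using norm_triangle_ineq[of "g (?P p)" "g (?P x) - g (?P p)"] by (simp add: G_def)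
    also have "norm (g (?P x) - g (?P p)) \<le> \<theta> (norm (?P x - ?P p))" by (rule g_mod[OF xD pD])
    also have "\<theta> (norm (?P x - ?P p)) \<le> \<theta> r"
      using xD by (intro \<theta>_mono) (auto simp: D_def dist_norm norm_minus_commute)
    finally have "norm N \<le> L"
      using norm_triangle_ineq4[of \<nu> G] chart_unit by (simp add: N_def L_def)
    moreover have "N \<noteq> 0" using N1 by auto
    ultimately have "1 \<le> L * (\<nu> \<bullet> n)" using \<nu>N by (simp add: n_def le_divide_eq)
    moreover have "norm n = 1" using N1 by (auto simp: n_def)
    moreover have "flat_at \<Omega> x n s (\<theta> s)" if s: "0 < s" "ball x s \<subseteq> ball p r" for s
      unfolding flat_at_def
    proof (intro conjI ballI)
      show "norm n = 1" by fact
      fix y assume y: "y \<in> ball x s"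
      then have yr: "y \<in> ball p r" using s by blast
      have Pxy: "norm (?P y - ?P x) \<le> norm (y - x)" "norm (y - x) < s"
        using y norm_hyperplane_proj_le[OF chart_unit, of "y - x"]
        by (simp_all add: hyperplane_proj_diff[OF chart_unit] dist_norm norm_minus_commute[of x y])
      have nonneg: "0 \<le> \<theta> s * s" using \<theta>_nonneg[of s] s by simp
      have "\<bar>\<phi> (?P y) - \<phi> (?P x) - G \<bullet> (?P y - ?P x)\<bar> \<le> \<theta> (norm (?P y - ?P x)) * norm (?P y - ?P x)"
        unfolding G_def by (rule taylor[OF inD[OF yr] xD])
      also have "\<dots> \<le> \<theta> s * s" using Pxy s \<theta>_nonneg by (intro mult_mono \<theta>_mono) auto
      finally have t: "\<bar>\<phi> (?P y) - \<phi> (?P x) - G \<bullet> (y - x)\<bar> \<le> \<theta> s * s"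
        by (simp add: hyperplane_proj_diff[OF chart_unit] inner_hyperplane_proj[OF chart_unit G])
      have xf: "x \<bullet> \<nu> = \<phi> (?P x)" using chart_frontier_iff[of x] x by blast
      \<comment> \<open>Thus the component along \<open>N\<close> is the vertical height over the
        graph plus the Taylor error. Passing to the unit normal divides by
        \<open>norm N \<ge> 1\<close>, which only improves the bounds.\<close>
      have yx: "(y - x) \<bullet> N = (y \<bullet> \<nu> - \<phi> (?P y)) + (\<phi> (?P y) - \<phi> (?P x) - G \<bullet> (y - x))"
        using xf by (simp add: N_def inner_diff_right inner_diff_left inner_commute)
      have yn: "(y - x) \<bullet> n = ((y - x) \<bullet> N) / norm N" by (simp add: n_def)
      show "y \<in> \<Omega> \<longrightarrow> - (\<theta> s * s) \<le> (y - x) \<bullet> n"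
      proof
        assume "y \<in> \<Omega>"
        then have "- (\<theta> s * s) \<le> (y - x) \<bullet> N" using chart_interior_iff[OF yr] yx t by linarith
        moreover have "\<theta> s * s * 1 \<le> \<theta> s * s * norm N" using nonneg N1 by (intro mult_left_mono) auto
        ultimately have "- (\<theta> s * s) * norm N \<le> (y - x) \<bullet> N" by simp
        then show "- (\<theta> s * s) \<le> (y - x) \<bullet> n" unfolding yn using N1 by (subst le_divide_eq) auto
      qed
      show "\<theta> s * s < (y - x) \<bullet> n \<longrightarrow> y \<in> \<Omega>"
      proof
        assume "\<theta> s * s < (y - x) \<bullet> n"
        then have "\<theta> s * s * norm N < (y - x) \<bullet> N" unfolding yn by (subst (asm) pos_less_divide_eq) (use N1 in linarith)
        moreover have "\<theta> s * s * 1 \<le> \<theta> s * s * norm N" using nonneg N1 by (intro mult_left_mono) auto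
        ultimately have "\<phi> (?P y) < y \<bullet> \<nu>" using yx t by linarith
        then show "y \<in> \<Omega>" using chart_interior_iff[OF yr] by simp
      qed
    qed
    ultimately show "\<exists>n. norm n = 1 \<and> 1 \<le> L * (\<nu> \<bullet> n) \<and> (\<forall>s>0. ball x s \<subseteq> ball p r \<longrightarrow> flat_at \<Omega> x n s (\<theta> s))"
      by blast
  qed
qed

lemma chart_continuous_on: "continuous_on ({y. y \<bullet> \<nu> = 0} \<inter> ball (hyperplane_proj \<nu> p) r) \<phi>"
proof -
  obtain g where "\<And>y. y \<in> {y. y \<bullet> \<nu> = 0} \<inter> ball (hyperplane_proj \<nu> p) r \<Longrightarrow>
      (\<phi> has_derivative (\<lambda>h. g y \<bullet> h)) (at y within {y. y \<bullet> \<nu> = 0})"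
    using chart_gradient by metis
  then have "continuous (at y within {y. y \<bullet> \<nu> = 0} \<inter> ball (hyperplane_proj \<nu> p) r) \<phi>"
    if "y \<in> {y. y \<bullet> \<nu> = 0} \<inter> ball (hyperplane_proj \<nu> p) r" for y
    using that by (meson continuous_within_subset has_derivative_continuous inf_le1)
  then show ?thesis by (simp add: continuous_on_eq_continuous_within)
qed

lemma chart_graph_near:
  assumes "0 < \<eta>"
  obtains a where "0 < a" "a \<le> r"
    "\<And>q. q \<bullet> \<nu> = 0 \<Longrightarrow> norm (q - hyperplane_proj \<nu> p) < a \<Longrightarrow> \<bar>\<phi> q - \<phi> (hyperplane_proj \<nu> p)\<bar> < \<eta>"
proof -
  have "hyperplane_proj \<nu> p \<in> {y. y \<bullet> \<nu> = 0} \<inter> ball (hyperplane_proj \<nu> p) r"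
    using chart_proj_in_disc[of p] chart_radius by simp
  then obtain b where b: "0 < b" "\<forall>q\<in>{y. y \<bullet> \<nu> = 0} \<inter> ball (hyperplane_proj \<nu> p) r.
      dist q (hyperplane_proj \<nu> p) < b \<longrightarrow> dist (\<phi> q) (\<phi> (hyperplane_proj \<nu> p)) < \<eta>"
    using chart_continuous_on assms unfolding continuous_on_iff by meson
  show thesis
    by (rule that[of "min b r"])
       (use b chart_radius in \<open>auto simp: dist_norm norm_minus_commute\<close>)
qed

text \<open>The foot point is taken along \<open>\<nu>\<close> and not as a nearest point: then
  \<open>z\<close> minus its foot point is exactly \<open>t *\<^sub>R \<nu>\<close>, and
  transversality gives its height along the normal there.\<close>

lemma chart_foot_point:
  assumes p: "p \<in> frontier \<Omega>" and "0 < \<eta>"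
  obtains b where "0 < b"
    "\<And>z. z \<in> \<Omega> \<inter> ball p b \<Longrightarrow> \<exists>t>0. t < \<eta> \<and> z - t *\<^sub>R \<nu> \<in> frontier \<Omega> \<inter> ball p \<eta>"
proof -
  \<comment> \<open>The distance from \<open>z\<close> to \<open>p\<close> costs one
    \<open>\<eta>'\<close> and the vertical move two, so the foot point stays within
    \<open>3 * \<eta>'\<close> of \<open>p\<close>.\<close>
  define \<eta>' where "\<eta>' = min \<eta> r / 4"
  have \<eta>': "0 < \<eta>'" "4 * \<eta>' \<le> \<eta>" "4 * \<eta>' \<le> r" using assms chart_radius by (auto simp: \<eta>'_def)
  obtain a where a: "0 < a" "a \<le> r"
    "\<And>q. q \<bullet> \<nu> = 0 \<Longrightarrow> norm (q - hyperplane_proj \<nu> p) < a \<Longrightarrow> \<bar>\<phi> q - \<phi> (hyperplane_proj \<nu> p)\<bar> < \<eta>'"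
    using chart_graph_near[OF \<eta>'(1)] by blast
  show thesis
  proof (rule that[of "min a \<eta>'"])
    fix z assume z: "z \<in> \<Omega> \<inter> ball p (min a \<eta>')"
    define q where "q = hyperplane_proj \<nu> z"
    define t where "t = z \<bullet> \<nu> - \<phi> q"
    have zr: "z \<in> ball p r" using z a by auto
    have nz: "norm (z - p) < a" "norm (z - p) < \<eta>'" using z by (auto simp: dist_norm norm_minus_commute)
    have t0: "0 < t" using chart_interior_iff[OF zr] z by (simp add: t_def q_def)
    have "norm (q - hyperplane_proj \<nu> p) \<le> norm (z - p)"
      by (simp add: q_def hyperplane_proj_diff[OF chart_unit] norm_hyperplane_proj_le[OF chart_unit])
    then have \<phi>: "\<bar>\<phi> q - \<phi> (hyperplane_proj \<nu> p)\<bar> < \<eta>'"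
      using nz by (intro a(3)) (auto simp: q_def hyperplane_proj_orthogonal[OF chart_unit])
    have pf: "p \<bullet> \<nu> = \<phi> (hyperplane_proj \<nu> p)" using chart_frontier_iff[of p] p chart_radius by simp
    have "\<bar>(z - p) \<bullet> \<nu>\<bar> \<le> norm (z - p)" using Cauchy_Schwarz_ineq2[of "z - p" \<nu>] chart_unit by simp
    then have t1: "t < 2 * \<eta>'" using \<phi> pf nz by (simp add: t_def inner_diff_left)
    let ?x = "z - t *\<^sub>R \<nu>"
    have "norm (?x - p) \<le> norm (z - p) + norm (t *\<^sub>R \<nu>)"
      using norm_triangle_ineq4[of "z - p" "t *\<^sub>R \<nu>"] by (simp add: algebra_simps)
    then have xp: "norm (?x - p) < 3 * \<eta>'" using t0 t1 nz chart_unit by simp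
    have "norm (?x - p) < \<eta>" "norm (?x - p) < r" using xp \<eta>' by linarith+
    then have xb: "?x \<in> ball p \<eta>" "?x \<in> ball p r" by (simp_all add: dist_norm norm_minus_commute)
    have "hyperplane_proj \<nu> ?x = q"
      using hyperplane_proj_add_scaleR[OF chart_unit, of z "- t"] by (simp add: q_def)
    moreover have "?x \<bullet> \<nu> = \<phi> q" using chart_unit by (simp add: inner_diff_left dot_square_norm t_def)
    ultimately have "?x \<in> frontier \<Omega>" using chart_frontier_iff[OF xb(2)] by simp
    then show "\<exists>t>0. t < \<eta> \<and> z - t *\<^sub>R \<nu> \<in> frontier \<Omega> \<inter> ball p \<eta>"
      using xb t0 t1 \<eta>' by (intro exI[of _ t]) auto
  qed (use a \<eta>' in auto)
qed

text \<open>The layer between the graph and a vertical translate of it, over a small disc, is the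
  continuous image of a convex product. A continuous function without zeros on it has constant
  sign.\<close>

lemma chart_connected_neighbourhood:
  assumes p: "p \<in> frontier \<Omega>" and "0 < \<eta>"
  obtains b W where "0 < b" "connected W" "\<Omega> \<inter> ball p b \<subseteq> W" "W \<subseteq> \<Omega> \<inter> ball p \<eta>"
proof -
  let ?P = "hyperplane_proj \<nu>"
  define \<eta>' where "\<eta>' = min \<eta> r / 4"
  have \<eta>': "0 < \<eta>'" "4 * \<eta>' \<le> \<eta>" "4 * \<eta>' \<le> r" using assms chart_radius by (auto simp: \<eta>'_def)
  obtain a' where a': "0 < a'" "a' \<le> r"
    "\<And>q. q \<bullet> \<nu> = 0 \<Longrightarrow> norm (q - ?P p) < a' \<Longrightarrow> \<bar>\<phi> q - \<phi> (?P p)\<bar> < \<eta>'"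
    using chart_graph_near[OF \<eta>'(1)] by blast
  define a where "a = min a' \<eta>'"
  have a: "0 < a" "a \<le> r" "a \<le> \<eta>'" "a \<le> a'" using a' \<eta>' by (auto simp: a_def)
  define D where "D = {y. y \<bullet> \<nu> = 0} \<inter> ball (?P p) a"
  \<comment> \<open>Coordinates that straighten the boundary: a base point in the hyperplane and the
    height above the graph.\<close>
  define F where "F = (\<lambda>(q, t). q + (\<phi> q + t) *\<^sub>R \<nu>)"
  define W where "W = F ` (D \<times> {0<..<2 * \<eta>'})"
  have pf: "p \<bullet> \<nu> = \<phi> (?P p)" using chart_frontier_iff[of p] p chart_radius by simp
  have p_eq: "p = ?P p + \<phi> (?P p) *\<^sub>R \<nu>" using pf by (simp add: hyperplane_proj_def)
  have \<nu>: "\<nu> \<bullet> \<nu> = 1" using chart_unit by (simp add: dot_square_norm)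
  have "connected W" unfolding W_def
  proof (rule connected_continuous_image)
    have D: "D \<subseteq> {y. y \<bullet> \<nu> = 0} \<inter> ball (?P p) r" using a by (auto simp: D_def)
    have "continuous_on (D \<times> {0<..<2 * \<eta>'}) (\<lambda>x. \<phi> (fst x))"
      by (rule continuous_on_compose2[OF continuous_on_subset[OF chart_continuous_on D]])
         (auto intro: continuous_intros)
    then show "continuous_on (D \<times> {0<..<2 * \<eta>'}) F" unfolding F_def case_prod_unfold
      by (intro continuous_intros)
    have "{y. y \<bullet> \<nu> = 0} = {y. \<nu> \<bullet> y = 0}" by (simp add: inner_commute)
    then have "convex D" unfolding D_def by (simp add: convex_Int convex_hyperplane)
    then show "connected (D \<times> {0<..<2 * \<eta>'})" by (intro convex_connected convex_Times) auto
  qed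
  moreover have "\<Omega> \<inter> ball p a \<subseteq> W"
  proof
    fix y assume y: "y \<in> \<Omega> \<inter> ball p a"
    then have yr: "y \<in> ball p r" and ny: "norm (y - p) < a" using a by (auto simp: dist_norm norm_minus_commute)
    have q: "norm (?P y - ?P p) < a"
      using ny norm_hyperplane_proj_le[OF chart_unit, of "y - p"] by (simp add: hyperplane_proj_diff[OF chart_unit])
    have t0: "0 < y \<bullet> \<nu> - \<phi> (?P y)" using chart_interior_iff[OF yr] y by simp
    have "\<bar>(y - p) \<bullet> \<nu>\<bar> \<le> norm (y - p)" using Cauchy_Schwarz_ineq2[of "y - p" \<nu>] chart_unit by simp
    moreover have "\<bar>\<phi> (?P y) - \<phi> (?P p)\<bar> < \<eta>'"
      using q a by (intro a'(3)) (auto simp: hyperplane_proj_orthogonal[OF chart_unit])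
    ultimately have "y \<bullet> \<nu> - \<phi> (?P y) < 2 * \<eta>'" using pf ny a by (simp add: inner_diff_left)
    moreover have "y = F (?P y, y \<bullet> \<nu> - \<phi> (?P y))" by (simp add: F_def hyperplane_proj_def)
    ultimately show "y \<in> W" unfolding W_def using q t0
      by (intro image_eqI[of _ _ "(?P y, y \<bullet> \<nu> - \<phi> (?P y))"])
         (auto simp: D_def dist_norm norm_minus_commute hyperplane_proj_orthogonal[OF chart_unit])
  qed
  moreover have "W \<subseteq> \<Omega> \<inter> ball p \<eta>"
  proof
    fix y assume "y \<in> W"
    then obtain q t where y: "y = q + (\<phi> q + t) *\<^sub>R \<nu>" and q: "q \<bullet> \<nu> = 0" "norm (q - ?P p) < a" and t: "0 < t" "t < 2 * \<eta>'"
      by (auto simp: W_def F_def D_def dist_norm norm_minus_commute)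
    have "\<bar>\<phi> q - \<phi> (?P p)\<bar> < \<eta>'" using q a by (intro a'(3)) auto
    then have \<phi>: "\<bar>\<phi> q - \<phi> (?P p) + t\<bar> < 3 * \<eta>'" using t by linarith
    have "y - p = (q - ?P p) + (\<phi> q - \<phi> (?P p) + t) *\<^sub>R \<nu>"
      by (subst p_eq) (simp add: y algebra_simps)
    then have "norm (y - p) \<le> norm (q - ?P p) + \<bar>\<phi> q - \<phi> (?P p) + t\<bar>"
      using norm_triangle_ineq[of "q - ?P p" "(\<phi> q - \<phi> (?P p) + t) *\<^sub>R \<nu>"] chart_unit by simp
    then have "norm (y - p) < 4 * \<eta>'" using q a \<phi> by linarith
    then have "norm (y - p) < \<eta>" "norm (y - p) < r" using \<eta>' by linarith+
    then have yb: "y \<in> ball p \<eta>" "y \<in> ball p r" by (simp_all add: dist_norm norm_minus_commute)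
    have "?P y = q" unfolding y
      by (simp only: hyperplane_proj_add_scaleR[OF chart_unit] hyperplane_proj_ident[OF chart_unit q(1)])
    moreover have "y \<bullet> \<nu> = \<phi> q + t" using q \<nu> by (simp add: y inner_add_left)
    ultimately show "y \<in> \<Omega> \<inter> ball p \<eta>" using chart_interior_iff[OF yb(2)] yb t by simp
  qed
  ultimately show thesis using a that by blast
qed

end

subsection \<open>Zeros near the boundary\<close>

lemma geometric_scale_between:
  fixes q t r0 :: real
  assumes "1 < q" "0 < r0" "0 < t" "t < r0 / q ^ j"
  obtains k where "j \<le> k" "r0 / q ^ Suc k \<le> t" "t < r0 / q ^ k"
proof -
  have "\<exists>k. r0 / q ^ Suc k \<le> t"
  proof -
    obtain k where "r0 / t < q ^ k" using real_arch_pow[OF \<open>1 < q\<close>] by blast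
    also have "q ^ k \<le> q ^ Suc k" using \<open>1 < q\<close> by (intro power_increasing) auto
    finally have "r0 / q ^ Suc k \<le> t"
      using assms zero_less_power[of q "Suc k"] by (simp add: divide_less_eq divide_le_eq mult.commute del: power_Suc)
    then show ?thesis ..
  qed
  then obtain k where k: "r0 / q ^ Suc k \<le> t" "\<And>i. i < k \<Longrightarrow> t < r0 / q ^ Suc i"
    using exists_least_iff[of "\<lambda>k. r0 / q ^ Suc k \<le> t"] by (auto simp: not_le)
  have anti: "r0 / q ^ i \<le> r0 / q ^ i'" if "i' \<le> i" for i i'
    using that assms by (intro divide_left_mono power_increasing mult_pos_pos) auto
  have "j \<le> k"
  proof (rule ccontr)
    assume "\<not> j \<le> k"
    then show False using anti[of "Suc k" j] k(1) assms(4) by (simp del: power_Suc)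
  qed
  moreover have "t < r0 / q ^ k"
  \<comment> \<open>For \<open>k = 0\<close> the minimality of \<open>k\<close> says nothing; the
    bound then comes from \<open>t < r0 / q ^ j\<close>.\<close>
  proof (cases k)
    case 0
    then show ?thesis using anti[of 0 j] assms(4) by simp
  next
    case (Suc i)
    then show ?thesis using k(2)[of i] by simp
  qed
  ultimately show thesis using that k by blast
qed

text \<open>The initial scale is a power of \<open>1 / (8 * d)\<close> so small that all later
  flatness values are below the threshold and balls of radius \<open>r0\<close> around boundary
  points in \<open>ball x r0\<close> stay inside the chart. The sequence \<open>\<epsilon>\<close>
  and the constant \<open>L\<close> serve all these points at once.\<close>

lemma chart_flat_scales:
  fixes \<Omega> :: "'a::euclidean_space set" and d :: real
  defines "d \<equiv> real DIM('a)"
  assumes chart: "C1_dini_chart \<Omega> x r \<nu> \<phi>" and "0 < R"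
  obtains r0 L :: real and \<epsilon> :: "nat \<Rightarrow> real" where "0 < r0" "2 * r0 \<le> R" "0 < L"
    "\<And>i. 0 \<le> \<epsilon> i" "summable \<epsilon>" "\<And>i. \<epsilon> i \<le> 1 / (16 * d)"
    "\<And>y. y \<in> frontier \<Omega> \<inter> ball x r0 \<Longrightarrow>
       \<exists>n. norm n = 1 \<and> 1 \<le> L * (\<nu> \<bullet> n) \<and> (\<forall>i. flat_at \<Omega> y n (r0 / (8 * d) ^ i) (\<epsilon> i))"
proof -
  have d: "1 \<le> d" unfolding d_def using DIM_positive[where 'a = 'a] by simp
  have r: "0 < r" by (rule chart_radius[OF chart])
  obtain \<theta> L where \<theta>: "dini_modulus \<theta>" and L: "0 < L" and
    flat: "\<And>y. y \<in> frontier \<Omega> \<inter> ball x r \<Longrightarrow>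
       \<exists>n. norm n = 1 \<and> 1 \<le> L * (\<nu> \<bullet> n) \<and> (\<forall>s>0. ball y s \<subseteq> ball x r \<longrightarrow> flat_at \<Omega> y n s (\<theta> s))"
    using chart_flat_at[OF chart] by blast
  define l where "l = 1 / (8 * d)"
  have l: "0 < l" "l < 1" using d by (auto simp: l_def)
  have sum: "summable (\<lambda>i. \<theta> (l ^ i))" by (rule dini_modulus_summable_geometric[OF \<theta> l])
  have "\<forall>\<^sub>F i in sequentially. \<theta> (l ^ i) < 1 / (16 * d)"
    using d by (intro order_tendstoD(2)[OF summable_LIMSEQ_zero[OF sum]]) simp
  moreover have "\<forall>\<^sub>F i in sequentially. l ^ i < min R r / 2"
    using l r \<open>0 < R\<close> by (intro order_tendstoD(2)[OF LIMSEQ_power_zero]) auto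
  ultimately have "\<forall>\<^sub>F i in sequentially. \<theta> (l ^ i) < 1 / (16 * d) \<and> l ^ i < min R r / 2"
    by (rule eventually_conj)
  then obtain k where k: "\<And>i. k \<le> i \<Longrightarrow> \<theta> (l ^ i) < 1 / (16 * d) \<and> l ^ i < min R r / 2"
    unfolding eventually_sequentially by blast
  have scale: "l ^ k / (8 * d) ^ i = l ^ (i + k)" for i
    by (simp add: l_def power_add power_divide)
  show thesis
  proof (rule that[of "l ^ k" L "\<lambda>i. \<theta> (l ^ (i + k))"])
    show "0 < l ^ k" "0 < L" using l L by auto
    show "2 * l ^ k \<le> R" using k[of k] by auto
    show "0 \<le> \<theta> (l ^ (i + k))" for i using \<theta> l by (simp add: dini_modulus_def)
    show "summable (\<lambda>i. \<theta> (l ^ (i + k)))" using sum by (simp only: summable_iff_shift[of "\<lambda>i. \<theta> (l ^ i)"])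
    show "\<theta> (l ^ (i + k)) \<le> 1 / (16 * d)" for i using k[of "i + k"] by simp
    fix y assume y: "y \<in> frontier \<Omega> \<inter> ball x (l ^ k)"
    have "l ^ k < r / 2" using k[of k] by auto
    then have "y \<in> frontier \<Omega> \<inter> ball x r" using y r by auto
    then obtain n where n: "norm n = 1" "1 \<le> L * (\<nu> \<bullet> n)" "\<And>s. 0 < s \<Longrightarrow> ball y s \<subseteq> ball x r \<Longrightarrow> flat_at \<Omega> y n s (\<theta> s)"
      using flat by blast
    have "flat_at \<Omega> y n (l ^ k / (8 * d) ^ i) (\<theta> (l ^ (i + k)))" for i
      unfolding scale
    proof (rule n(3))
      show "0 < l ^ (i + k)" using l by simp
      have "l ^ (i + k) \<le> l ^ k" using l by (intro power_decreasing) auto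
      then show "ball y (l ^ (i + k)) \<subseteq> ball x r"
        using y \<open>l ^ k < r / 2\<close> by (intro ball_subset_ball_iff[THEN iffD2]) (auto simp: dist_commute)
    qed
    then show "\<exists>n. norm n = 1 \<and> 1 \<le> L * (\<nu> \<bullet> n) \<and> (\<forall>i. flat_at \<Omega> y n (l ^ k / (8 * d) ^ i) (\<theta> (l ^ (i + k))))"
      using n by blast
  qed
qed

section \<open>Boundary gradient and nearby zeros: the two implications\<close>

lemma not_zero_gradient_of_positive:
  fixes \<Omega> :: "'a::euclidean_space set"
  assumes chart: "C1_dini_chart \<Omega> x r \<nu> \<phi>" and x: "x \<in> frontier \<Omega>" and "0 < R"
    and \<Omega>: "open \<Omega>" "harmonic_fun_on \<Omega> u" "continuous_on (closure \<Omega>) u"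
    and zero: "\<And>y. y \<in> frontier \<Omega> \<inter> ball x R \<Longrightarrow> u y = 0"
    and pos: "\<And>y. y \<in> \<Omega> \<inter> ball x R \<Longrightarrow> 0 < u y"
    and "\<Omega> \<subseteq> S"
  shows "\<not> (u has_derivative (\<lambda>h. 0)) (at x within S)"
proof
  assume der: "(u has_derivative (\<lambda>h. 0)) (at x within S)"
  define d where "d = real DIM('a)"
  have d: "1 \<le> d" unfolding d_def using DIM_positive[where 'a = 'a] by simp
  obtain r0 L :: real and \<epsilon> :: "nat \<Rightarrow> real" where r0: "0 < r0" "2 * r0 \<le> R"
    and \<epsilon>: "\<And>i. 0 \<le> \<epsilon> i" "summable \<epsilon>" "\<And>i. \<epsilon> i \<le> 1 / (16 * d)"
    and flat: "\<And>y. y \<in> frontier \<Omega> \<inter> ball x r0 \<Longrightarrow>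
       \<exists>n. norm n = 1 \<and> 1 \<le> L * (\<nu> \<bullet> n) \<and> (\<forall>i. flat_at \<Omega> y n (r0 / (8 * d) ^ i) (\<epsilon> i))"
    using chart_flat_scales[OF chart \<open>0 < R\<close>] unfolding d_def by metis
  obtain n where n: "norm n = 1" "\<And>i. flat_at \<Omega> x n (r0 / (8 * d) ^ i) (\<epsilon> i)"
    using flat[of x] x r0 by auto
  define \<rho> where "\<rho> = (\<lambda>i. r0 / (8 * d) ^ i)"
  have sub: "ball x r0 \<subseteq> ball x R" using r0 by (intro subset_ball) simp
  obtain a N where a: "0 < a" "\<And>i. N \<le> i \<Longrightarrow> x + (\<rho> i / 2) *\<^sub>R n \<in> \<Omega> \<and> a * \<rho> i \<le> u (x + (\<rho> i / 2) *\<^sub>R n)"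
    using positive_linear_growth[of \<epsilon> r0 \<Omega> u x n, folded d_def, OF \<epsilon> r0(1) \<Omega> n(2)] zero pos sub
    unfolding \<rho>_def by blast
  have "u x = 0" using zero x \<open>0 < R\<close> by simp
  \<comment> \<open>With tolerance \<open>a\<close>, a zero derivative gives at most
    \<open>a * \<rho> i / 2\<close> at distance \<open>\<rho> i / 2\<close> from \<open>x\<close>,
    half of what linear growth requires.\<close>
  then obtain \<delta> where \<delta>: "0 < \<delta>" "\<And>y. y \<in> S \<Longrightarrow> norm (y - x) < \<delta> \<Longrightarrow> norm (u y) \<le> a * norm (y - x)"
    using der \<open>0 < a\<close> unfolding has_derivative_within_alt by auto
  have \<rho>0: "0 < \<rho> i" for i using r0 d by (simp add: \<rho>_def)
  have "\<rho> \<longlonglongrightarrow> r0 * 0"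
    unfolding \<rho>_def divide_inverse power_inverse[symmetric]
    using d by (intro tendsto_mult tendsto_const LIMSEQ_power_zero) (simp add: inverse_eq_divide)
  then have "\<forall>\<^sub>F i in sequentially. \<rho> i < \<delta>" using \<delta> by (intro order_tendstoD(2)) auto
  then obtain i where i: "N \<le> i" "\<rho> i < \<delta>"
    unfolding eventually_sequentially by (meson nat_le_linear order_trans)
  let ?y = "x + (\<rho> i / 2) *\<^sub>R n"
  have "norm (?y - x) = \<rho> i / 2" using n(1) \<rho>0[of i] by simp
  then have "norm (u ?y) \<le> a * (\<rho> i / 2)" using \<delta>(2)[of ?y] a(2)[OF i(1)] \<open>\<Omega> \<subseteq> S\<close> i(2) \<rho>0[of i] by auto
  moreover have "0 < a * \<rho> i" using a \<rho>0 by simp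
  ultimately show False using a(2)[OF i(1)] by auto
qed

text \<open>For each \<open>y\<close> at scale \<open>j\<close>, a zero is taken so close to
  \<open>x\<close> that its foot point \<open>p\<close> still has \<open>y\<close> within
  \<open>\<rho> j\<close>. The uniform rate at \<open>p\<close> then bounds
  \<open>u y\<close>.\<close>

lemma zero_gradient_of_accumulating_zeros:
  fixes \<Omega> :: "'a::euclidean_space set"
  assumes chart: "C1_dini_chart \<Omega> x r \<nu> \<phi>" and x: "x \<in> frontier \<Omega>" and "0 < R"
    and \<Omega>: "open \<Omega>" "harmonic_fun_on \<Omega> u" "continuous_on (closure \<Omega>) u"
    and zero: "\<And>y. y \<in> frontier \<Omega> \<inter> ball x R \<Longrightarrow> u y = 0"
    and acc: "\<And>s. 0 < s \<Longrightarrow> \<exists>z\<in>\<Omega> \<inter> ball x s. u z = 0"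
    and T: "\<And>y. y \<in> T \<Longrightarrow> u y = 0"
  shows "(u has_derivative (\<lambda>h. 0)) (at x within \<Omega> \<union> T)"
proof -
  define d where "d = real DIM('a)"
  have d: "1 \<le> d" unfolding d_def using DIM_positive[where 'a = 'a] by simp
  obtain r0 L :: real and \<epsilon> :: "nat \<Rightarrow> real" where r0: "0 < r0" "2 * r0 \<le> R" and L: "0 < L"
    and \<epsilon>: "\<And>i. 0 \<le> \<epsilon> i" "summable \<epsilon>" "\<And>i. \<epsilon> i \<le> 1 / (16 * d)"
    and flat: "\<And>y. y \<in> frontier \<Omega> \<inter> ball x r0 \<Longrightarrow>
       \<exists>n. norm n = 1 \<and> 1 \<le> L * (\<nu> \<bullet> n) \<and> (\<forall>i. flat_at \<Omega> y n (r0 / (8 * d) ^ i) (\<epsilon> i))"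
    using chart_flat_scales[OF chart \<open>0 < R\<close>] unfolding d_def by metis
  define \<rho> where "\<rho> = (\<lambda>i. r0 / (8 * d) ^ i)"
  have \<rho>0: "0 < \<rho> i" for i using r0 d by (simp add: \<rho>_def)
  have \<rho>_le: "\<rho> i \<le> r0" for i
    using d r0 one_le_power[of "8 * d" i] by (simp add: \<rho>_def divide_le_eq mult_le_cancel_left1)
  have \<rho>_Suc: "\<rho> i = 8 * d * \<rho> (Suc i)" for i using d by (simp add: \<rho>_def)
  \<comment> \<open>The radius \<open>2 * r0\<close> covers the balls of radius \<open>r0\<close>
    around all foot points in use, so that one initial error \<open>M / r0\<close> serves them
    all.\<close>
  have "compact (closure \<Omega> \<inter> cball x (2 * r0))" by (simp add: closed_Int_compact)
  then have "bounded (u ` (closure \<Omega> \<inter> cball x (2 * r0)))"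
    using continuous_on_subset[OF \<Omega>(3)] by (intro compact_imp_bounded compact_continuous_image) auto
  then obtain M where M: "0 < M" "\<And>y. y \<in> closure \<Omega> \<inter> cball x (2 * r0) \<Longrightarrow> \<bar>u y\<bar> \<le> M"
    unfolding bounded_pos by auto
  \<comment> \<open>Consecutive scales differ by \<open>8 * d\<close>, so the scale
    \<open>\<rho> k\<close> just above \<open>t\<close> is at most \<open>8 * d * t\<close>;
    transversality costs the further factor \<open>L\<close>.\<close>
  define \<tau> where "\<tau> = 8 * d * L"
  have pos: "0 \<le> M / r0" "0 \<le> \<tau>" using M r0 L d by (auto simp: \<tau>_def)
  obtain \<kappa> :: "nat \<Rightarrow> real" where \<kappa>0: "\<kappa> \<longlonglongrightarrow> 0" and
    \<kappa>: "\<And>(\<Omega> :: 'a set) u p n j k z y. \<lbrakk>open \<Omega>; harmonic_fun_on \<Omega> u; continuous_on (closure \<Omega>) u;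
       \<And>i. flat_at \<Omega> p n (r0 / (8 * d) ^ i) (\<epsilon> i);
       \<And>y. y \<in> frontier \<Omega> \<inter> ball p r0 \<Longrightarrow> u y = 0;
       \<And>y. y \<in> \<Omega> \<inter> ball p r0 \<Longrightarrow> abs (u y) \<le> M / r0 * r0;
       j \<le> k; z \<in> \<Omega> \<inter> ball p (r0 / (8 * d) ^ k); u z = 0; r0 / (8 * d) ^ k \<le> \<tau> * ((z - p) \<bullet> n);
       y \<in> \<Omega> \<inter> ball p (r0 / (8 * d) ^ j)\<rbrakk>
     \<Longrightarrow> abs (u y) \<le> \<kappa> j * (r0 / (8 * d) ^ j)"
    using uniform_vanishing_rate[where 'a = 'a, folded d_def, OF \<epsilon> r0(1) pos] by blast
  have decay: "\<bar>u y\<bar> \<le> \<kappa> j * \<rho> j" if y: "y \<in> \<Omega> \<inter> ball x (\<rho> j)" for y j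
  proof -
    \<comment> \<open>The first bound keeps \<open>y\<close> in \<open>ball p (\<rho> j)\<close>;
      the second gives \<open>t < \<rho> j\<close>, so that the scale of the zero is no larger than
      scale \<open>j\<close>.\<close>
    define \<eta> where "\<eta> = min (\<rho> j - dist x y) (\<rho> j)"
    have \<eta>: "0 < \<eta>" "\<eta> \<le> \<rho> j - dist x y" "\<eta> \<le> \<rho> j" using y \<rho>0[of j] by (auto simp: \<eta>_def)
    obtain b where b: "0 < b" "\<And>z. z \<in> \<Omega> \<inter> ball x b \<Longrightarrow> \<exists>t>0. t < \<eta> \<and> z - t *\<^sub>R \<nu> \<in> frontier \<Omega> \<inter> ball x \<eta>"
      using chart_foot_point[OF chart x \<eta>(1)] by blast
    obtain z where z: "z \<in> \<Omega> \<inter> ball x b" "u z = 0" using acc[OF b(1)] by blast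
    obtain t where t: "0 < t" "t < \<eta>" "z - t *\<^sub>R \<nu> \<in> frontier \<Omega> \<inter> ball x \<eta>" using b(2)[OF z(1)] by blast
    define p where "p = z - t *\<^sub>R \<nu>"
    have p: "p \<in> frontier \<Omega>" "dist x p < \<eta>" using t by (auto simp: p_def)
    have "t < \<rho> j" using t \<eta> by linarith
    then obtain k where k: "j \<le> k" "\<rho> (Suc k) \<le> t" "t < \<rho> k"
      using geometric_scale_between[of "8 * d" r0 t j] d r0 t(1) unfolding \<rho>_def by auto
    have pr: "dist x p < r0" using p \<eta> \<rho>_le[of j] by linarith
    obtain n where n: "norm n = 1" "1 \<le> L * (\<nu> \<bullet> n)" "\<And>i. flat_at \<Omega> p n (\<rho> i) (\<epsilon> i)"
      using flat[of p] p pr unfolding \<rho>_def by auto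
    have near: "w \<in> ball x (2 * r0)" if "w \<in> ball p r0" for w
      using that pr dist_triangle[of x w p] by (simp add: dist_commute)
    have "ball x (2 * r0) \<subseteq> ball x R" using r0 by (intro subset_ball)
    show ?thesis unfolding \<rho>_def
    proof (rule \<kappa>[OF \<Omega>, of p n j k z])
      show "flat_at \<Omega> p n (r0 / (8 * d) ^ i) (\<epsilon> i)" for i using n(3)[of i] by (simp add: \<rho>_def)
      show "u w = 0" if "w \<in> frontier \<Omega> \<inter> ball p r0" for w
        using zero near that \<open>ball x (2 * r0) \<subseteq> ball x R\<close> by blast
      show "\<bar>u w\<bar> \<le> M / r0 * r0" if "w \<in> \<Omega> \<inter> ball p r0" for w
        using M(2)[of w] near[of w] that r0 closure_subset[of \<Omega>] by auto
      have zp: "z - p = t *\<^sub>R \<nu>" by (simp add: p_def)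
      have "norm (z - p) = t" using chart_unit[OF chart] t(1) by (simp add: zp)
      then show "z \<in> \<Omega> \<inter> ball p (r0 / (8 * d) ^ k)"
        using z k(3) by (simp add: dist_norm norm_minus_commute \<rho>_def)
      have "\<rho> k \<le> 8 * d * t" using k(2) d unfolding \<rho>_Suc[of k] by (intro mult_left_mono) auto
      also have "\<dots> \<le> 8 * d * t * (L * (\<nu> \<bullet> n))" using n(2) d t(1) mult_left_mono[OF n(2), of "8 * d * t"] by simp
      also have "\<dots> = \<tau> * ((z - p) \<bullet> n)" by (simp add: zp \<tau>_def)
      finally show "r0 / (8 * d) ^ k \<le> \<tau> * ((z - p) \<bullet> n)" by (simp add: \<rho>_def)
      have "dist p y < \<rho> j" using p \<eta> dist_triangle[of p y x] by (simp add: dist_commute)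
      then show "y \<in> \<Omega> \<inter> ball p (r0 / (8 * d) ^ j)" using y by (simp add: \<rho>_def)
    qed (use k z in auto)
  qed
  have "u x = 0" using zero x \<open>0 < R\<close> by simp
  show ?thesis unfolding has_derivative_within_alt
  proof (intro conjI allI impI)
    fix e :: real assume "0 < e"
    \<comment> \<open>The factor \<open>8 * d\<close> is the price of rounding
      \<open>norm (y - x)\<close> up to a scale \<open>\<rho> j\<close>.\<close>
    then have "0 < e / (8 * d)" using d by simp
    then have "\<forall>\<^sub>F j in sequentially. \<kappa> j < e / (8 * d)"
      using \<kappa>0 by (intro order_tendstoD(2))
    then obtain J where J: "\<And>j. J \<le> j \<Longrightarrow> \<kappa> j < e / (8 * d)" unfolding eventually_sequentially by blast
    have "norm (u y) \<le> e * norm (y - x)" if y: "y \<in> \<Omega>" "norm (y - x) < \<rho> J" for y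
    proof -
      have "x \<notin> \<Omega>" using x \<open>open \<Omega>\<close> by (simp add: frontier_def interior_open)
      then have "0 < norm (y - x)" using y by auto
      then obtain j where j: "J \<le> j" "\<rho> (Suc j) \<le> norm (y - x)" "norm (y - x) < \<rho> j"
        using geometric_scale_between[of "8 * d" r0 "norm (y - x)" J] d r0 y(2) unfolding \<rho>_def by auto
      have "\<bar>u y\<bar> \<le> \<kappa> j * \<rho> j" using decay[of y j] y(1) j(3) by (simp add: dist_norm norm_minus_commute)
      also have "\<dots> \<le> e / (8 * d) * \<rho> j" using J[OF j(1)] \<rho>0[of j] by (intro mult_right_mono) auto
      also have "\<dots> = e * \<rho> (Suc j)" using d by (simp add: \<rho>_Suc[of j])
      also have "\<dots> \<le> e * norm (y - x)" using j(2) \<open>0 < e\<close> by (intro mult_left_mono) auto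
      finally show ?thesis by simp
    qed
    then show "\<exists>\<delta>>0. \<forall>y\<in>\<Omega> \<union> T. norm (y - x) < \<delta> \<longrightarrow> norm (u y - u x - 0) \<le> e * norm (y - x)"
      using \<rho>0[of J] T \<open>u x = 0\<close> \<open>0 < e\<close> by (intro exI[of _ "\<rho> J"]) auto
  qed simp
qed

theorem proposition1p9:
  fixes \<Omega> \<Sigma> :: "'a::euclidean_space set" and u :: "'a \<Rightarrow> real" and z :: 'a and \<rho> :: real
  assumes "C1_dini_domain \<Omega>"
    and "z \<in> frontier \<Omega>" and "0 < \<rho>"
    and "\<Sigma> = ball z \<rho> \<inter> frontier \<Omega>"
    and "harmonic_fun_on \<Omega> u"
    and "continuous_on (closure \<Omega>) u"
    and "\<forall>x\<in>\<Sigma>. u x = 0"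
  shows "singular_set \<Omega> \<Sigma> u = zero_accumulation_set \<Omega> \<Sigma> u"
proof -
  have "open \<Omega>" using assms(1) by (simp add: C1_dini_domain_def)
  \<comment> \<open>A gradient of norm 0 is the zero vector, so the left side is membership in
    \<open>singular_set\<close>, with existence of the derivative included.\<close>
  have "(u has_derivative (\<lambda>h. 0)) (at x within \<Omega> \<union> \<Sigma>) \<longleftrightarrow> (\<forall>s>0. u -` {0} \<inter> ball x s \<inter> \<Omega> \<noteq> {})"
    if x: "x \<in> \<Sigma>" for x
  proof -
    have xf: "x \<in> frontier \<Omega>" "x \<in> ball z \<rho>" using x assms(4) by auto
    obtain r \<nu> \<phi> where chart: "C1_dini_chart \<Omega> x r \<nu> \<phi>"
      using assms(1) xf unfolding C1_dini_domain_def by blast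
    obtain R where R: "0 < R" "ball x R \<subseteq> ball z \<rho>" using xf(2) open_ball by (meson openE)
    have zero: "u y = 0" if "y \<in> frontier \<Omega> \<inter> ball x R" for y using that R assms(4,7) by blast
    show ?thesis
    proof
      assume "\<forall>s>0. u -` {0} \<inter> ball x s \<inter> \<Omega> \<noteq> {}"
      then have "\<exists>z\<in>\<Omega> \<inter> ball x s. u z = 0" if "0 < s" for s using that by blast
      then show "(u has_derivative (\<lambda>h. 0)) (at x within \<Omega> \<union> \<Sigma>)"
        using zero_gradient_of_accumulating_zeros[OF chart xf(1) R(1) \<open>open \<Omega>\<close> assms(5,6) zero] assms(7) by blast
    next
      assume der: "(u has_derivative (\<lambda>h. 0)) (at x within \<Omega> \<union> \<Sigma>)"
      show "\<forall>s>0. u -` {0} \<inter> ball x s \<inter> \<Omega> \<noteq> {}"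
      proof (intro allI impI notI)
        fix s :: real assume "0 < s" and nz: "u -` {0} \<inter> ball x s \<inter> \<Omega> = {}"
        obtain b W where W: "0 < b" "connected W" "\<Omega> \<inter> ball x b \<subseteq> W" "W \<subseteq> \<Omega> \<inter> ball x s"
          using chart_connected_neighbourhood[OF chart xf(1) \<open>0 < s\<close>] by blast
        have nzW: "u w \<noteq> 0" if "w \<in> W" for w using nz W(4) that by blast
        have "continuous_on W u"
          using W(4) closure_subset by (intro continuous_on_subset[OF assms(6)]) blast
        then have "connected (u ` W)" using W(2) by (rule connected_continuous_image)
        \<comment> \<open>A connected set of reals that misses 0 lies on one side of it. In the
          negative case the positivity argument is applied to \<open>- u\<close>.\<close>
        then have "(\<forall>w\<in>W. 0 < u w) \<or> (\<forall>w\<in>W. 0 < - u w)"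
          using nzW connectedD_interval[of "u ` W" _ _ 0] by (smt (verit) image_iff)
        moreover have "0 < min b R" "\<Omega> \<inter> ball x (min b R) \<subseteq> W" using W R by auto
        moreover have zero': "u y = 0" if "y \<in> frontier \<Omega> \<inter> ball x (min b R)" for y using zero that by auto
        moreover have "((\<lambda>y. - u y) has_derivative (\<lambda>h. 0)) (at x within \<Omega> \<union> \<Sigma>)"
          using has_derivative_minus[OF der] by simp
        moreover have "harmonic_fun_on \<Omega> (\<lambda>y. - u y)" "continuous_on (closure \<Omega>) (\<lambda>y. - u y)"
          using assms(5,6) by (auto intro: harmonic_fun_on_uminus continuous_on_minus)
        ultimately show False
          using not_zero_gradient_of_positive[OF chart xf(1), of "min b R" u "\<Omega> \<union> \<Sigma>"]
            not_zero_gradient_of_positive[OF chart xf(1), of "min b R" "\<lambda>y. - u y" "\<Omega> \<union> \<Sigma>"]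
            der \<open>open \<Omega>\<close> assms(5,6) by (metis Un_upper1 neg_equal_0_iff_equal subsetD)
      qed
    qed
  qed
  moreover have "(\<bullet>) (0::'a) = (\<lambda>h. 0)" by (rule ext) simp
  ultimately show ?thesis
    by (auto simp: singular_set_def zero_accumulation_set_def has_gradient_within_def)
qed

end
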